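(* For any integers $k,m\geq 2$, the group $\mathbb F_k\times\mathbb F_m$ is not flexibly HS-stable.
   Context: $\mathbb F_k$ denotes the free group on $k$ generators. For $A\in\mathbb M_d(\mathbb C)$, $\|A\|_2=(\frac1d\sum_{i,j}|a_{i,j}|^2)^{1/2}$ is the normalized Hilbert–Schmidt norm, and $\mathrm U(d)$ is the group of $d\times d$ unitary matrices. For a countable group $\Gamma$, a sequence of maps $\varphi_n:\Gamma\to\mathrm U(d_n)$ ($d_n\in\mathbb N$) is an asymptotic homomorphism if $\lim_{n\to\infty}\|\varphi_n(gh)-\varphi_n(g)\varphi_n(h)\|_2=0$ for all $g,h\in\Gamma$. $\Gamma$ is flexibly HS-stable if for every asymptotic homomorphism $\varphi_n:\Gamma\to\mathrm U(d_n)$ there exist homomorphisms $\rho_n:\Gamma\to\mathrm U(D_n)$, with $D_n\geq d_n$ and $\lim_{n\to\infty}D_n/d_n=1$, such that $\lim_{n\to\infty}\|\varphi_n(g)-p_n\rho_n(g)p_n\|_2=0$ for every $g\in\Gamma$, where $p_n:\mathbb C^{D_n}\to\mathbb C^{d_n}$ is the orthogonal projection (and $p_n\rho_n(g)p_n$ is viewed as a $d_n\times d_n$ matrix). *)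

theory Defs
  imports "HOL-Algebra.Group" "Jordan_Normal_Form.Matrix"
begin

text \<open>A letter (i, b) stands for the generator x_i (b = True) or its inverse (b = False).\<close>

definition inv_letter :: "nat \<times> bool \<Rightarrow> nat \<times> bool \<Rightarrow> bool" where
  "inv_letter x y \<longleftrightarrow> fst x = fst y \<and> snd x \<noteq> snd y"

fun reduced :: "(nat \<times> bool) list \<Rightarrow> bool" where
  "reduced [] = True"
| "reduced [x] = True"
| "reduced (x # y # ys) = (\<not> inv_letter x y \<and> reduced (y # ys))"

definition reduce :: "(nat \<times> bool) list \<Rightarrow> (nat \<times> bool) list" where
  "reduce xs = foldr (\<lambda>x acc. case acc of
       [] \<Rightarrow> [x]
     | y # ys \<Rightarrow> (if inv_letter x y then ys else x # acc)) xs []"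

definition free_group :: "nat \<Rightarrow> (nat \<times> bool) list monoid" where
  "free_group k = \<lparr> carrier = {w. reduced w \<and> (\<forall>x\<in>set w. fst x < k)},
                    mult = (\<lambda>u v. reduce (u @ v)),
                    one = [] \<rparr>"

definition adjoint_mat :: "complex mat \<Rightarrow> complex mat" where
  "adjoint_mat A = mat (dim_col A) (dim_row A) (\<lambda>(i, j). cnj (A $$ (j, i)))"

definition unitary_mats :: "nat \<Rightarrow> complex mat set" where
  "unitary_mats d = {U \<in> carrier_mat d d. U * adjoint_mat U = 1\<^sub>m d \<and> adjoint_mat U * U = 1\<^sub>m d}"

definition hs_norm :: "complex mat \<Rightarrow> real" where
  "hs_norm A = sqrt ((1 / real (dim_row A)) *
      (\<Sum>i<dim_row A. \<Sum>j<dim_col A. (cmod (A $$ (i, j)))\<^sup>2))"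

definition asymptotic_hom ::
  "('a, 'b) monoid_scheme \<Rightarrow> (nat \<Rightarrow> nat) \<Rightarrow> (nat \<Rightarrow> 'a \<Rightarrow> complex mat) \<Rightarrow> bool" where
  "asymptotic_hom G d \<phi> \<longleftrightarrow>
     (\<forall>n. d n \<ge> 1) \<and>
     (\<forall>n. \<forall>g\<in>carrier G. \<phi> n g \<in> unitary_mats (d n)) \<and>
     (\<forall>g\<in>carrier G. \<forall>h\<in>carrier G.
        (\<lambda>n. hs_norm (\<phi> n (g \<otimes>\<^bsub>G\<^esub> h) - \<phi> n g * \<phi> n h)) \<longlonglongrightarrow> 0)"

definition unitary_rep :: "('a, 'b) monoid_scheme \<Rightarrow> nat \<Rightarrow> ('a \<Rightarrow> complex mat) \<Rightarrow> bool" where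
  "unitary_rep G D \<rho> \<longleftrightarrow>
     (\<forall>g\<in>carrier G. \<rho> g \<in> unitary_mats D) \<and>
     (\<forall>g\<in>carrier G. \<forall>h\<in>carrier G. \<rho> (g \<otimes>\<^bsub>G\<^esub> h) = \<rho> g * \<rho> h)"

text \<open>Compression p A p to the first d coordinates, viewed as a d x d matrix.\<close>
definition compress :: "nat \<Rightarrow> complex mat \<Rightarrow> complex mat" where
  "compress d A = mat d d (\<lambda>(i, j). A $$ (i, j))"

definition flexibly_HS_stable :: "('a, 'b) monoid_scheme \<Rightarrow> bool" where
  "flexibly_HS_stable G \<longleftrightarrow>
     (\<forall>d \<phi>. asymptotic_hom G d \<phi> \<longrightarrow>
        (\<exists>D \<rho>. (\<forall>n. D n \<ge> d n) \<and>
               (\<lambda>n. real (D n) / real (d n)) \<longlonglongrightarrow> 1 \<and>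
               (\<forall>n. unitary_rep G (D n) (\<rho> n)) \<and>
               (\<forall>g\<in>carrier G. (\<lambda>n. hs_norm (\<phi> n g - compress (d n) (\<rho> n g))) \<longlonglongrightarrow> 0)))"

end

(* The counterexample to stability. Let n = 2h + 1, let R represent Z/n and let F_k act on
   C^R (x) C^R (x) (C^2)^(x R) by  a = sum_b delta(b) e_bb (x) 1 (x) X_b  and the Fourier matrix of the
   first factor, F_m by  a' = sum_g delta(g) 1 (x) e_gg (x) Z_g  and the Fourier matrix of the
   second factor; the remaining generators act trivially. Here X_b and Z_b are the Pauli matrices of
   the b-th qubit and delta(b)^2 is a quadratic phase D. All these commute except for the n blocks
   b = g, out of n^2, on which a and a' anticommute, so the commutator has normalized norm 2/sqrt n.

   Since X_b^2 = 1, a^2 is the phase D tensored with 1. Conjugation by D and by the Fourier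
   matrix acts on Weyl coefficients as a shear and a rotation of (Z/n)^2 with phases, and this action has
   a spectral gap independent of n: the phases force almost invariant vectors to live near the
   origin, where ping-pong applies. Hence a unitary that commutes with operators close to a and to the
   Fourier matrix almost commutes with all matrix units e_ib of the first factor, and the same
   holds for the second factor.

   Suppose that commuting unitary representations on a slightly larger space are close to this.
   An averaging argument replaces e_ib by operators in the bicommutant of the images of two generators
   of F_k, and the matrix units f_ig of the second factor by operators in the bicommutant of the
   images of two generators of F_m, which commute with the former. Now delta(i) X_i = sum_b e_bi a e_ib,
   and likewise delta(i) Z_i is obtained from f and a', so for most i the matrices delta(i) X_i and
   delta(i) Z_i are close in normalized norm to commuting contractions. But X_i Z_i = - Z_i X_i. *)

theory Submission
  imports Defs "HOL-Analysis.Inner_Product" "HOL-Analysis.L2_Norm" "HOL-Analysis.Elementary_Metric_Spaces"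
begin

section \<open>Finitely supported matrices\<close>

text \<open>The linear term of \<open>chirp\<close> is essential. The phase w (- i * i) and the
  Fourier matrix both commute with the parity i -> - i, which is not scalar for n > 1, so without
  that term there would be no gap. Since \<open>beta\<close> inverts 2 modulo the odd n, the chirp
  divided by its mirror image is the plain character w i. The square of the Fourier matrix is the
  parity, so an almost invariant vector is almost invariant under this character too, which confines
  it to |a| <= n / 6. There the shear does not wrap around, and a problem modulo n becomes ping-pong
  over the integers. The obstruction has to survive n -> infinity. The defect is of order 1 / sqrt
  n, while each estimate is linear in the squared error with a constant free of n: 4500 from
  ping-pong, 9000 for commutators with matrix units, 4 * (360 * 9000 + 39) < 13000000 at the end.
  Only the total error over the n^2 matrix units is controlled, by n times the squared error, so the
  contradiction is drawn from an average over i. Passing to a compression costs little: if a unitary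
  has a compression close to a unitary of almost full dimension, it is itself close to that unitary
  extended by zero.\<close>

text \<open>An arbitrary index type lets a space and its enlargement live in one algebra: operators
  on the smaller space are extended by zero, and identity operators of finite index sets become the
  projections \<open>unit J\<close>.\<close>

typedef 'i fmat = "{f :: 'i \<Rightarrow> 'i \<Rightarrow> complex. finite {i. \<exists>j. f i j \<noteq> 0 \<or> f j i \<noteq> 0}}"
  morphisms ent Fmat
  by (rule exI[of _ "\<lambda>_ _. 0"]) simp

text \<open>Rows and columns share one support, so an inclusion of \<open>supp x\<close> in J says
  that x lives on the square block of J.\<close>

definition supp :: "'i fmat \<Rightarrow> 'i set" where
  "supp x = {i. \<exists>j. ent x i j \<noteq> 0 \<or> ent x j i \<noteq> 0}"

lemma finite_supp [simp]: "finite (supp x)"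
  using ent[of x] by (simp add: supp_def)

lemma not_supp: "i \<notin> supp x \<or> j \<notin> supp x \<Longrightarrow> ent x i j = 0"
  by (auto simp: supp_def)

lemma supp_subsetI:
  assumes "\<And>i j. i \<notin> K \<or> j \<notin> K \<Longrightarrow> ent x i j = 0"
  shows "supp x \<subseteq> K"
proof
  fix i assume "i \<in> supp x"
  then obtain j where "ent x i j \<noteq> 0 \<or> ent x j i \<noteq> 0" by (auto simp: supp_def)
  then show "i \<in> K" using assms[of i j] assms[of j i] by argo
qed

lemma fmat_eqI: "(\<And>i j. ent x i j = ent y i j) \<Longrightarrow> x = y"
  by (metis ent_inject ext)

lemma ent_Fmat:
  assumes "finite K" "\<And>i j. i \<notin> K \<or> j \<notin> K \<Longrightarrow> f i j = 0"
  shows "ent (Fmat f) i j = f i j"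
proof -
  have "{i. \<exists>j. f i j \<noteq> 0 \<or> f j i \<noteq> 0} \<subseteq> K" using assms(2) by blast
  then have "finite {i. \<exists>j. f i j \<noteq> 0 \<or> f j i \<noteq> 0}" using assms(1) finite_subset by blast
  then show ?thesis by (simp add: Fmat_inverse)
qed

definition mkf :: "'i set \<Rightarrow> ('i \<Rightarrow> 'i \<Rightarrow> complex) \<Rightarrow> 'i fmat" where
  "mkf K f = Fmat (\<lambda>i j. if i \<in> K \<and> j \<in> K then f i j else 0)"

lemma ent_mkf: "finite K \<Longrightarrow> ent (mkf K f) i j = (if i \<in> K \<and> j \<in> K then f i j else 0)"
  unfolding mkf_def by (rule ent_Fmat) auto

lemma supp_mkf: "finite K \<Longrightarrow> supp (mkf K f) \<subseteq> K"
  by (auto simp: supp_def ent_mkf split: if_splits)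

text \<open>The real part of the trace of x times the adjoint of y. The real part is what the class
  \<open>real_inner\<close> asks for, and it yields the Frobenius norm, without
  normalization.\<close>

definition hs_inner :: "'i fmat \<Rightarrow> 'i fmat \<Rightarrow> real" where
  "hs_inner x y = (\<Sum>i\<in>supp x. \<Sum>j\<in>supp x. Re (ent x i j * cnj (ent y i j)))"

instantiation fmat :: (type) "{zero, plus, minus, uminus, times, scaleR, norm, dist, sgn, uniformity, open}"
begin
definition "0 = Fmat (\<lambda>_ _. 0)"
definition "x + y = Fmat (\<lambda>i j. ent x i j + ent y i j)"
definition "x - y = Fmat (\<lambda>i j. ent x i j - ent y i j)"
definition "- x = Fmat (\<lambda>i j. - ent x i j)"
definition "x * y = Fmat (\<lambda>i j. \<Sum>k\<in>supp x. ent x i k * ent y k j)"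
definition scaleR_fmat :: "real \<Rightarrow> 'a fmat \<Rightarrow> 'a fmat" where "scaleR_fmat r x = Fmat (\<lambda>i j. of_real r * ent x i j)"
definition norm_fmat :: "'a fmat \<Rightarrow> real" where "norm_fmat x = sqrt (hs_inner x x)"
definition dist_fmat :: "'a fmat \<Rightarrow> 'a fmat \<Rightarrow> real" where "dist_fmat x y = norm (x - y)"
definition sgn_fmat :: "'a fmat \<Rightarrow> 'a fmat" where "sgn_fmat x = Fmat (\<lambda>i j. of_real (inverse (norm x)) * ent x i j)"
definition uniformity_fmat :: "('a fmat \<times> 'a fmat) filter" where
  "uniformity_fmat = (INF e\<in>{0 <..}. principal {(x, y). dist x y < e})"
definition open_fmat :: "'a fmat set \<Rightarrow> bool" where
  "open_fmat U = (\<forall>x\<in>U. eventually (\<lambda>(x', y). x' = x \<longrightarrow> y \<in> U) uniformity)"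
instance ..
end

definition adj :: "'i fmat \<Rightarrow> 'i fmat" where "adj x = Fmat (\<lambda>i j. cnj (ent x j i))"

definition scaleC :: "complex \<Rightarrow> 'i fmat \<Rightarrow> 'i fmat" where
  "scaleC c x = Fmat (\<lambda>i j. c * ent x i j)"

lemma ent_zero [simp]: "ent 0 i j = 0"
  unfolding zero_fmat_def by (rule ent_Fmat[of "{}"]) auto

lemma ent_plus [simp]: "ent (x + y) i j = ent x i j + ent y i j"
  unfolding plus_fmat_def by (rule ent_Fmat[of "supp x \<union> supp y"]) (auto simp: not_supp)

lemma ent_minus [simp]: "ent (x - y) i j = ent x i j - ent y i j"
  unfolding minus_fmat_def by (rule ent_Fmat[of "supp x \<union> supp y"]) (auto simp: not_supp)

lemma ent_uminus [simp]: "ent (- x) i j = - ent x i j"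
  unfolding uminus_fmat_def by (rule ent_Fmat[of "supp x"]) (auto simp: not_supp)

lemma ent_scaleR [simp]: "ent (scaleR r x) i j = of_real r * ent x i j"
  unfolding scaleR_fmat_def by (rule ent_Fmat[of "supp x"]) (auto simp: not_supp)

lemma ent_scaleC [simp]: "ent (scaleC r x) i j = r * ent x i j"
  unfolding scaleC_def by (rule ent_Fmat[of "supp x"]) (auto simp: not_supp)

lemma ent_adj [simp]: "ent (adj x) i j = cnj (ent x j i)"
  unfolding adj_def by (rule ent_Fmat[of "supp x"]) (auto simp: not_supp)

lemma supp_adj [simp]: "supp (adj x) = supp x"
  by (auto simp: supp_def)

lemma ent_times_supp: "ent (x * y) i j = (\<Sum>k\<in>supp x. ent x i k * ent y k j)"
  unfolding times_fmat_def
  by (rule ent_Fmat[of "supp x \<union> supp y"]) (auto simp: not_supp)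

lemma ent_times:
  assumes "finite K" "supp x \<inter> supp y \<subseteq> K"
  shows "ent (x * y) i j = (\<Sum>k\<in>K. ent x i k * ent y k j)"
proof -
  have *: "(\<Sum>k\<in>L. ent x i k * ent y k j) = (\<Sum>k\<in>supp x \<inter> supp y. ent x i k * ent y k j)"
    if "finite L" "supp x \<inter> supp y \<subseteq> L" for L
  proof (intro sum.mono_neutral_right ballI that)
    fix k assume "k \<in> L - supp x \<inter> supp y"
    then show "ent x i k * ent y k j = 0" by (cases "k \<in> supp x") (simp_all add: not_supp)
  qed
  show ?thesis unfolding ent_times_supp using *[of "supp x"] *[of K] assms by simp
qed

lemma supp_times: "supp (x * y) \<subseteq> supp x \<union> supp y"
proof
  fix i assume "i \<in> supp (x * y)"
  then obtain j where "ent (x * y) i j \<noteq> 0 \<or> ent (x * y) j i \<noteq> 0" by (auto simp: supp_def)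
  then show "i \<in> supp x \<union> supp y"
  proof (rule contrapos_pp)
    assume i: "i \<notin> supp x \<union> supp y"
    have "ent (x * y) i j = 0" "ent (x * y) j i = 0"
      unfolding ent_times_supp using i by (auto intro!: sum.neutral simp: not_supp)
    then show "\<not> (ent (x * y) i j \<noteq> 0 \<or> ent (x * y) j i \<noteq> 0)" by simp
  qed
qed

lemma hs_inner_eq:
  assumes "finite K" "supp x \<inter> supp y \<subseteq> K"
  shows "hs_inner x y = (\<Sum>i\<in>K. \<Sum>j\<in>K. Re (ent x i j * cnj (ent y i j)))"
proof -
  have *: "(\<Sum>i\<in>L. \<Sum>j\<in>L. Re (ent x i j * cnj (ent y i j)))
     = (\<Sum>i\<in>supp x \<inter> supp y. \<Sum>j\<in>supp x \<inter> supp y. Re (ent x i j * cnj (ent y i j)))"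
    if "finite L" "supp x \<inter> supp y \<subseteq> L" for L
    unfolding sum.cartesian_product
  proof (intro sum.mono_neutral_right ballI)
    fix p assume p: "p \<in> L \<times> L - (supp x \<inter> supp y) \<times> (supp x \<inter> supp y)"
    obtain i j where ij: "p = (i, j)" by force
    have "i \<notin> supp x \<or> j \<notin> supp x \<or> i \<notin> supp y \<or> j \<notin> supp y" using p by (simp add: ij)
    then have "ent x i j = 0 \<or> ent y i j = 0" using not_supp[of i x j] not_supp[of i y j] by argo
    then show "(case p of (i, j) \<Rightarrow> Re (ent x i j * cnj (ent y i j))) = 0"
      unfolding ij by (elim disjE) simp_all
  qed (use that in auto)
  show ?thesis unfolding hs_inner_def using *[of "supp x"] *[of K] assms by simp
qed

instance fmat :: (type) ring
proof
  fix a b c :: "'a fmat"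
  show "a * b * c = a * (b * c)"
  proof (rule fmat_eqI)
    fix i j
    define K where "K = supp a \<union> supp b \<union> supp c"
    have K: "finite K" by (simp add: K_def)
    have "ent (a * b * c) i j = (\<Sum>k\<in>K. ent (a * b) i k * ent c k j)"
      using supp_times by (intro ent_times K) (auto simp: K_def)
    also have "\<dots> = (\<Sum>k\<in>K. (\<Sum>l\<in>K. ent a i l * ent b l k) * ent c k j)"
      by (intro sum.cong refl arg_cong2[where f = "(*)"] ent_times K) (auto simp: K_def)
    also have "\<dots> = (\<Sum>l\<in>K. ent a i l * (\<Sum>k\<in>K. ent b l k * ent c k j))"
      by (simp add: sum_distrib_right sum_distrib_left mult.assoc) (rule sum.swap)
    also have "\<dots> = (\<Sum>l\<in>K. ent a i l * ent (b * c) l j)"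
      by (intro sum.cong refl arg_cong2[where f = "(*)"] ent_times[symmetric] K) (auto simp: K_def)
    also have "\<dots> = ent (a * (b * c)) i j"
      using supp_times by (intro ent_times[symmetric] K) (auto simp: K_def)
    finally show "ent (a * b * c) i j = ent (a * (b * c)) i j" .
  qed
  have K: "finite (supp a \<union> supp b \<union> supp c)" by simp
  show "(a + b) * c = a * c + b * c"
  proof (rule fmat_eqI)
    fix i j
    show "ent ((a + b) * c) i j = ent (a * c + b * c) i j"
      by (simp, subst (1 2 3) ent_times[OF K]) (auto simp: sum.distrib algebra_simps)
  qed
  show "a * (b + c) = a * b + a * c"
  proof (rule fmat_eqI)
    fix i j
    show "ent (a * (b + c)) i j = ent (a * b + a * c) i j"
      by (simp, subst (1 2 3) ent_times[OF K]) (auto simp: sum.distrib algebra_simps)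
  qed
qed (rule fmat_eqI, simp add: add.assoc add.commute)+

lemma Re_mult_cnj_self: "Re (z * cnj z) = (cmod z)\<^sup>2"
  by (metis complex_norm_square Re_complex_of_real)

instantiation fmat :: (type) real_inner
begin
definition "inner x y = hs_inner x (y :: 'a fmat)"
instance
proof (standard, unfold inner_fmat_def)
  fix x y z :: "'a fmat" and a b r :: real
  show "scaleR a (x + y) = scaleR a x + scaleR a y"
    "scaleR (a + b) x = scaleR a x + scaleR b x"
    "scaleR a (scaleR b x) = scaleR (a * b) x" "scaleR 1 x = x"
    by (rule fmat_eqI, simp add: algebra_simps)+
  show "dist x y = norm (x - y)" by (fact dist_fmat_def)
  show "sgn x = x /\<^sub>R norm x" by (simp add: sgn_fmat_def scaleR_fmat_def)
  show "(uniformity :: ('a fmat \<times> 'a fmat) filter) = (INF e\<in>{0 <..}. principal {(x, y). dist x y < e})"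
    by (fact uniformity_fmat_def)
  show "open (U :: 'a fmat set) = (\<forall>x\<in>U. eventually (\<lambda>(x', y). x' = x \<longrightarrow> y \<in> U) uniformity)" for U
    by (fact open_fmat_def)
  show "norm x = sqrt (hs_inner x x)" by (fact norm_fmat_def)
  have K: "finite (supp x \<union> supp y \<union> supp z)" by simp
  show "hs_inner x y = hs_inner y x"
    by (subst (1 2) hs_inner_eq[OF K]) (auto simp: mult.commute)
  show "hs_inner (x + y) z = hs_inner x z + hs_inner y z"
    by (subst (1 2 3) hs_inner_eq[OF K]) (auto simp: sum.distrib algebra_simps)
  show "hs_inner (r *\<^sub>R x) y = r * hs_inner x y"
    by (subst (1 2) hs_inner_eq[OF K]) (auto simp: sum_distrib_left algebra_simps)
  have sq: "hs_inner x x = (\<Sum>i\<in>supp x. \<Sum>j\<in>supp x. (cmod (ent x i j))\<^sup>2)"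
    unfolding hs_inner_def Re_mult_cnj_self ..
  show "0 \<le> hs_inner x x" unfolding sq by (intro sum_nonneg) auto
  show "(hs_inner x x = 0) = (x = 0)"
  proof
    assume "hs_inner x x = 0"
    then have "\<forall>i\<in>supp x. \<forall>j\<in>supp x. ent x i j = 0"
      unfolding sq by (simp add: sum_nonneg_eq_0_iff sum_nonneg)
    then show "x = 0" by (intro fmat_eqI) (metis ent_zero not_supp)
  qed (simp add: hs_inner_def)
qed
end

lemmas inner_fmat_eq = hs_inner_eq[folded inner_fmat_def]

lemma norm_fmat_sq:
  assumes "finite K" "supp x \<subseteq> K"
  shows "(norm x)\<^sup>2 = (\<Sum>i\<in>K. \<Sum>j\<in>K. (cmod (ent x i j))\<^sup>2)"
  by (subst power2_norm_eq_inner, subst inner_fmat_eq[of K])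
    (use assms in \<open>auto simp only: Re_mult_cnj_self\<close>)

lemma norm_ent_le: "cmod (ent x i j) \<le> norm x"
proof (cases "i \<in> supp x \<and> j \<in> supp x")
  case True
  have "(cmod (ent x i j))\<^sup>2 \<le> (\<Sum>j\<in>supp x. (cmod (ent x i j))\<^sup>2)"
    using True by (intro member_le_sum) auto
  also have "\<dots> \<le> (\<Sum>i\<in>supp x. \<Sum>j\<in>supp x. (cmod (ent x i j))\<^sup>2)"
    using True by (intro member_le_sum[where f = "\<lambda>i. \<Sum>j\<in>supp x. (cmod (ent x i j))\<^sup>2"])
      (auto intro: sum_nonneg)
  also have "\<dots> = (norm x)\<^sup>2" by (rule norm_fmat_sq[symmetric]) auto
  finally show ?thesis by (simp add: power2_le_iff_abs_le)
qed (auto simp: not_supp)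

lemma adj_adj [simp]: "adj (adj x) = x"
  and adj_zero [simp]: "adj 0 = 0"
  and adj_add: "adj (x + y) = adj x + adj y"
  and adj_diff: "adj (x - y) = adj x - adj y"
  and adj_scaleR: "adj (scaleR r x) = scaleR r (adj x)"
  and adj_scaleC: "adj (scaleC c x) = scaleC (cnj c) (adj x)"
  by (rule fmat_eqI, simp)+

lemma adj_mult: "adj (x * y) = adj y * adj x"
proof (rule fmat_eqI)
  fix i j
  have K: "finite (supp x \<union> supp y)" by simp
  show "ent (adj (x * y)) i j = ent (adj y * adj x) i j"
    by (simp, subst (1 2) ent_times[OF K]) (auto simp: mult.commute)
qed

lemma adj_sum: "adj (\<Sum>i\<in>A. f i) = (\<Sum>i\<in>A. adj (f i))"
  by (induction A rule: infinite_finite_induct) (auto simp: adj_add)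

lemma mult_scaleC_left [simp]: "scaleC c x * y = scaleC c (x * y)"
  and mult_scaleC_right [simp]: "x * scaleC c y = scaleC c (x * y)"
proof -
  have K: "finite (supp x \<union> supp y)" by simp
  show "scaleC c x * y = scaleC c (x * y)" "x * scaleC c y = scaleC c (x * y)"
    by (rule fmat_eqI, simp, subst (1 2) ent_times[OF K], auto simp: sum_distrib_left algebra_simps)+
qed

lemma scaleC_scaleC [simp]: "scaleC a (scaleC b x) = scaleC (a * b) x"
  and scaleC_one [simp]: "scaleC 1 x = x"
  and scaleC_minus_one: "scaleC (- 1) x = - x"
  by (rule fmat_eqI, simp add: algebra_simps)+

lemma inner_adj_adj: "inner (adj x) (adj y) = inner x y"
proof -
  define K where "K = supp x \<union> supp y"
  have K: "finite K" "supp x \<inter> supp y \<subseteq> K" by (auto simp: K_def)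
  have "inner (adj x) (adj y) = (\<Sum>i\<in>K. \<Sum>j\<in>K. Re (cnj (ent x j i) * ent y j i))"
    using K by (subst inner_fmat_eq[of K]) simp_all
  also have "\<dots> = (\<Sum>i\<in>K. \<Sum>j\<in>K. Re (ent x i j * cnj (ent y i j)))"
    by (subst sum.swap) (simp add: mult.commute)
  also have "\<dots> = inner x y" using K by (subst inner_fmat_eq[of K]) simp_all
  finally show ?thesis .
qed

lemma norm_adj [simp]: "norm (adj x) = norm x"
  by (simp add: norm_eq_sqrt_inner inner_adj_adj)

lemma inner_mult_left: "inner (x * y) z = inner y (adj x * z)"
proof -
  define K where "K = supp x \<union> supp y \<union> supp z"
  have K: "finite K" by (simp add: K_def)
  have "inner (x * y) z = (\<Sum>i\<in>K. \<Sum>j\<in>K. Re ((\<Sum>k\<in>K. ent x i k * ent y k j) * cnj (ent z i j)))"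
    by (subst inner_fmat_eq[OF K], simp add: K_def, blast?, subst ent_times[OF K])
      (auto simp: K_def)
  also have "\<dots> = (\<Sum>i\<in>K. \<Sum>j\<in>K. \<Sum>k\<in>K. Re (ent x i k * ent y k j * cnj (ent z i j)))"
    by (simp only: sum_distrib_right Re_sum)
  also have "\<dots> = (\<Sum>k\<in>K. \<Sum>j\<in>K. \<Sum>i\<in>K. Re (ent x i k * ent y k j * cnj (ent z i j)))"
    by (subst (2) sum.swap, subst sum.swap, subst (2) sum.swap) (rule refl)
  also have "\<dots> = (\<Sum>k\<in>K. \<Sum>j\<in>K. Re (ent y k j * cnj (\<Sum>i\<in>K. cnj (ent x i k) * ent z i j)))"
    by (simp only: cnj_sum sum_distrib_left Re_sum complex_cnj_mult complex_cnj_cnj mult.commute mult.left_commute mult.assoc)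
  also have "\<dots> = inner y (adj x * z)"
    by (subst inner_fmat_eq[OF K], simp add: K_def, blast?, subst ent_times[OF K])
      (auto simp: K_def)
  finally show ?thesis .
qed

lemma inner_mult_right: "inner (x * y) z = inner x (z * adj y)"
proof -
  have "inner (x * y) z = inner (adj y * adj x) (adj z)" by (metis adj_mult inner_adj_adj)
  also have "\<dots> = inner (adj x) (y * adj z)" by (simp add: inner_mult_left)
  also have "\<dots> = inner x (z * adj y)" by (metis adj_adj adj_mult inner_adj_adj)
  finally show ?thesis .
qed

text \<open>Cauchy-Schwarz bounds each entry, and the resulting double sum factors. The class
  instance that follows supplies continuity of products.\<close>

lemma norm_mult_fmat: "norm (x * y) \<le> norm x * norm (y :: 'i fmat)"
proof -
  define K where "K = supp x \<union> supp y"
  have K: "finite K" by (simp add: K_def)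
  have *: "(cmod (ent (x * y) i j))\<^sup>2 \<le> (\<Sum>k\<in>K. (cmod (ent x i k))\<^sup>2) * (\<Sum>k\<in>K. (cmod (ent y k j))\<^sup>2)" for i j
  proof -
    have "cmod (ent (x * y) i j) \<le> (\<Sum>k\<in>K. cmod (ent x i k) * cmod (ent y k j))"
      by (subst ent_times[OF K]) (auto simp: K_def norm_mult[symmetric] intro: norm_sum)
    also have "\<dots> \<le> L2_set (\<lambda>k. cmod (ent x i k)) K * L2_set (\<lambda>k. cmod (ent y k j)) K"
      using L2_set_mult_ineq[of "\<lambda>k. cmod (ent x i k)" "\<lambda>k. cmod (ent y k j)" K] by simp
    finally have "(cmod (ent (x * y) i j))\<^sup>2 \<le> (L2_set (\<lambda>k. cmod (ent x i k)) K * L2_set (\<lambda>k. cmod (ent y k j)) K)\<^sup>2"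
      by (rule power_mono) simp
    also have "\<dots> = (\<Sum>k\<in>K. (cmod (ent x i k))\<^sup>2) * (\<Sum>k\<in>K. (cmod (ent y k j))\<^sup>2)"
      by (simp add: power_mult_distrib L2_set_def sum_nonneg)
    finally show ?thesis .
  qed
  have "(norm (x * y))\<^sup>2 = (\<Sum>i\<in>K. \<Sum>j\<in>K. (cmod (ent (x * y) i j))\<^sup>2)"
    using supp_times[of x y] by (intro norm_fmat_sq K) (auto simp: K_def)
  also have "\<dots> \<le> (\<Sum>i\<in>K. \<Sum>j\<in>K. (\<Sum>k\<in>K. (cmod (ent x i k))\<^sup>2) * (\<Sum>k\<in>K. (cmod (ent y k j))\<^sup>2))"
    by (intro sum_mono *)
  also have "\<dots> = (\<Sum>i\<in>K. \<Sum>k\<in>K. (cmod (ent x i k))\<^sup>2) * (\<Sum>j\<in>K. \<Sum>k\<in>K. (cmod (ent y k j))\<^sup>2)"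
    by (simp add: sum_product)
  also have "(\<Sum>j\<in>K. \<Sum>k\<in>K. (cmod (ent y k j))\<^sup>2) = (norm y)\<^sup>2"
    by (subst sum.swap) (rule norm_fmat_sq[symmetric], use K in \<open>auto simp: K_def\<close>)
  also have "(\<Sum>i\<in>K. \<Sum>k\<in>K. (cmod (ent x i k))\<^sup>2) = (norm x)\<^sup>2"
    by (rule norm_fmat_sq[symmetric]) (use K in \<open>auto simp: K_def\<close>)
  finally show ?thesis by (simp add: power_mult_distrib[symmetric] power2_le_iff_abs_le)
qed

instance fmat :: (type) real_normed_algebra
proof
  fix x y :: "'a fmat" and r :: real
  have K: "finite (supp x \<union> supp y)" by simp
  show "scaleR r x * y = scaleR r (x * y)" "x * scaleR r y = scaleR r (x * y)"
    by (rule fmat_eqI, simp, subst (1 2) ent_times[OF K], auto simp: sum_distrib_left algebra_simps)+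
  show "norm (x * y) \<le> norm x * norm y" by (rule norm_mult_fmat)
qed

lemma norm_scaleC: "norm (scaleC c x) = cmod c * norm x"
proof -
  have "supp (scaleC c x) \<subseteq> supp x" by (rule supp_subsetI) (auto simp: not_supp)
  then have "(norm (scaleC c x))\<^sup>2 = (\<Sum>i\<in>supp x. \<Sum>j\<in>supp x. (cmod (c * ent x i j))\<^sup>2)"
    by (simp add: norm_fmat_sq[of "supp x" "scaleC c x"])
  also have "\<dots> = (cmod c * norm x)\<^sup>2"
    by (simp add: norm_fmat_sq[of "supp x" x] norm_mult power_mult_distrib sum_distrib_left)
  finally show ?thesis by simp
qed

text \<open>The whole type need not be complete, since a Cauchy sequence may try to acquire infinite
  support. A fixed finite block is complete, which is what the minimal-norm and fixed-point
  arguments use.\<close>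

lemma complete_supp:
  assumes "finite (J :: 'i set)"
  shows "complete {x :: 'i fmat. supp x \<subseteq> J}"
  unfolding complete_def
proof (intro allI impI, elim conjE)
  fix f :: "nat \<Rightarrow> 'i fmat"
  assume f: "\<forall>n. f n \<in> {x. supp x \<subseteq> J}" and C: "Cauchy f"
  have "convergent (\<lambda>n. ent (f n) i j)" for i j
  proof -
    have "Cauchy (\<lambda>n. ent (f n) i j)"
      unfolding Cauchy_def
    proof (intro allI impI)
      fix e :: real assume "e > 0"
      then obtain M where M: "\<And>m n. m \<ge> M \<Longrightarrow> n \<ge> M \<Longrightarrow> dist (f m) (f n) < e"
        using C unfolding Cauchy_def by blast
      show "\<exists>M. \<forall>m\<ge>M. \<forall>n\<ge>M. dist (ent (f m) i j) (ent (f n) i j) < e"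
      proof (intro exI[of _ M] allI impI)
        fix m n assume "m \<ge> M" "n \<ge> M"
        then show "dist (ent (f m) i j) (ent (f n) i j) < e"
          using M[of m n] norm_ent_le[of "f m - f n" i j] by (simp add: dist_norm)
      qed
    qed
    then show ?thesis by (simp add: Cauchy_convergent_iff)
  qed
  then obtain L where L: "\<And>i j. (\<lambda>n. ent (f n) i j) \<longlonglongrightarrow> L i j"
    unfolding convergent_def by metis
  define l where "l = mkf J L"
  have lJ: "supp l \<subseteq> J" unfolding l_def by (rule supp_mkf[OF assms])
  have le: "(\<lambda>n. ent (f n) i j) \<longlonglongrightarrow> ent l i j" for i j
  proof (cases "i \<in> J \<and> j \<in> J")
    case False
    then have "ent (f n) i j = 0" for n using f by (intro not_supp) auto
    then show ?thesis using False assms by (auto simp: l_def ent_mkf)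
  qed (use L assms in \<open>auto simp: l_def ent_mkf\<close>)
  have "(\<lambda>n. (norm (f n - l))\<^sup>2) = (\<lambda>n. \<Sum>i\<in>J. \<Sum>j\<in>J. (cmod (ent (f n) i j - ent l i j))\<^sup>2)"
  proof
    fix n
    have "supp (f n) \<subseteq> J" using f by simp
    moreover have "supp (f n - l) \<subseteq> supp (f n) \<union> supp l"
      by (rule supp_subsetI) (auto simp: not_supp)
    ultimately have "supp (f n - l) \<subseteq> J" using lJ by (meson Un_subset_iff order_trans)
    then show "(norm (f n - l))\<^sup>2 = (\<Sum>i\<in>J. \<Sum>j\<in>J. (cmod (ent (f n) i j - ent l i j))\<^sup>2)"
      by (simp add: norm_fmat_sq[OF assms])
  qed
  moreover have "(\<lambda>n. \<Sum>i\<in>J. \<Sum>j\<in>J. (cmod (ent (f n) i j - ent l i j))\<^sup>2)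
      \<longlonglongrightarrow> (\<Sum>i\<in>J. \<Sum>j\<in>J. (cmod (ent l i j - ent l i j))\<^sup>2)"
    by (intro tendsto_sum tendsto_power tendsto_norm tendsto_diff le tendsto_const)
  ultimately have "(\<lambda>n. (norm (f n - l))\<^sup>2) \<longlonglongrightarrow> 0" by simp
  then have "(\<lambda>n. sqrt ((norm (f n - l))\<^sup>2)) \<longlonglongrightarrow> sqrt 0" by (rule tendsto_real_sqrt)
  then have "(\<lambda>n. dist (f n) l) \<longlonglongrightarrow> 0" by (simp add: dist_norm)
  then have "f \<longlonglongrightarrow> l" by (rule tendsto_dist_iff[THEN iffD2])
  then show "\<exists>l\<in>{x. supp x \<subseteq> J}. f \<longlonglongrightarrow> l" using lJ by (intro bexI[of _ l]) simp_all
qed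

section \<open>A spectral gap over the integers modulo n\<close>

locale cyc = fixes h :: nat
begin

section \<open>Roots of unity and sums over residues\<close>

definition n :: int where "n = 2 * int h + 1"
text \<open>Balanced representatives: R is stable under negation and |a| measures the size of a
  residue, as the cones of the ping-pong argument require.\<close>

definition R :: "int set" where "R = {- int h..int h}"
definition w :: "int \<Rightarrow> complex" where "w k = cis (2 * pi * of_int k / of_int n)"
definition rep :: "int \<Rightarrow> int" where "rep j = (j + int h) mod n - int h"

lemma n_pos: "n > 0" by (simp add: n_def)
lemma finite_R [simp]: "finite R" by (simp add: R_def)
lemma card_R: "int (card R) = n" by (simp add: R_def n_def)

lemma w_add: "w (a + b) = w a * w b"
  by (simp add: w_def cis_mult add_divide_distrib distrib_left)
lemma w_0 [simp]: "w 0 = 1" by (simp add: w_def)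
lemma w_uminus: "w (- a) = cnj (w a)" by (simp add: w_def cis_cnj)
lemma w_diff: "w (a - b) = w a * cnj (w b)" by (metis diff_conv_add_uminus w_add w_uminus)
lemma norm_w [simp]: "cmod (w a) = 1" by (simp add: w_def)
lemma w_cnj [simp]: "w a * cnj (w a) = 1" by (metis complex_norm_square norm_w of_real_1 one_power2)
lemma w_period: "w (n * k) = 1"
proof -
  have "2 * pi * of_int (n * k) / of_int n = of_int k * 2 * pi" using n_pos by simp
  then show ?thesis unfolding w_def
    by (intro complex_eqI) (simp_all add: cos_one_2pi_int sin_zero_iff_int2, auto intro: exI[of _ "2 * k"])
qed
lemma w_add_period: "w (a + n * k) = w a" by (simp add: w_add w_period)

lemma w_neq_1: assumes "\<not> n dvd k" shows "w k \<noteq> 1"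
proof
  assume "w k = 1"
  then have "cos (2 * pi * of_int k / of_int n) = 1" by (metis cis.sel(1) one_complex.sel(1) w_def)
  then obtain m :: int where "2 * pi * of_int k / of_int n = of_int m * 2 * pi" by (auto simp: cos_one_2pi_int)
  then have "real_of_int k = of_int (n * m)" using n_pos by (simp add: field_simps)
  then have "k = n * m" by linarith
  then show False using assms by simp
qed

text \<open>The angle of w a has absolute value between pi / 3 and pi, so its chord to 1 is at least
  the radius. Below the threshold n / 6 the multiple 3 a still has size at most n / 2.\<close>

lemma norm_w_minus_1:
  assumes "a \<in> R" "n < 6 * \<bar>a\<bar>"
  shows "cmod (w a - 1) \<ge> 1"
proof -
  define t where "t = 2 * pi * \<bar>of_int a\<bar> / of_int n"
  have "real_of_int n < 6 * \<bar>of_int a\<bar>" using assms(2) by linarith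
  then have "pi / 3 \<le> t" using n_pos unfolding t_def by (simp add: field_simps)
  moreover have "2 * \<bar>real_of_int a\<bar> \<le> of_int n" using assms(1) unfolding R_def n_def by auto
  then have "t \<le> pi" using n_pos unfolding t_def by (simp add: field_simps)
  ultimately have "cos t \<le> 1 / 2" using cos_monotone_0_pi_le[of "pi / 3" t] by (simp add: cos_60)
  moreover have "cos t = cos (2 * pi * of_int a / of_int n)"
    using n_pos cos_abs_real[of "2 * pi * of_int a / of_int n"] by (simp add: t_def abs_mult)
  ultimately have "Re (w a) \<le> 1 / 2" by (simp add: w_def)
  moreover have "(cmod (w a - 1))\<^sup>2 = 2 - 2 * Re (w a)"
  proof -
    have "(Re (w a))\<^sup>2 + (Im (w a))\<^sup>2 = 1" by (metis cmod_power2 norm_w one_power2)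
    then show ?thesis unfolding cmod_power2 by (simp add: power2_eq_square algebra_simps)
  qed
  ultimately have "1\<^sup>2 \<le> (cmod (w a - 1))\<^sup>2" by simp
  then show ?thesis by (rule power2_le_imp_le) simp
qed

lemma rep_in [simp]: "rep j \<in> R"
  using pos_mod_bound[OF n_pos, of "j + int h"] pos_mod_sign[OF n_pos, of "j + int h"]
  by (simp add: rep_def R_def n_def)

lemma rep_id: "j \<in> R \<Longrightarrow> rep j = j"
  unfolding rep_def R_def n_def by (subst mod_pos_pos_trivial) auto

lemma rep_eq: "\<exists>k. rep j = j + n * k"
proof
  show "rep j = j + n * (- ((j + int h) div n))"
    unfolding rep_def using minus_div_mult_eq_mod[of "j + int h" n] by (simp add: algebra_simps)
qed

lemma dvd_diff_R: "i \<in> R \<Longrightarrow> j \<in> R \<Longrightarrow> n dvd i - j \<longleftrightarrow> i = j"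
proof
  assume a: "i \<in> R" "j \<in> R" "n dvd i - j"
  have "\<bar>i - j\<bar> < n" using a by (auto simp: R_def n_def)
  then show "i = j" using a(3) zdvd_imp_le[of n "\<bar>i - j\<bar>"] by fastforce
qed auto

text \<open>Functions on Z/n are kept as periodic functions on the integers, so that index
  arithmetic needs no reduction.\<close>

definition periodic :: "(int \<Rightarrow> 'a) \<Rightarrow> bool" where
  "periodic f \<longleftrightarrow> (\<forall>j k. f (j + n * k) = f j)"

lemma periodicD: "periodic f \<Longrightarrow> f (j + n * k) = f j" by (simp add: periodic_def)

lemma periodic_rep: "periodic f \<Longrightarrow> f (rep j) = f j" by (metis periodicD rep_eq)

lemma periodic_comp_rep: "periodic (\<lambda>i. f (rep i))"
proof -
  have "rep (j + n * k) = rep j" for j k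
  proof -
    have "(j + n * k + int h) mod n = (j + int h) mod n"
      using mod_mult_self2[of "j + int h" n k] by (simp add: algebra_simps)
    then show ?thesis by (simp add: rep_def)
  qed
  then show ?thesis by (simp add: periodic_def)
qed

lemma sum_shift:
  fixes f :: "int \<Rightarrow> 'a::comm_monoid_add"
  assumes "periodic f"
  shows "(\<Sum>j\<in>R. f (j + a)) = (\<Sum>j\<in>R. f j)"
proof -
  have inj: "inj_on (\<lambda>j. rep (j + a)) R"
  proof
    fix i j assume ij: "i \<in> R" "j \<in> R" "rep (i + a) = rep (j + a)"
    obtain k l where "rep (i + a) = i + a + n * k" "rep (j + a) = j + a + n * l" using rep_eq by meson
    then have "i - j = n * (l - k)" using ij(3) by (simp add: algebra_simps)
    then show "i = j" using dvd_diff_R[OF ij(1,2)] by simp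
  qed
  then have img: "(\<lambda>j. rep (j + a)) ` R = R" by (intro endo_inj_surj) auto
  have "(\<Sum>j\<in>R. f (j + a)) = (\<Sum>j\<in>R. f (rep (j + a)))" by (simp add: periodic_rep[OF assms])
  also have "\<dots> = (\<Sum>j\<in>(\<lambda>j. rep (j + a)) ` R. f j)" by (simp add: sum.reindex[OF inj])
  finally show ?thesis by (simp only: img)
qed

lemma sum_neg: "(\<Sum>j\<in>R. f (- j)) = (\<Sum>j\<in>R. f j)"
  by (rule sum.reindex_bij_witness[of _ uminus uminus]) (auto simp: R_def)

lemma sum_w: "(\<Sum>j\<in>R. w (k * j)) = (if n dvd k then of_int n else 0)"
proof (cases "n dvd k")
  case True
  then obtain m where "k = n * m" by blast
  then have "w (k * j) = 1" for j using w_period[of "m * j"] by (simp add: mult.assoc)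
  moreover have "of_nat (card R) = (of_int n :: complex)" by (metis card_R of_int_of_nat_eq)
  ultimately show ?thesis using True by simp
next
  case False
  have "periodic (\<lambda>j. w (k * j))"
    unfolding periodic_def
  proof (intro allI)
    fix j l
    have "k * (j + n * l) = k * j + n * (k * l)" by (simp add: algebra_simps)
    then show "w (k * (j + n * l)) = w (k * j)" by (simp only: w_add_period)
  qed
  from sum_shift[OF this, of 1] have "w k * (\<Sum>j\<in>R. w (k * j)) = (\<Sum>j\<in>R. w (k * j))"
    by (simp add: distrib_left w_add sum_distrib_left mult.commute)
  then have "(w k - 1) * (\<Sum>j\<in>R. w (k * j)) = 0" by (simp add: algebra_simps)
  then show ?thesis using w_neq_1[OF False] False by auto
qed

text \<open>The inverse of 2 modulo the odd number n.\<close>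

definition beta :: int where "beta = int h + 1"

lemma w_beta: "w (2 * beta * a) = w a"
proof -
  have "2 * beta * a = a + n * a" by (simp add: beta_def n_def algebra_simps)
  then show ?thesis using w_add_period by simp
qed

section \<open>The action on Weyl coefficients and its gap\<close>

definition hs :: "(int \<times> int \<Rightarrow> complex) \<Rightarrow> real" where
  "hs g = L2_set (\<lambda>p. cmod (g p)) (R \<times> R)"

lemma hs_sq: "(hs g)\<^sup>2 = (\<Sum>a\<in>R. \<Sum>b\<in>R. (cmod (g (a, b)))\<^sup>2)"
  by (simp add: hs_def L2_set_def sum_nonneg sum.cartesian_product case_prod_beta)

lemma hs_nonneg [simp]: "hs g \<ge> 0" by (simp add: hs_def L2_set_nonneg)

lemma hs_triangle: "hs (\<lambda>p. f p - g p) \<le> hs (\<lambda>p. f p - k p) + hs (\<lambda>p. k p - g p)"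
proof -
  have "hs (\<lambda>p. f p - g p) \<le> L2_set (\<lambda>p. cmod (f p - k p) + cmod (k p - g p)) (R \<times> R)"
    unfolding hs_def by (intro L2_set_mono norm_diff_triangle_le[OF order.refl order.refl]) simp
  also have "\<dots> \<le> hs (\<lambda>p. f p - k p) + hs (\<lambda>p. k p - g p)"
    unfolding hs_def by (rule L2_set_triangle_ineq)
  finally show ?thesis .
qed

lemma hs_cong_norm:
  assumes "(\<Sum>a\<in>R. \<Sum>b\<in>R. (cmod (f (a, b)))\<^sup>2) = (\<Sum>a\<in>R. \<Sum>b\<in>R. (cmod (g (a, b)))\<^sup>2)"
  shows "hs f = hs g"
  using assms by (metis hs_nonneg hs_sq power2_eq_iff_nonneg)

text \<open>The actions on Weyl coefficients of conjugation by the quadratic phase (shear) and by the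
  Fourier matrix (rot); flip is the square of rot.\<close>
definition shear :: "(int \<times> int \<Rightarrow> complex) \<Rightarrow> int \<times> int \<Rightarrow> complex" where
  "shear c = (\<lambda>(a, b). w (- a * a + beta * a) * c (a, b + 2 * a))"
definition rot :: "(int \<times> int \<Rightarrow> complex) \<Rightarrow> int \<times> int \<Rightarrow> complex" where
  "rot c = (\<lambda>(a, b). w (a * b) * c (b, - a))"
definition flip :: "(int \<times> int \<Rightarrow> complex) \<Rightarrow> int \<times> int \<Rightarrow> complex" where
  "flip c = (\<lambda>(a, b). c (- a, - b))"

lemma hs_rot: "hs (rot g) = hs g"
proof (rule hs_cong_norm)
  have "(\<Sum>a\<in>R. \<Sum>b\<in>R. (cmod (rot g (a, b)))\<^sup>2) = (\<Sum>b\<in>R. \<Sum>a\<in>R. (cmod (g (b, - a)))\<^sup>2)"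
    by (subst sum.swap) (simp add: rot_def norm_mult)
  also have "\<dots> = (\<Sum>b\<in>R. \<Sum>a\<in>R. (cmod (g (b, a)))\<^sup>2)"
    by (intro sum.cong refl sum_neg[of "\<lambda>a. (cmod (g (_, a)))\<^sup>2"])
  finally show "(\<Sum>a\<in>R. \<Sum>b\<in>R. (cmod (rot g (a, b)))\<^sup>2) = (\<Sum>b\<in>R. \<Sum>a\<in>R. (cmod (g (b, a)))\<^sup>2)" .
qed

lemma hs_flip: "hs (flip g) = hs g"
proof (rule hs_cong_norm)
  show "(\<Sum>a\<in>R. \<Sum>b\<in>R. (cmod (flip g (a, b)))\<^sup>2) = (\<Sum>a\<in>R. \<Sum>b\<in>R. (cmod (g (a, b)))\<^sup>2)"
    using sum_neg[of "\<lambda>a. \<Sum>b\<in>R. (cmod (g (a, b)))\<^sup>2"]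
      sum_neg[of "\<lambda>b. (cmod (g (_, b)))\<^sup>2"] by (simp add: flip_def)
qed

lemma hs_shear: "(\<And>a. periodic (\<lambda>b. g (a, b))) \<Longrightarrow> hs (shear g) = hs g"
proof (rule hs_cong_norm)
  assume "\<And>a. periodic (\<lambda>b. g (a, b))"
  then have "periodic (\<lambda>b. (cmod (g (a, b)))\<^sup>2)" for a by (simp add: periodic_def)
  from sum_shift[OF this]
  show "(\<Sum>a\<in>R. \<Sum>b\<in>R. (cmod (shear g (a, b)))\<^sup>2) = (\<Sum>a\<in>R. \<Sum>b\<in>R. (cmod (g (a, b)))\<^sup>2)"
    by (simp add: shear_def norm_mult)
qed

text \<open>The phases w (a * b) and w (- (b * a)) cancel. Almost invariance under
  \<open>rot\<close> thus becomes almost evenness, at twice the cost.\<close>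

lemma rot_rot: "rot (rot c) = flip c"
  by (auto simp: rot_def flip_def fun_eq_iff mult.commute simp flip: mult.assoc w_add)

text \<open>The shear and its conjugate under the flip differ by the phase w a, so an almost invariant
  c is concentrated where that phase is close to 1.\<close>
lemma phase_concentration:
  assumes c: "\<And>a. periodic (\<lambda>b. c (a, b))"
  shows "hs (\<lambda>p. (w (fst p) - 1) * c p) \<le> 2 * hs (\<lambda>p. shear c p - c p) + 4 * hs (\<lambda>p. rot c p - c p)"
proof -
  have sym: "hs (\<lambda>p. f p - g p) = hs (\<lambda>p. g p - f p)" for f g
    by (simp add: hs_def norm_minus_commute)
  have fl: "hs (\<lambda>p. c p - flip c p) \<le> 2 * hs (\<lambda>p. rot c p - c p)"
  proof -
    have "hs (\<lambda>p. rot c p - flip c p) = hs (rot (\<lambda>p. c p - rot c p))"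
      unfolding rot_rot[symmetric] by (rule arg_cong[of _ _ hs]) (auto simp: rot_def fun_eq_iff algebra_simps)
    then have "hs (\<lambda>p. rot c p - flip c p) = hs (\<lambda>p. rot c p - c p)" by (simp add: hs_rot sym)
    then show ?thesis using hs_triangle[of c "flip c" "rot c"] by (simp add: sym)
  qed
  have "hs (\<lambda>p. shear c p - shear (flip c) p) = hs (shear (\<lambda>p. c p - flip c p))"
    by (rule arg_cong[of _ _ hs]) (auto simp: shear_def fun_eq_iff algebra_simps)
  also have "\<dots> = hs (\<lambda>p. c p - flip c p)"
  proof (rule hs_shear)
    fix a
    have "c (- a, - (j + n * k)) = c (- a, - j)" for j k
      using periodicD[OF c, of "- a" "- j" "- k"] by (simp add: algebra_simps)
    then show "periodic (\<lambda>b. c (a, b) - flip c (a, b))"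
      using c by (simp add: periodic_def flip_def)
  qed
  finally have 1: "hs (\<lambda>p. shear c p - shear (flip c) p) = hs (\<lambda>p. c p - flip c p)" .
  have "hs (\<lambda>p. flip c p - flip (shear (flip c)) p) = hs (flip (\<lambda>p. c p - shear (flip c) p))"
    by (rule arg_cong[of _ _ hs]) (auto simp: flip_def fun_eq_iff)
  then have "hs (\<lambda>p. c p - flip (shear (flip c)) p) \<le> hs (\<lambda>p. c p - flip c p) + hs (\<lambda>p. c p - shear (flip c) p)"
    using hs_triangle[of c "flip (shear (flip c))" "flip c"] by (simp add: hs_flip)
  moreover have "hs (\<lambda>p. c p - shear (flip c) p) \<le> hs (\<lambda>p. shear c p - c p) + hs (\<lambda>p. c p - flip c p)"
    using hs_triangle[of c "shear (flip c)" "shear c"] 1 by (simp add: sym)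
  \<comment> \<open>Two shear defects and two flip defects; each flip defect costs two rotation
    defects.\<close>
  ultimately have "hs (\<lambda>p. shear c p - flip (shear (flip c)) p) \<le> 2 * hs (\<lambda>p. shear c p - c p) + 4 * hs (\<lambda>p. rot c p - c p)"
    using hs_triangle[of "shear c" "flip (shear (flip c))" c] fl by simp
  moreover have "hs (\<lambda>p. shear c p - flip (shear (flip c)) p) = hs (shear (\<lambda>p. (w (fst p) - 1) * c p))"
  proof (unfold hs_def, intro arg_cong2[of _ _ _ _ L2_set] refl ext)
    fix p :: "int \<times> int"
    obtain a b where p: "p = (a, b)" by force
    \<comment> \<open>The exponents of the phase and of its mirror image differ by 2 * beta * a,
      which is a modulo n.\<close>
    have "w (- a * a + beta * a) = w (- a * a - beta * a) * w a"
      by (subst w_beta[symmetric], simp only: w_add[symmetric]) (simp add: algebra_simps)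
    moreover have "flip (shear (flip c)) p = w (- a * a - beta * a) * c (a, b + 2 * a)"
    proof -
      have "a * - a + beta * - a = - a * a - beta * a" "- (- b + 2 * - a) = b + 2 * a" by simp_all
      then show ?thesis unfolding p shear_def flip_def prod.case minus_minus by (simp only:)
    qed
    moreover have "shear c p = w (- a * a + beta * a) * c (a, b + 2 * a)"
      by (simp add: p shear_def)
    ultimately have "shear c p - flip (shear (flip c)) p = w (- a * a - beta * a) * ((w a - 1) * c (a, b + 2 * a))"
      by (simp only: left_diff_distrib right_diff_distrib mult.assoc mult_1)
    then show "cmod (shear c p - flip (shear (flip c)) p) = cmod (shear (\<lambda>p. (w (fst p) - 1) * c p) p)"
      by (simp add: p shear_def norm_mult)
  qed
  moreover have "hs (shear (\<lambda>p. (w (fst p) - 1) * c p)) = hs (\<lambda>p. (w (fst p) - 1) * c p)"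
    using c by (intro hs_shear) (simp add: periodic_def)
  ultimately show ?thesis by simp
qed

text \<open>If f almost agrees with its pullback along s, then s almost preserves the mass of f. The
  error is measured on E alone, so the image of E may leave the square.\<close>

lemma L2_set_transport:
  fixes f :: "int \<times> int \<Rightarrow> real"
  assumes "E \<subseteq> R \<times> R" "inj_on s E" "\<And>p. p \<in> E \<Longrightarrow> \<bar>f (s p) - f p\<bar> \<le> cmod (k p)" "\<And>p. f p \<ge> 0"
  shows "\<bar>L2_set f (s ` E) - L2_set f E\<bar> \<le> hs k"
proof -
  have "finite E" using assms(1) finite_subset by fastforce
  have k: "L2_set (\<lambda>p. cmod (k p)) E \<le> hs k"
    unfolding hs_def L2_set_def using assms(1)
    by (intro real_sqrt_le_mono sum_mono2) auto
  have s: "L2_set f (s ` E) = L2_set (\<lambda>p. f (s p)) E"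
    unfolding L2_set_def by (simp add: sum.reindex[OF assms(2)])
  have "L2_set (\<lambda>p. f (s p)) E \<le> L2_set (\<lambda>p. f p + cmod (k p)) E"
    using assms(3,4) by (intro L2_set_mono) (auto simp: abs_le_iff algebra_simps)
  also have "\<dots> \<le> L2_set f E + L2_set (\<lambda>p. cmod (k p)) E" by (rule L2_set_triangle_ineq)
  finally have 1: "L2_set f (s ` E) \<le> L2_set f E + hs k" using k s by linarith
  have "L2_set f E \<le> L2_set (\<lambda>p. f (s p) + cmod (k p)) E"
    using assms(3,4) by (intro L2_set_mono) (auto simp: abs_le_iff algebra_simps)
  also have "\<dots> \<le> L2_set (\<lambda>p. f (s p)) E + L2_set (\<lambda>p. cmod (k p)) E" by (rule L2_set_triangle_ineq)
  finally have 2: "L2_set f E \<le> L2_set f (s ` E) + hs k" using k s by linarith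
  from 1 2 show ?thesis by linarith
qed

lemma L2_set_subset:
  fixes f :: "'b \<Rightarrow> real"
  assumes "finite B" "A \<subseteq> B" shows "L2_set f A \<le> L2_set f B"
  unfolding L2_set_def using assms by (intro real_sqrt_le_mono sum_mono2) auto

lemma L2_set_sq: "(L2_set (f :: 'b \<Rightarrow> real) A)\<^sup>2 = (\<Sum>p\<in>A. (f p)\<^sup>2)"
  by (simp add: L2_set_def sum_nonneg)

lemma L2_set_Un_le:
  fixes f :: "'b \<Rightarrow> real"
  assumes "finite A" "finite B" shows "L2_set f (A \<union> B) \<le> L2_set f A + L2_set f B"
proof -
  have "(L2_set f (A \<union> B))\<^sup>2 \<le> (L2_set f A)\<^sup>2 + (L2_set f B)\<^sup>2"
    unfolding L2_set_sq using sum.union_inter[OF assms, of "\<lambda>p. (f p)\<^sup>2"]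
      sum_nonneg[of "A \<inter> B" "\<lambda>p. (f p)\<^sup>2"] by simp
  also have "\<dots> \<le> (L2_set f A + L2_set f B)\<^sup>2" by (simp add: power2_sum L2_set_nonneg)
  finally show ?thesis by (rule power2_le_imp_le) (simp add: L2_set_nonneg)
qed

text \<open>Ping-pong: on the part where both coordinates are small, the shear and its inverse send the
  cone V (|b| < |a|) to disjoint subsets of the cone H (|a| < |b|), which the rotation
  identifies with V again; so c has little mass on either.\<close>
lemma weyl_gap:
  assumes c: "\<And>a. periodic (\<lambda>b. c (a, b))"
  shows "(\<Sum>a\<in>R. \<Sum>b\<in>R. (cmod (c (a, b)))\<^sup>2) - (cmod (c (0, 0)))\<^sup>2
    \<le> 4500 * ((hs (\<lambda>p. shear c p - c p))\<^sup>2 + (hs (\<lambda>p. rot c p - c p))\<^sup>2)"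
proof -
  define Q where "Q = R \<times> R"
  define f where "f = (\<lambda>p. cmod (c p))"
  define L where "L = L2_set f"
  define eA where "eA = hs (\<lambda>p. shear c p - c p)"
  define eB where "eB = hs (\<lambda>p. rot c p - c p)"
  define e where "e = eA + eB"
  have e0: "0 \<le> eA" "0 \<le> eB" "0 \<le> e" by (simp_all add: eA_def eB_def e_def)
  define sg where "sg = (\<lambda>(a, b). (a, b + 2 * a) :: int \<times> int)"
  define ta where "ta = (\<lambda>(a, b). (b, - a) :: int \<times> int)"
  have Qfin: "finite Q" by (simp add: Q_def)
  have fin: "finite E" if "E \<subseteq> Q" for E using that Qfin finite_subset by blast
  have Lnn: "L E \<ge> 0" for E by (simp add: L_def L2_set_nonneg)
  have sg: "\<bar>L (sg ` E) - L E\<bar> \<le> e" if "E \<subseteq> Q" for E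
  proof -
    have "\<bar>L (sg ` E) - L E\<bar> \<le> eA"
      unfolding L_def eA_def
    proof (rule L2_set_transport)
      fix p assume "p \<in> E"
      obtain a b where p: "p = (a, b)" by force
      have "f (sg p) = cmod (shear c p)" by (simp add: f_def sg_def shear_def p norm_mult)
      then show "\<bar>f (sg p) - f p\<bar> \<le> cmod (shear c p - c p)"
        using norm_triangle_ineq3[of "shear c p" "c p"] by (simp add: f_def)
    qed (use that in \<open>auto simp: Q_def inj_on_def sg_def f_def\<close>)
    then show ?thesis using e0 by (simp add: e_def)
  qed
  have ta: "\<bar>L (ta ` E) - L E\<bar> \<le> e" if "E \<subseteq> Q" for E
  proof -
    have "\<bar>L (ta ` E) - L E\<bar> \<le> eB"
      unfolding L_def eB_def
    proof (rule L2_set_transport)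
      fix p assume "p \<in> E"
      obtain a b where p: "p = (a, b)" by force
      have "f (ta p) = cmod (rot c p)" by (simp add: f_def ta_def rot_def p norm_mult)
      then show "\<bar>f (ta p) - f p\<bar> \<le> cmod (rot c p - c p)"
        using norm_triangle_ineq3[of "rot c p" "c p"] by (simp add: f_def)
    qed (use that in \<open>auto simp: Q_def inj_on_def ta_def f_def\<close>)
    then show ?thesis using e0 by (simp add: e_def)
  qed
  \<comment> \<open>Here |w a - 1| >= 1, so phase concentration bounds the mass; 2 * eA + 4 * eB is
    rounded up to 4 * e.\<close>
  have large: "L E \<le> 4 * e" if "E \<subseteq> Q" "\<And>p. p \<in> E \<Longrightarrow> n < 6 * \<bar>fst p\<bar>" for E
  proof -
    have "L E \<le> L2_set (\<lambda>p. cmod ((w (fst p) - 1) * c p)) E"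
      unfolding L_def
    proof (rule L2_set_mono)
      fix p assume p: "p \<in> E"
      then have "1 \<le> cmod (w (fst p) - 1)" using that by (intro norm_w_minus_1) (auto simp: Q_def)
      then show "f p \<le> cmod ((w (fst p) - 1) * c p)"
        by (simp add: f_def norm_mult mult_right_le_one_le mult_le_cancel_right1)
    qed (simp add: f_def)
    also have "\<dots> \<le> hs (\<lambda>p. (w (fst p) - 1) * c p)"
      unfolding hs_def using that(1) Qfin by (intro L2_set_subset) (auto simp: Q_def)
    also have "\<dots> \<le> 4 * e" using phase_concentration[OF c, folded eA_def eB_def] e0(1) by (simp add: e_def)
    finally show ?thesis .
  qed
  define Vt where "Vt = {p \<in> Q. \<bar>snd p\<bar> < \<bar>fst p\<bar>}"
  \<comment> \<open>With |b| < |a| <= n / 6 one has |b + 2 a| < 3 |a| <= n / 2, so the shear stays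
    inside the square.\<close>
  define V where "V = {p \<in> Vt. 6 * \<bar>fst p\<bar> \<le> n}"
  define H where "H = {p \<in> Q. \<bar>fst p\<bar> < \<bar>snd p\<bar>}"
  define D1 where "D1 = {p \<in> Q. fst p = snd p \<and> fst p \<noteq> 0}"
  define D2 where "D2 = {p \<in> Q. fst p = - snd p \<and> fst p \<noteq> 0}"
  have sub: "Vt \<subseteq> Q" "V \<subseteq> Q" "H \<subseteq> Q" "D1 \<subseteq> Q" "D2 \<subseteq> Q"
    by (auto simp: Vt_def V_def H_def D1_def D2_def)
  \<comment> \<open>The preimage of V, that is, its image under the inverse shear. Coordinates have
    equal signs in the image of V and opposite signs in \<open>V'\<close>, whence the
    disjointness.\<close>
  define V' where "V' = {p. sg p \<in> V}"
  have VQ: "V' \<subseteq> H"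
    by (auto simp: V'_def V_def Vt_def H_def Q_def sg_def R_def n_def)
  have sgV: "sg ` V \<subseteq> H"
    by (auto simp: V_def Vt_def H_def Q_def sg_def R_def n_def)
  have disj: "sg ` V \<inter> V' = {}"
    by (auto simp: V_def V'_def Vt_def sg_def)
  have img: "sg ` V' = V"
  proof
    show "V \<subseteq> sg ` V'"
    proof
      fix p assume "p \<in> V"
      moreover have "p = sg (fst p, snd p - 2 * fst p)" by (simp add: sg_def)
      ultimately show "p \<in> sg ` V'" unfolding V'_def by (metis (mono_tags, lifting) image_eqI mem_Collect_eq)
    qed
  qed (auto simp: V'_def)
  have v1: "L V - e \<le> L (sg ` V)" using sg[OF sub(2)] by linarith
  have "V' \<subseteq> Q" using VQ sub(3) by (rule order_trans)
  from sg[OF this] have v2: "L V - e \<le> L V'" unfolding img by linarith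
  have "(L (sg ` V))\<^sup>2 + (L V')\<^sup>2 = (L (sg ` V \<union> V'))\<^sup>2"
    unfolding L_def L2_set_sq using VQ sgV sub disj fin by (intro sum.union_disjoint[symmetric]) auto
  also have "\<dots> \<le> (L H)\<^sup>2"
    using VQ sgV fin[OF sub(3)] Lnn unfolding L_def by (intro power_mono L2_set_subset) auto
  finally have h1: "(L (sg ` V))\<^sup>2 + (L V')\<^sup>2 \<le> (L H)\<^sup>2" .
  have "H = ta ` Vt"
  proof
    show "H \<subseteq> ta ` Vt"
    proof
      fix p assume "p \<in> H"
      then have "(- snd p, fst p) \<in> Vt" by (auto simp: H_def Vt_def Q_def R_def)
      moreover have "p = ta (- snd p, fst p)" by (simp add: ta_def)
      ultimately show "p \<in> ta ` Vt" by blast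
    qed
  qed (auto simp: H_def Vt_def ta_def Q_def R_def)
  then have h2: "L H \<le> L Vt + e" using ta[OF sub(1)] by simp
  have "L Vt \<le> L V + L (Vt - V)"
  proof -
    have "V \<union> (Vt - V) = Vt" by (auto simp: V_def)
    moreover have "finite V" "finite (Vt - V)" using fin[OF sub(1)] fin[OF sub(2)] by simp_all
    ultimately show ?thesis using L2_set_Un_le[of V "Vt - V" f] by (simp add: L_def)
  qed
  moreover have "L (Vt - V) \<le> 4 * e" by (rule large) (auto simp: V_def Vt_def)
  ultimately have vt: "L Vt \<le> L V + 4 * e" by linarith
  \<comment> \<open>The bounds above combine to 2 (L V - e)^2 <= (L V + 5 e)^2, which gives L V <=
    (5 + sqrt 2) / (sqrt 2 - 1) * e; the coefficient is about 15.5.\<close>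
  have v: "L V \<le> 16 * e"
  proof (rule ccontr)
    assume "\<not> L V \<le> 16 * e"
    then obtain t where t: "L V = 16 * e + t" "t > 0" by (metis add.commute diff_add_cancel diff_gt_0_iff_gt not_le)
    have "(15 * e + t)\<^sup>2 \<le> (L (sg ` V))\<^sup>2" "(15 * e + t)\<^sup>2 \<le> (L V')\<^sup>2"
      using v1 v2 t e0 by (auto intro!: power_mono)
    then have "2 * (15 * e + t)\<^sup>2 \<le> (L H)\<^sup>2" using h1 by linarith
    also have "\<dots> \<le> (21 * e + t)\<^sup>2" using h2 vt t Lnn by (intro power_mono) auto
    finally have "9 * e\<^sup>2 + 18 * (e * t) + t\<^sup>2 \<le> 0" by (simp add: power2_eq_square algebra_simps)
    moreover have "e * t \<ge> 0" "t\<^sup>2 > 0" using e0 t by auto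
    ultimately show False using zero_le_power2[of e] by linarith
  qed
  \<comment> \<open>The two cones miss the diagonals. The shear sends a small (a, a) to (a, 3 a) in
    H, and the rotation sends the antidiagonal into the diagonal.\<close>
  define D1s where "D1s = {p \<in> D1. 6 * \<bar>fst p\<bar> \<le> n}"
  have "sg ` D1s \<subseteq> H"
    by (auto simp: D1s_def D1_def H_def Q_def sg_def R_def n_def)
  then have "L (sg ` D1s) \<le> L H" unfolding L_def by (rule L2_set_subset[OF fin[OF sub(3)]])
  moreover have "D1s \<subseteq> Q" by (auto simp: D1s_def D1_def)
  ultimately have "L D1s \<le> L H + e" using sg[of D1s] by linarith
  moreover have "L D1 \<le> L D1s + L (D1 - D1s)"
  proof -
    have "D1s \<union> (D1 - D1s) = D1" by (auto simp: D1s_def)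
    moreover have "finite D1s" "finite (D1 - D1s)" using fin[OF sub(4)] by (simp_all add: D1s_def)
    ultimately show ?thesis using L2_set_Un_le[of D1s "D1 - D1s" f] by (simp add: L_def)
  qed
  moreover have "L (D1 - D1s) \<le> 4 * e" by (rule large) (auto simp: D1s_def D1_def)
  ultimately have d1: "L D1 \<le> 26 * e" using h2 vt v by linarith
  have "ta ` D2 \<subseteq> D1" by (auto simp: D1_def D2_def Q_def R_def ta_def)
  then have "L (ta ` D2) \<le> L D1" unfolding L_def by (rule L2_set_subset[OF fin[OF sub(4)]])
  then have d2: "L D2 \<le> 27 * e" using ta[OF sub(5)] d1 by linarith
  have Q: "Q = {(0, 0)} \<union> (Vt \<union> (H \<union> (D1 \<union> D2)))"
    by (auto simp: Q_def Vt_def H_def D1_def D2_def R_def)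
  have "(\<Sum>p\<in>Q. (f p)\<^sup>2) \<le> (\<Sum>p\<in>{(0, 0)}. (f p)\<^sup>2) + ((\<Sum>p\<in>Vt. (f p)\<^sup>2) + ((\<Sum>p\<in>H. (f p)\<^sup>2) + ((\<Sum>p\<in>D1. (f p)\<^sup>2) + (\<Sum>p\<in>D2. (f p)\<^sup>2))))"
  proof -
    have le: "(\<Sum>p\<in>A \<union> B. (f p)\<^sup>2) \<le> (\<Sum>p\<in>A. (f p)\<^sup>2) + (\<Sum>p\<in>B. (f p)\<^sup>2)" if "finite A" "finite B" for A B
      using sum.union_inter[OF that, of "\<lambda>p. (f p)\<^sup>2"] sum_nonneg[of "A \<inter> B" "\<lambda>p. (f p)\<^sup>2"] by simp
    note ff = fin[OF sub(1)] fin[OF sub(3)] fin[OF sub(4)] fin[OF sub(5)]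
    have "(\<Sum>p\<in>Q. (f p)\<^sup>2) \<le> (\<Sum>p\<in>{(0, 0)}. (f p)\<^sup>2) + (\<Sum>p\<in>Vt \<union> (H \<union> (D1 \<union> D2)). (f p)\<^sup>2)"
      unfolding Q by (rule le) (use ff in auto)
    moreover have "(\<Sum>p\<in>Vt \<union> (H \<union> (D1 \<union> D2)). (f p)\<^sup>2) \<le> (\<Sum>p\<in>Vt. (f p)\<^sup>2) + (\<Sum>p\<in>H \<union> (D1 \<union> D2). (f p)\<^sup>2)"
      by (rule le) (use ff in auto)
    moreover have "(\<Sum>p\<in>H \<union> (D1 \<union> D2). (f p)\<^sup>2) \<le> (\<Sum>p\<in>H. (f p)\<^sup>2) + (\<Sum>p\<in>D1 \<union> D2. (f p)\<^sup>2)"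
      by (rule le) (use ff in auto)
    moreover have "(\<Sum>p\<in>D1 \<union> D2. (f p)\<^sup>2) \<le> (\<Sum>p\<in>D1. (f p)\<^sup>2) + (\<Sum>p\<in>D2. (f p)\<^sup>2)"
      by (rule le) (use ff in auto)
    ultimately show ?thesis by linarith
  qed
  also have "\<dots> = (f (0, 0))\<^sup>2 + ((L Vt)\<^sup>2 + ((L H)\<^sup>2 + ((L D1)\<^sup>2 + (L D2)\<^sup>2)))"
    by (simp add: L_def L2_set_sq)
  also have "\<dots> \<le> (f (0, 0))\<^sup>2 + ((20 * e)\<^sup>2 + ((21 * e)\<^sup>2 + ((26 * e)\<^sup>2 + (27 * e)\<^sup>2)))"
    using v vt h2 d1 d2 Lnn by (intro add_mono order.refl power_mono) auto
  \<comment> \<open>The bounds 20, 21, 26 and 27 times e contribute 400 + 441 + 676 + 729 =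
    2246.\<close>
  also have "\<dots> = (f (0, 0))\<^sup>2 + 2246 * e\<^sup>2" by (simp add: power_mult_distrib)
  also have "e\<^sup>2 \<le> 2 * (eA\<^sup>2 + eB\<^sup>2)"
    using zero_le_power2[of "eA - eB"] by (simp add: e_def power2_sum power2_diff)
  finally have "(\<Sum>p\<in>Q. (f p)\<^sup>2) - (f (0, 0))\<^sup>2 \<le> 4492 * (eA\<^sup>2 + eB\<^sup>2)" by simp
  also have "\<dots> \<le> 4500 * (eA\<^sup>2 + eB\<^sup>2)" by (intro mult_right_mono) auto
  finally show ?thesis
    by (simp add: Q_def f_def eA_def eB_def sum.cartesian_product case_prod_beta)
qed

section \<open>Weyl transform of a matrix\<close>

text \<open>The Weyl coefficients of x: its pairing with the product of the shift by a and the
  character of frequency b, without the factor 1 / n. Hence the factor n in \<open>parseval\<close>;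
  at (0, 0) the trace appears.\<close>

definition ctr :: "(int \<Rightarrow> int \<Rightarrow> complex) \<Rightarrow> int \<times> int \<Rightarrow> complex" where
  "ctr x = (\<lambda>(a, b). \<Sum>j\<in>R. x (j + a) j * w (- (b * j)))"

text \<open>Plancherel on Z/n: expand the square and sum over b first.\<close>

lemma parseval_row: "(\<Sum>b\<in>R. (cmod (\<Sum>j\<in>R. g j * w (- (b * j))))\<^sup>2) = of_int n * (\<Sum>j\<in>R. (cmod (g j))\<^sup>2)"
proof -
  have "complex_of_real (\<Sum>b\<in>R. (cmod (\<Sum>j\<in>R. g j * w (- (b * j))))\<^sup>2)
    = (\<Sum>b\<in>R. (\<Sum>j\<in>R. g j * w (- (b * j))) * (\<Sum>l\<in>R. cnj (g l) * w (b * l)))"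
    by (simp only: of_real_sum complex_norm_square cnj_sum complex_cnj_mult w_uminus complex_cnj_cnj)
  also have "\<dots> = (\<Sum>b\<in>R. \<Sum>j\<in>R. \<Sum>l\<in>R. g j * cnj (g l) * w ((l - j) * b))"
    unfolding sum_product
  proof (intro sum.cong refl)
    fix b j l
    have "w ((l - j) * b) = w (- (b * j)) * w (b * l)"
      unfolding w_add[symmetric] by (simp add: algebra_simps)
    then show "g j * w (- (b * j)) * (cnj (g l) * w (b * l)) = g j * cnj (g l) * w ((l - j) * b)" by simp
  qed
  also have "\<dots> = (\<Sum>j\<in>R. \<Sum>l\<in>R. \<Sum>b\<in>R. g j * cnj (g l) * w ((l - j) * b))"
    by (subst sum.swap, rule sum.cong[OF refl], rule sum.swap)
  also have "\<dots> = (\<Sum>j\<in>R. \<Sum>l\<in>R. if l = j then g j * cnj (g j) * of_int n else 0)"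
    by (intro sum.cong refl) (simp add: sum_distrib_left[symmetric] sum_w dvd_diff_R)
  also have "\<dots> = complex_of_real (of_int n * (\<Sum>j\<in>R. (cmod (g j))\<^sup>2))"
    by (simp only: of_real_mult of_real_sum complex_norm_square of_real_of_int_eq sum_distrib_left)
      (simp add: sum.delta mult.commute)
  finally show ?thesis by (simp only: of_real_eq_iff)
qed

lemma parseval:
  assumes "\<And>j. periodic (\<lambda>i. x i j)"
  shows "(hs (ctr x))\<^sup>2 = of_int n * (\<Sum>i\<in>R. \<Sum>j\<in>R. (cmod (x i j))\<^sup>2)"
proof -
  have p: "periodic (\<lambda>i. (cmod (x i j))\<^sup>2)" for j using assms by (simp add: periodic_def)
  have "(hs (ctr x))\<^sup>2 = (\<Sum>a\<in>R. of_int n * (\<Sum>j\<in>R. (cmod (x (j + a) j))\<^sup>2))"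
    unfolding hs_sq ctr_def by (simp add: parseval_row)
  also have "\<dots> = of_int n * (\<Sum>j\<in>R. \<Sum>a\<in>R. (cmod (x (a + j) j))\<^sup>2)"
    by (subst sum.swap) (simp add: sum_distrib_left add.commute)
  also have "\<dots> = of_int n * (\<Sum>j\<in>R. \<Sum>a\<in>R. (cmod (x a j))\<^sup>2)"
    by (simp add: sum_shift[OF p])
  finally show ?thesis by (subst sum.swap)
qed

definition chirp :: "int \<Rightarrow> complex" where "chirp i = w (- i * i + beta * i)"

text \<open>Replacing j by j + a in the chirp adds - 2 * a * j to its exponent. This changes the
  frequency b to b + 2 * a and leaves a phase that depends on a alone.\<close>

lemma shear_ctr: "shear (ctr x) = ctr (\<lambda>i j. chirp i * x i j * cnj (chirp j))"
proof
  fix p :: "int \<times> int"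
  obtain a b where p: "p = (a, b)" by force
  have "w (- a * a + beta * a) * (x (j + a) j * w (- ((b + 2 * a) * j)))
      = chirp (j + a) * x (j + a) j * cnj (chirp j) * w (- (b * j))" for j
  proof -
    have "w (- a * a + beta * a) * w (- ((b + 2 * a) * j)) = chirp (j + a) * cnj (chirp j) * w (- (b * j))"
      unfolding chirp_def w_uminus[symmetric] w_add[symmetric] by (simp add: algebra_simps)
    then show ?thesis by (metis (no_types, lifting) mult.commute mult.left_commute)
  qed
  then show "shear (ctr x) p = ctr (\<lambda>i j. chirp i * x i j * cnj (chirp j)) p"
    unfolding p shear_def ctr_def prod.case sum_distrib_left by (rule sum.cong[OF refl])
qed

text \<open>Conjugation by the unitary Fourier matrix, entry by entry.\<close>

definition fconj :: "(int \<Rightarrow> int \<Rightarrow> complex) \<Rightarrow> int \<Rightarrow> int \<Rightarrow> complex" where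
  "fconj x = (\<lambda>k l. (\<Sum>i\<in>R. \<Sum>j\<in>R. w (k * i) * x i j * w (- (l * j))) / of_int n)"

text \<open>Summing over l first is an orthogonality relation that forces i = j + b modulo n;
  periodicity in the first index then extracts this single term from the sum over i.\<close>

lemma rot_ctr:
  assumes x: "\<And>j. periodic (\<lambda>i. x i j)"
  shows "rot (ctr x) = ctr (fconj x)"
proof
  fix p :: "int \<times> int"
  obtain a b where p: "p = (a, b)" by force
  have inner: "(\<Sum>i\<in>R. w (a * i) * x i j * (if n dvd i - j - b then 1 else 0)) = w (a * (j + b)) * x (j + b) j" for j
  proof -
    have "periodic (\<lambda>i. w (a * i) * x i j * (if n dvd i - j - b then 1 else 0))"
      unfolding periodic_def
    proof (intro allI)
      fix i k
      have "w (a * (i + n * k)) = w (a * i)"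
        using w_add_period[of "a * i" "a * k"] by (simp add: algebra_simps)
      moreover have "n dvd i + n * k - j - b \<longleftrightarrow> n dvd i - j - b"
        using dvd_add_left_iff[of n "n * k" "i - j - b"] by (simp add: algebra_simps)
      ultimately show "w (a * (i + n * k)) * x (i + n * k) j * (if n dvd i + n * k - j - b then 1 else 0)
         = w (a * i) * x i j * (if n dvd i - j - b then 1 else 0)"
        using periodicD[OF x] by simp
    qed
    from sum_shift[OF this, of "j + b"]
    have "(\<Sum>i\<in>R. w (a * i) * x i j * (if n dvd i - j - b then 1 else 0))
       = (\<Sum>i\<in>R. w (a * (i + (j + b))) * x (i + (j + b)) j * (if n dvd i then 1 else 0))" by simp
    also have "\<dots> = (\<Sum>i\<in>R. if i = 0 then w (a * (j + b)) * x (j + b) j else 0)"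
    proof (intro sum.cong refl)
      fix i assume "i \<in> R"
      then have "n dvd i \<longleftrightarrow> i = 0" using dvd_diff_R[of i 0] by (simp add: R_def)
      then show "w (a * (i + (j + b))) * x (i + (j + b)) j * (if n dvd i then 1 else 0)
        = (if i = 0 then w (a * (j + b)) * x (j + b) j else 0)" by simp
    qed
    also have "\<dots> = w (a * (j + b)) * x (j + b) j" by (simp add: sum.delta R_def)
    finally show ?thesis .
  qed
  have n0: "complex_of_int n \<noteq> 0" using n_pos by simp
  have "ctr (fconj x) p = (\<Sum>l\<in>R. \<Sum>i\<in>R. \<Sum>j\<in>R. w (a * i) * x i j * w ((i - j - b) * l) / of_int n)"
    unfolding p ctr_def fconj_def prod.case sum_divide_distrib sum_distrib_right
  proof (intro sum.cong refl)
    fix l i j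
    have "w (a * i) * w ((i - j - b) * l) = w ((l + a) * i) * w (- (l * j)) * w (- (b * l))"
      unfolding w_add[symmetric] by (simp add: algebra_simps)
    then show "w ((l + a) * i) * x i j * w (- (l * j)) / of_int n * w (- (b * l))
       = w (a * i) * x i j * w ((i - j - b) * l) / of_int n"
      by (simp add: field_simps)
  qed
  also have "\<dots> = (\<Sum>i\<in>R. \<Sum>j\<in>R. \<Sum>l\<in>R. w (a * i) * x i j * w ((i - j - b) * l) / of_int n)"
    by (subst sum.swap, rule sum.cong[OF refl], rule sum.swap)
  also have "\<dots> = (\<Sum>i\<in>R. \<Sum>j\<in>R. w (a * i) * x i j * (if n dvd i - j - b then 1 else 0))"
    by (intro sum.cong refl) (simp add: sum_distrib_left[symmetric] sum_divide_distrib[symmetric] sum_w n0 n_pos[THEN less_imp_neq, symmetric])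
  also have "\<dots> = (\<Sum>j\<in>R. w (a * (j + b)) * x (j + b) j)"
    by (subst sum.swap) (simp only: inner)
  also have "\<dots> = rot (ctr x) p"
    by (simp add: p rot_def ctr_def sum_distrib_left distrib_left w_add mult.commute mult.left_commute)
  finally show "rot (ctr x) p = ctr (fconj x) p" by simp
qed

text \<open>The left side is n times the squared distance from x to the scalar matrices, and the
  claim is \<open>weyl_gap\<close> read through Parseval. Only the values on R enter, so x may be
  replaced by its periodic extension.\<close>

theorem numeric_gap:
  "of_int n * (\<Sum>i\<in>R. \<Sum>j\<in>R. (cmod (x i j))\<^sup>2) - (cmod (\<Sum>j\<in>R. x j j))\<^sup>2
    \<le> 4500 * of_int n * ((\<Sum>i\<in>R. \<Sum>j\<in>R. (cmod (chirp i * x i j * cnj (chirp j) - x i j))\<^sup>2)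
       + (\<Sum>i\<in>R. \<Sum>j\<in>R. (cmod (fconj x i j - x i j))\<^sup>2))"
proof -
  define y where "y = (\<lambda>i j. x (rep i) (rep j))"
  have y: "periodic (\<lambda>i. y i j)" for j
    unfolding y_def by (rule periodic_comp_rep)
  have yx: "i \<in> R \<Longrightarrow> j \<in> R \<Longrightarrow> y i j = x i j" for i j by (simp add: y_def rep_id)
  have chirp: "chirp (i + n * k) = chirp i" for i k
  proof -
    have "- (i + n * k) * (i + n * k) + beta * (i + n * k) = (- i * i + beta * i) + n * (beta * k - 2 * i * k - n * k * k)"
      by (simp add: algebra_simps)
    then show ?thesis unfolding chirp_def by (simp only: w_add_period)
  qed
  have c: "periodic (\<lambda>b. ctr y (a, b))" for a
    unfolding periodic_def
  proof (intro allI)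
    fix b k
    have "w (- ((b + n * k) * j)) = w (- (b * j))" for j
      using w_add_period[of "- (b * j)" "- (k * j)"] by (simp add: algebra_simps)
    then show "ctr y (a, b + n * k) = ctr y (a, b)" by (simp add: ctr_def)
  qed
  have lin: "(\<lambda>p. ctr u p - ctr v p) = ctr (\<lambda>i j. u i j - v i j)" for u v
    by (auto simp: ctr_def fun_eq_iff sum_subtractf algebra_simps)
  have 1: "(hs (ctr y))\<^sup>2 = of_int n * (\<Sum>i\<in>R. \<Sum>j\<in>R. (cmod (x i j))\<^sup>2)"
    by (simp add: parseval[OF y] yx)
  have 2: "(hs (\<lambda>p. shear (ctr y) p - ctr y p))\<^sup>2
      = of_int n * (\<Sum>i\<in>R. \<Sum>j\<in>R. (cmod (chirp i * x i j * cnj (chirp j) - x i j))\<^sup>2)"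
    unfolding shear_ctr lin
    by (subst parseval) (use y chirp in \<open>simp_all add: periodic_def yx\<close>)
  have fc: "fconj y (k + n * l) j = fconj y k j" for k l j
  proof -
    have "w ((k + n * l) * i) = w (k * i)" for i
      using w_add_period[of "k * i" "l * i"] by (simp add: algebra_simps)
    then show ?thesis by (simp add: fconj_def)
  qed
  have "fconj y i j = fconj x i j" for i j by (simp add: fconj_def yx)
  then have 3: "(hs (\<lambda>p. rot (ctr y) p - ctr y p))\<^sup>2
      = of_int n * (\<Sum>i\<in>R. \<Sum>j\<in>R. (cmod (fconj x i j - x i j))\<^sup>2)"
    unfolding rot_ctr[OF y] lin
    by (subst parseval) (use y fc in \<open>simp_all add: periodic_def yx\<close>)
  have "(0::int) \<in> R" by (simp add: R_def)
  then have 4: "ctr y (0, 0) = (\<Sum>j\<in>R. x j j)" by (simp add: ctr_def yx)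
  from weyl_gap[OF c] show ?thesis
    unfolding 2 3 4 hs_sq[symmetric] 1 by (simp add: algebra_simps)
qed

end

section \<open>Contractions and averaging\<close>

lemma norm_avg_le: "(norm ((1/2) *\<^sub>R (u + v)))\<^sup>2 \<le> ((norm u)\<^sup>2 + (norm (v :: 'a::real_inner))\<^sup>2) / 2"
proof -
  have "(norm (u + v))\<^sup>2 + (norm (u - v))\<^sup>2 = 2 * ((norm u)\<^sup>2 + (norm v)\<^sup>2)"
    by (simp add: power2_norm_eq_inner inner_simps inner_commute)
  then have "(norm (u + v))\<^sup>2 \<le> 2 * ((norm u)\<^sup>2 + (norm v)\<^sup>2)"
    using zero_le_power2[of "norm (u - v)"] by linarith
  then show ?thesis by (simp add: power_mult_distrib power2_eq_square)
qed

lemma norm_add3_sq_le: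
  "(norm (u + v + t))\<^sup>2 \<le> 3 * ((norm u)\<^sup>2 + (norm v)\<^sup>2 + (norm (t :: 'a::real_inner))\<^sup>2)"
proof -
  have "3 * ((norm u)\<^sup>2 + (norm v)\<^sup>2 + (norm t)\<^sup>2) - (norm (u + v + t))\<^sup>2
    = (norm (u - v))\<^sup>2 + (norm (v - t))\<^sup>2 + (norm (u - t))\<^sup>2"
    by (simp add: power2_norm_eq_inner inner_simps inner_commute)
  then show ?thesis
    using zero_le_power2[of "norm (u - v)"] zero_le_power2[of "norm (v - t)"] zero_le_power2[of "norm (u - t)"]
    by linarith
qed

lemma parallelogram_family:
  fixes A B :: "'k \<Rightarrow> 'a::real_inner"
  shows "(\<Sum>k\<in>I. (norm (A k - B k))\<^sup>2)
    = 2 * (\<Sum>k\<in>I. (norm (A k))\<^sup>2) + 2 * (\<Sum>k\<in>I. (norm (B k))\<^sup>2) - 4 * (\<Sum>k\<in>I. (norm ((1/2) *\<^sub>R (A k + B k)))\<^sup>2)"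
proof -
  have "(norm (A k - B k))\<^sup>2 = 2 * (norm (A k))\<^sup>2 + 2 * (norm (B k))\<^sup>2 - 4 * (norm ((1/2) *\<^sub>R (A k + B k)))\<^sup>2" for k
    unfolding power2_norm_eq_inner by (simp add: inner_simps inner_commute field_simps)
  then show ?thesis by (simp add: sum.distrib sum_subtractf sum_distrib_left)
qed

text \<open>By the parallelogram law a minimizing sequence is Cauchy and two minimizers agree. The
  conclusion is phrased for fixed points: a norm-preserving map of K into itself must fix A on
  I.\<close>

lemma min_norm_family:
  fixes K :: "('k \<Rightarrow> 'a::real_inner) set"
  assumes I: "finite I" and Q: "complete Q" and ne: "K \<noteq> {}"
    and sub: "\<And>A k. A \<in> K \<Longrightarrow> k \<in> I \<Longrightarrow> A k \<in> Q"
    and conv: "\<And>A B. A \<in> K \<Longrightarrow> B \<in> K \<Longrightarrow> (\<lambda>k. (1/2) *\<^sub>R (A k + B k)) \<in> K"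
    and closed: "\<And>F L. (\<And>j. F j \<in> K) \<Longrightarrow> (\<And>k. k \<in> I \<Longrightarrow> (\<lambda>j::nat. F j k) \<longlonglongrightarrow> L k) \<Longrightarrow> L \<in> K"
  shows "\<exists>A\<in>K. \<forall>B\<in>K. (\<Sum>k\<in>I. (norm (B k))\<^sup>2) = (\<Sum>k\<in>I. (norm (A k))\<^sup>2) \<longrightarrow> (\<forall>k\<in>I. B k = A k)"
proof -
  define N where "N = (\<lambda>A. \<Sum>k\<in>I. (norm (A k :: 'a))\<^sup>2)"
  define m where "m = Inf (N ` K)"
  have N0: "N A \<ge> 0" for A by (simp add: N_def sum_nonneg)
  have bdd: "bdd_below (N ` K)" using N0 by (intro bdd_belowI2[of _ 0]) auto
  have m_le: "m \<le> N A" if "A \<in> K" for A unfolding m_def using that bdd by (intro cINF_lower) auto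
  have diff: "(\<Sum>k\<in>I. (norm (A k - B k))\<^sup>2) \<le> 2 * (N A - m) + 2 * (N B - m)" if "A \<in> K" "B \<in> K" for A B
    using parallelogram_family[of A B I] m_le[OF conv[OF that]] by (simp add: N_def)
  have "\<exists>A\<in>K. N A < m + 1 / Suc j" for j
  proof -
    have "m < m + 1 / Suc j" by simp
    then show ?thesis unfolding m_def using ne by (subst (asm) cINF_less_iff) (use bdd ne in \<open>auto simp: m_def\<close>)
  qed
  then obtain F where F: "\<And>j. F j \<in> K" "\<And>j. N (F j) < m + 1 / Suc j" by metis
  have "\<exists>l\<in>Q. (\<lambda>j. F j k) \<longlonglongrightarrow> l" if k: "k \<in> I" for k
  proof -
    have "Cauchy (\<lambda>j. F j k)"
      unfolding Cauchy_def
    proof (intro allI impI)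
      fix \<epsilon> :: real assume "\<epsilon> > 0"
      then obtain M where M: "inverse (real (Suc M)) < \<epsilon>\<^sup>2 / 4" using reals_Archimedean[of "\<epsilon>\<^sup>2 / 4"] by auto
      have "dist (F i k) (F j k) < \<epsilon>" if "i \<ge> M" "j \<ge> M" for i j
      proof -
        have s: "1 / real (Suc l) \<le> inverse (real (Suc M))" if "l \<ge> M" for l
          using that by (simp add: inverse_eq_divide frac_le)
        have "(norm (F i k - F j k))\<^sup>2 \<le> (\<Sum>k\<in>I. (norm (F i k - F j k))\<^sup>2)"
          using I k by (intro member_le_sum) auto
        also have "\<dots> \<le> 2 * (N (F i) - m) + 2 * (N (F j) - m)" by (rule diff[OF F(1) F(1)])
        also have "\<dots> < \<epsilon>\<^sup>2" using F(2)[of i] F(2)[of j] s[OF that(1)] s[OF that(2)] M unfolding right_diff_distrib by linarith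
        finally show ?thesis using \<open>\<epsilon> > 0\<close> by (simp add: dist_norm power2_less_imp_less)
      qed
      then show "\<exists>M. \<forall>i\<ge>M. \<forall>j\<ge>M. dist (F i k) (F j k) < \<epsilon>" by blast
    qed
    moreover have "\<forall>j. F j k \<in> Q" using sub[OF F(1) k] by blast
    ultimately show ?thesis using Q[unfolded complete_def, rule_format, of "\<lambda>j. F j k"] by simp
  qed
  then obtain L where L: "\<And>k. k \<in> I \<Longrightarrow> (\<lambda>j. F j k) \<longlonglongrightarrow> L k" by metis
  have LK: "L \<in> K" by (rule closed[of F, OF F(1) L])
  have "(\<lambda>j. N (F j)) \<longlonglongrightarrow> N L"
    unfolding N_def by (intro tendsto_sum tendsto_power tendsto_norm L)
  moreover have "(\<lambda>j. m + 1 / real (Suc j)) \<longlonglongrightarrow> m"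
    using tendsto_add[OF tendsto_const[of m] LIMSEQ_inverse_real_of_nat] by (simp add: inverse_eq_divide)
  ultimately have "N L \<le> m" using F(2) by (intro LIMSEQ_le[of "\<lambda>j. N (F j)"]) (auto intro: less_imp_le)
  show ?thesis
  proof (rule bexI[OF _ LK], rule ballI, rule impI)
    fix B assume "B \<in> K" "(\<Sum>k\<in>I. (norm (B k))\<^sup>2) = (\<Sum>k\<in>I. (norm (L k))\<^sup>2)"
    then have "(\<Sum>k\<in>I. (norm (B k - L k))\<^sup>2) \<le> 0"
      using diff[of B L] LK \<open>N L \<le> m\<close> by (simp add: N_def)
    then have "(\<Sum>k\<in>I. (norm (B k - L k))\<^sup>2) = 0" by (intro antisym sum_nonneg) auto
    then show "\<forall>k\<in>I. B k = L k" using I by (simp add: sum_nonneg_eq_0_iff)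
  qed
qed

section \<open>Contractions and contractive columns\<close>

text \<open>Operator norm at most 1, expressed through left multiplication so that all estimates
  stay in the Frobenius norm.\<close>

definition contr :: "'i fmat \<Rightarrow> bool" where
  "contr x \<longleftrightarrow> (\<forall>z. norm (x * z) \<le> norm z)"

lemma contrD: "contr x \<Longrightarrow> norm (x * z) \<le> norm z" by (simp add: contr_def)

text \<open>Moving adj x across the inner product leaves z against x * (adj x * z). Cauchy-Schwarz
  and cancellation of one factor conclude.\<close>

lemma contr_adj: assumes "contr x" shows "contr (adj x)"
  unfolding contr_def
proof
  fix z
  have "(norm (adj x * z))\<^sup>2 = inner z (x * (adj x * z))"
    by (simp add: power2_norm_eq_inner inner_mult_left)
  also have "\<dots> \<le> norm z * norm (x * (adj x * z))" by (rule norm_cauchy_schwarz)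
  also have "\<dots> \<le> norm z * norm (adj x * z)" by (intro mult_left_mono contrD assms) auto
  finally have "norm (adj x * z) * norm (adj x * z) \<le> norm z * norm (adj x * z)" by (simp add: power2_eq_square)
  then show "norm (adj x * z) \<le> norm z" by (cases "norm (adj x * z) = 0") auto
qed

lemma contr_right: assumes "contr x" shows "norm (z * x) \<le> norm z"
proof -
  have "norm (z * x) = norm (adj x * adj z)" by (metis adj_mult norm_adj)
  also have "\<dots> \<le> norm z" using contrD[OF contr_adj[OF assms], of "adj z"] by simp
  finally show ?thesis .
qed

lemma contr_mult: "contr x \<Longrightarrow> contr y \<Longrightarrow> contr (x * y)"
  unfolding contr_def by (metis mult.assoc order_trans)

lemma contr_proj: assumes "p * p = p" "adj p = p" shows "contr p"
  unfolding contr_def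
proof
  fix z
  have "(norm (p * z))\<^sup>2 = inner z (p * z)"
    using assms by (simp add: power2_norm_eq_inner inner_mult_left mult.assoc[symmetric])
  also have "\<dots> \<le> norm z * norm (p * z)" by (rule norm_cauchy_schwarz)
  finally have "norm (p * z) * norm (p * z) \<le> norm z * norm (p * z)" by (simp add: power2_eq_square)
  then show "norm (p * z) \<le> norm z" by (cases "norm (p * z) = 0") auto
qed

lemma contr_of_isometry: assumes "contr (adj u * u)" shows "contr u"
  unfolding contr_def
proof
  fix z
  have "(norm (u * z))\<^sup>2 = inner z (adj u * u * z)"
    by (simp add: power2_norm_eq_inner inner_mult_left mult.assoc)
  also have "\<dots> \<le> norm z * norm (adj u * u * z)" by (rule norm_cauchy_schwarz)
  also have "\<dots> \<le> norm z * norm z" by (intro mult_left_mono contrD assms) auto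
  finally show "norm (u * z) \<le> norm z" by (simp add: power2_eq_square[symmetric] power2_le_iff_abs_le)
qed

text \<open>The sum of adj (A b) * A b is at most 1, in a form that passes to midpoints and
  limits.\<close>

definition column_contr :: "'b set \<Rightarrow> ('b \<Rightarrow> 'i fmat) \<Rightarrow> bool" where
  "column_contr I A \<longleftrightarrow> (\<forall>z. (\<Sum>b\<in>I. (norm (A b * z))\<^sup>2) \<le> (norm z)\<^sup>2)"

lemma column_contrD: "column_contr I A \<Longrightarrow> (\<Sum>b\<in>I. (norm (A b * z))\<^sup>2) \<le> (norm z)\<^sup>2" by (simp add: column_contr_def)

text \<open>By duality, the adjoint of a contractive column is a contractive row.\<close>

lemma norm_row_sum:
  assumes "column_contr I A"
  shows "(norm (\<Sum>b\<in>I. adj (A b) * y b))\<^sup>2 \<le> (\<Sum>b\<in>I. (norm (y b))\<^sup>2)"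
proof -
  define s where "s = (\<Sum>b\<in>I. adj (A b) * y b)"
  have "(norm s)\<^sup>2 = (\<Sum>b\<in>I. inner (y b) (A b * s))"
    unfolding power2_norm_eq_inner by (subst (1) s_def) (simp add: inner_sum_left inner_mult_left)
  also have "\<dots> \<le> (\<Sum>b\<in>I. \<bar>norm (y b)\<bar> * \<bar>norm (A b * s)\<bar>)"
    using norm_cauchy_schwarz by (intro sum_mono) simp
  also have "\<dots> \<le> L2_set (\<lambda>b. norm (y b)) I * L2_set (\<lambda>b. norm (A b * s)) I"
    by (rule L2_set_mult_ineq)
  also have "\<dots> \<le> L2_set (\<lambda>b. norm (y b)) I * norm s"
  proof (rule mult_left_mono)
    show "L2_set (\<lambda>b. norm (A b * s)) I \<le> norm s"
      unfolding L2_set_def by (rule real_le_lsqrt) (simp_all add: column_contrD[OF assms])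
  qed (simp add: L2_set_nonneg)
  finally have "norm s * norm s \<le> L2_set (\<lambda>b. norm (y b)) I * norm s" by (simp add: power2_eq_square)
  then have "norm s \<le> L2_set (\<lambda>b. norm (y b)) I"
    by (cases "norm s = 0") (auto simp: L2_set_nonneg)
  then have "(norm s)\<^sup>2 \<le> (L2_set (\<lambda>b. norm (y b)) I)\<^sup>2" by (intro power_mono) auto
  then show ?thesis by (simp add: s_def L2_set_def sum_nonneg)
qed

text \<open>The completely positive map that compresses copies of u by the column A. For a column of
  matrix units e_ib it gives the sum of e_bi u e_ib, which isolates the i-th block of u.\<close>

definition compr :: "'b set \<Rightarrow> ('b \<Rightarrow> 'i fmat) \<Rightarrow> 'i fmat \<Rightarrow> 'i fmat" where
  "compr I A u = (\<Sum>b\<in>I. adj (A b) * u * A b)"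

lemma contr_compr:
  assumes "column_contr I A" "contr u"
  shows "contr (compr I A u)"
  unfolding contr_def
proof
  fix z
  have "(norm (compr I A u * z))\<^sup>2 \<le> (\<Sum>b\<in>I. (norm (u * (A b * z)))\<^sup>2)"
    using norm_row_sum[OF assms(1), of "\<lambda>b. u * (A b * z)"] by (simp add: compr_def sum_distrib_right mult.assoc)
  also have "\<dots> \<le> (\<Sum>b\<in>I. (norm (A b * z))\<^sup>2)"
    by (intro sum_mono power_mono contrD assms(2)) auto
  also have "\<dots> \<le> (norm z)\<^sup>2" by (rule column_contrD[OF assms(1)])
  finally show "norm (compr I A u * z) \<le> norm z" by (simp add: power2_le_iff_abs_le)
qed

text \<open>The three factors are exchanged one at a time. The two column exchanges each cost the
  column distance, and changing U to a costs only its effect on c; the three-term square inequality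
  makes this 3 + 3 and 3.\<close>

lemma compr_close:
  assumes A: "column_contr I A" and c: "column_contr I c" and U: "contr U" and a: "contr a"
  shows "(norm (compr I A U - compr I c a))\<^sup>2
    \<le> 6 * (\<Sum>b\<in>I. (norm (A b - c b))\<^sup>2) + 3 * (\<Sum>b\<in>I. (norm ((U - a) * c b))\<^sup>2)"
proof -
  define t1 where "t1 = (\<Sum>b\<in>I. adj (A b) * (U * (A b - c b)))"
  define t2 where "t2 = (\<Sum>b\<in>I. adj (A b) * ((U - a) * c b))"
  define t3 where "t3 = (\<Sum>b\<in>I. adj (c b) * (adj a * (A b - c b)))"
  have eq: "compr I A U - compr I c a = t1 + t2 + adj t3"
    unfolding compr_def t1_def t2_def t3_def adj_sum sum.distrib[symmetric] sum_subtractf[symmetric]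
    by (intro sum.cong refl) (simp add: adj_mult adj_diff algebra_simps)
  have 1: "(norm t1)\<^sup>2 \<le> (\<Sum>b\<in>I. (norm (A b - c b))\<^sup>2)"
    unfolding t1_def by (rule order_trans[OF norm_row_sum[OF A]]) (intro sum_mono power_mono contrD U norm_ge_zero)
  have 2: "(norm t2)\<^sup>2 \<le> (\<Sum>b\<in>I. (norm ((U - a) * c b))\<^sup>2)"
    unfolding t2_def by (rule norm_row_sum[OF A])
  have 3: "(norm (adj t3))\<^sup>2 \<le> (\<Sum>b\<in>I. (norm (A b - c b))\<^sup>2)"
    unfolding t3_def norm_adj
    by (rule order_trans[OF norm_row_sum[OF c]]) (intro sum_mono power_mono contrD contr_adj a norm_ge_zero)
  show ?thesis unfolding eq using norm_add3_sq_le[of t1 t2 "adj t3"] 1 2 3 unfolding distrib_left by linarith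
qed

section \<open>Units and unitaries of a finite block\<close>

definition unit :: "'i set \<Rightarrow> 'i fmat" where
  "unit J = mkf J (\<lambda>i j. if i = j then 1 else 0)"

lemma ent_unit: "finite J \<Longrightarrow> ent (unit J) i j = (if i \<in> J \<and> i = j then 1 else 0)"
  by (auto simp: unit_def ent_mkf)

lemma supp_unit: "finite J \<Longrightarrow> supp (unit J) \<subseteq> J"
  by (simp add: unit_def supp_mkf)

lemma adj_unit: "finite J \<Longrightarrow> adj (unit J) = unit J"
proof (rule fmat_eqI)
  fix i j assume "finite J"
  then show "ent (adj (unit J)) i j = ent (unit J) i j" by (cases "i = j") (simp_all add: ent_unit)
qed

lemma unit_mult: assumes "finite J" "supp x \<subseteq> J" shows "unit J * x = x"
proof (rule fmat_eqI)
  fix i j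
  have "ent (unit J * x) i j = (\<Sum>k\<in>J. if k = i then ent x i j else 0)"
    using assms supp_unit[OF assms(1)]
    by (subst ent_times[of J]) (simp add: le_infI1, simp add: le_infI1, rule sum.cong, auto simp: ent_unit)
  also have "\<dots> = ent x i j"
  proof (cases "i \<in> J")
    case False
    then have "i \<notin> supp x" using assms(2) by (meson subsetD)
    then show ?thesis using False assms by (simp add: not_supp)
  qed (use assms in simp)
  finally show "ent (unit J * x) i j = ent x i j" .
qed

lemma mult_unit: assumes "finite J" "supp x \<subseteq> J" shows "x * unit J = x"
  using unit_mult[of J "adj x"] assms by (metis adj_adj adj_mult adj_unit supp_adj)

definition unitary :: "'i set \<Rightarrow> 'i fmat \<Rightarrow> bool" where
  "unitary J u \<longleftrightarrow> supp u \<subseteq> J \<and> u * adj u = unit J \<and> adj u * u = unit J"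

lemma contr_unit: "finite J \<Longrightarrow> contr (unit J)"
  by (rule contr_proj) (auto simp: adj_unit unit_mult supp_unit)

lemma unitary_contr: "finite J \<Longrightarrow> unitary J u \<Longrightarrow> contr u"
  by (rule contr_of_isometry) (simp add: unitary_def contr_unit)

lemma unitary_adj: "unitary J u \<Longrightarrow> unitary J (adj u)"
  by (simp add: unitary_def)

lemma supp_mult_subset: "supp x \<subseteq> J \<Longrightarrow> supp y \<subseteq> J \<Longrightarrow> supp (x * y) \<subseteq> J"
  using supp_times[of x y] by (meson Un_least order_trans)

lemma supp_diff_subset: "supp x \<subseteq> J \<Longrightarrow> supp y \<subseteq> J \<Longrightarrow> supp (x - y) \<subseteq> J"
  and supp_add_subset: "supp x \<subseteq> J \<Longrightarrow> supp y \<subseteq> J \<Longrightarrow> supp (x + y) \<subseteq> J"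
  and supp_scaleR_subset: "supp x \<subseteq> J \<Longrightarrow> supp (scaleR r x) \<subseteq> J"
  and supp_scaleC_subset: "supp x \<subseteq> J \<Longrightarrow> supp (scaleC c x) \<subseteq> J"
proof -
  have *: "supp x \<subseteq> J \<Longrightarrow> i \<notin> J \<or> j \<notin> J \<Longrightarrow> ent x i j = 0" for x i j
    by (meson not_supp subsetD)
  show "supp x \<subseteq> J \<Longrightarrow> supp y \<subseteq> J \<Longrightarrow> supp (x - y) \<subseteq> J"
    "supp x \<subseteq> J \<Longrightarrow> supp y \<subseteq> J \<Longrightarrow> supp (x + y) \<subseteq> J"
    "supp x \<subseteq> J \<Longrightarrow> supp (scaleR r x) \<subseteq> J" "supp x \<subseteq> J \<Longrightarrow> supp (scaleC c x) \<subseteq> J"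
    by (rule supp_subsetI; simp add: *)+
qed

lemma unitary_mult:
  assumes J: "finite J" and u: "unitary J u" and v: "unitary J v"
  shows "unitary J (u * v)"
proof -
  have "u * v * adj (u * v) = u * (v * adj v) * adj u" by (simp add: adj_mult mult.assoc)
  also have "\<dots> = u * adj u" using u v by (simp add: unitary_def mult_unit[OF J])
  finally have 1: "u * v * adj (u * v) = unit J" using u by (simp add: unitary_def)
  have "adj (u * v) * (u * v) = adj v * (adj u * u) * v" by (simp add: adj_mult mult.assoc)
  also have "\<dots> = adj v * v" using u v by (simp add: unitary_def mult_unit[OF J])
  finally show ?thesis using 1 u v by (simp add: unitary_def supp_mult_subset)
qed

lemma unitary_unit: "finite J \<Longrightarrow> unitary J (unit J)"
  by (simp add: unitary_def supp_unit adj_unit unit_mult)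

lemma norm_unitary_left:
  assumes "finite J" "unitary J u" "supp x \<subseteq> J"
  shows "norm (u * x) = norm x"
proof (rule antisym)
  show "norm (u * x) \<le> norm x" by (rule contrD[OF unitary_contr[OF assms(1,2)]])
  have "adj u * (u * x) = x" using assms by (simp add: mult.assoc[symmetric] unitary_def unit_mult)
  then show "norm x \<le> norm (u * x)"
    using contrD[OF contr_adj[OF unitary_contr[OF assms(1,2)]], of "u * x"] by simp
qed

lemma norm_unitary_right:
  assumes "finite J" "unitary J u" "supp x \<subseteq> J"
  shows "norm (x * u) = norm x"
  using norm_unitary_left[OF assms(1) unitary_adj[OF assms(2)], of "adj x"] assms(3)
  by (metis adj_mult norm_adj supp_adj)

section \<open>Averaging over a unitary group, and commutants\<close>

lemma complete_limit_supp:
  assumes "finite J" "\<And>j. supp (F j) \<subseteq> J" "(F :: nat \<Rightarrow> 'i fmat) \<longlonglongrightarrow> l"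
  shows "supp l \<subseteq> J"
proof -
  have "Cauchy F" using assms(3) by (rule LIMSEQ_imp_Cauchy)
  then obtain l' where "supp l' \<subseteq> J" "F \<longlonglongrightarrow> l'"
    using complete_supp[OF assms(1)] assms(2) unfolding complete_def by (metis mem_Collect_eq)
  then show ?thesis using LIMSEQ_unique[OF assms(3)] by simp
qed

text \<open>The element of smallest norm of a convex set invariant under conjugation by S is unique,
  hence commutes with S. The convex set keeps track of the distance to y and of the
  contraction property of the columns.\<close>
lemma commuting_approximation:
  fixes y :: "'a \<times> 'b \<Rightarrow> 'i fmat"
  assumes J: "finite J" and I: "finite I1" "finite I2"
    and S: "\<And>s. s \<in> S \<Longrightarrow> unitary J s" "\<And>s t. s \<in> S \<Longrightarrow> t \<in> S \<Longrightarrow> adj s * t \<in> S" "unit J \<in> S"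
    and y: "\<And>k. k \<in> I1 \<times> I2 \<Longrightarrow> supp (y k) \<subseteq> J" "\<And>i. i \<in> I1 \<Longrightarrow> column_contr I2 (\<lambda>b. y (i, b))"
    and c: "\<And>s. s \<in> S \<Longrightarrow> (\<Sum>k\<in>I1 \<times> I2. (norm (y k * s - s * y k))\<^sup>2) \<le> c"
  obtains A where "\<And>k. k \<in> I1 \<times> I2 \<Longrightarrow> supp (A k) \<subseteq> J"
    "\<And>k s. k \<in> I1 \<times> I2 \<Longrightarrow> s \<in> S \<Longrightarrow> s * A k = A k * s"
    "(\<Sum>k\<in>I1 \<times> I2. (norm (A k - y k))\<^sup>2) \<le> c"
    "\<And>i. i \<in> I1 \<Longrightarrow> column_contr I2 (\<lambda>b. A (i, b))"
proof -
  define I where "I = I1 \<times> I2"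
  \<comment> \<open>Closeness is demanded to all conjugates of y: conjugation by t turns the
    condition for s into the one for adj t * s, so K is invariant. Taking s = \<open>unit J\<close>
    recovers the distance to y itself.\<close>
  define K where "K = {A. (\<forall>k\<in>I. supp (A k) \<subseteq> J) \<and> (\<forall>s\<in>S. (\<Sum>k\<in>I. (norm (A k - s * y k * adj s))\<^sup>2) \<le> c)
     \<and> (\<forall>i\<in>I1. column_contr I2 (\<lambda>b. A (i, b)))}"
  have fI: "finite I" using I by (simp add: I_def)
  have iso: "norm (s * x * adj s) = norm x" if "s \<in> S" "supp x \<subseteq> J" for s x
    using norm_unitary_right[OF J unitary_adj[OF S(1)[OF that(1)]], of "s * x"]
      norm_unitary_left[OF J S(1)[OF that(1)] that(2)] S(1)[OF that(1)] that(2)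
    by (simp add: supp_mult_subset unitary_def)
  have yK: "y \<in> K"
    unfolding K_def
  proof (intro CollectI conjI ballI)
    fix s assume s: "s \<in> S"
    note us = S(1)[OF s]
    have "norm (y k - s * y k * adj s) = norm (y k * s - s * y k)" if "k \<in> I" for k
    proof -
      have "(y k * s - s * y k) * adj s = y k * (s * adj s) - s * y k * adj s"
        by (simp add: algebra_simps)
      also have "\<dots> = y k - s * y k * adj s"
        using us y(1)[of k] that by (simp add: unitary_def I_def mult_unit[OF J])
      moreover have "supp (y k * s - s * y k) \<subseteq> J"
        using us y(1)[of k] that by (intro supp_diff_subset supp_mult_subset) (auto simp: unitary_def I_def)
      ultimately show ?thesis using norm_unitary_right[OF J unitary_adj[OF us]] by metis
    qed
    then show "(\<Sum>k\<in>I. (norm (y k - s * y k * adj s))\<^sup>2) \<le> c" using c[OF s] by (simp add: I_def)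
  qed (use y in \<open>auto simp: I_def\<close>)
  have conv: "(\<lambda>k. (1/2) *\<^sub>R (A k + B k)) \<in> K" if "A \<in> K" "B \<in> K" for A B
    unfolding K_def
  proof (intro CollectI conjI ballI)
    fix k assume "k \<in> I"
    then show "supp ((1/2) *\<^sub>R (A k + B k)) \<subseteq> J" using that
      by (intro supp_scaleR_subset supp_add_subset) (auto simp: K_def)
  next
    fix s assume s: "s \<in> S"
    have "(1/2) *\<^sub>R (A k + B k) - s * y k * adj s
       = (1/2) *\<^sub>R ((A k - s * y k * adj s) + (B k - s * y k * adj s))" for k
    proof -
      have "v = (1/2) *\<^sub>R (v + v)" for v :: "'i fmat" by (simp add: scaleR_2[symmetric])
      then have "(1/2) *\<^sub>R (u + v) - x = (1/2) *\<^sub>R ((u - x) + (v - x))" for u v x :: "'i fmat"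
        by (metis add_diff_add scaleR_right_diff_distrib)
      then show ?thesis .
    qed
    then have "(\<Sum>k\<in>I. (norm ((1/2) *\<^sub>R (A k + B k) - s * y k * adj s))\<^sup>2)
      \<le> (\<Sum>k\<in>I. ((norm (A k - s * y k * adj s))\<^sup>2 + (norm (B k - s * y k * adj s))\<^sup>2) / 2)"
      by (intro sum_mono) (simp only: norm_avg_le)
    also have "\<dots> = ((\<Sum>k\<in>I. (norm (A k - s * y k * adj s))\<^sup>2) + (\<Sum>k\<in>I. (norm (B k - s * y k * adj s))\<^sup>2)) / 2"
      by (simp add: sum_divide_distrib[symmetric] sum.distrib)
    also have "\<dots> \<le> (c + c) / 2" using that s by (intro divide_right_mono add_mono) (auto simp: K_def)
    finally show "(\<Sum>k\<in>I. (norm ((1/2) *\<^sub>R (A k + B k) - s * y k * adj s))\<^sup>2) \<le> c" by simp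
  next
    fix i assume i: "i \<in> I1"
    show "column_contr I2 (\<lambda>b. (1/2) *\<^sub>R (A (i, b) + B (i, b)))"
      unfolding column_contr_def
    proof
      fix z
      have "(\<Sum>b\<in>I2. (norm ((1/2) *\<^sub>R (A (i, b) + B (i, b)) * z))\<^sup>2)
        \<le> (\<Sum>b\<in>I2. ((norm (A (i, b) * z))\<^sup>2 + (norm (B (i, b) * z))\<^sup>2) / 2)"
        by (intro sum_mono) (simp only: mult_scaleR_left distrib_right norm_avg_le)
      also have "\<dots> = ((\<Sum>b\<in>I2. (norm (A (i, b) * z))\<^sup>2) + (\<Sum>b\<in>I2. (norm (B (i, b) * z))\<^sup>2)) / 2"
        by (simp add: sum_divide_distrib[symmetric] sum.distrib)
      also have "\<dots> \<le> ((norm z)\<^sup>2 + (norm z)\<^sup>2) / 2" using that i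
        by (intro divide_right_mono add_mono column_contrD) (auto simp: K_def)
      finally show "(\<Sum>b\<in>I2. (norm ((1/2) *\<^sub>R (A (i, b) + B (i, b)) * z))\<^sup>2) \<le> (norm z)\<^sup>2" by simp
    qed
  qed
  have closed: "L \<in> K" if F: "\<And>j::nat. F j \<in> K" and L: "\<And>k. k \<in> I \<Longrightarrow> (\<lambda>j. F j k) \<longlonglongrightarrow> L k" for F L
    unfolding K_def
  proof (intro CollectI conjI ballI)
    fix k assume k: "k \<in> I"
    then show "supp (L k) \<subseteq> J" using F
      by (intro complete_limit_supp[OF J _ L[OF k]]) (auto simp: K_def)
  next
    fix s assume s: "s \<in> S"
    have "(\<lambda>j. \<Sum>k\<in>I. (norm (F j k - s * y k * adj s))\<^sup>2) \<longlonglongrightarrow> (\<Sum>k\<in>I. (norm (L k - s * y k * adj s))\<^sup>2)"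
      by (intro tendsto_sum tendsto_power tendsto_norm tendsto_diff tendsto_const L)
    then show "(\<Sum>k\<in>I. (norm (L k - s * y k * adj s))\<^sup>2) \<le> c"
      by (rule LIMSEQ_le_const2) (use F s in \<open>auto simp: K_def\<close>)
  next
    fix i assume i: "i \<in> I1"
    show "column_contr I2 (\<lambda>b. L (i, b))"
      unfolding column_contr_def
    proof
      fix z
      have "(\<lambda>j. \<Sum>b\<in>I2. (norm (F j (i, b) * z))\<^sup>2) \<longlonglongrightarrow> (\<Sum>b\<in>I2. (norm (L (i, b) * z))\<^sup>2)"
        using i by (intro tendsto_sum tendsto_power tendsto_norm tendsto_mult tendsto_const L) (auto simp: I_def)
      then show "(\<Sum>b\<in>I2. (norm (L (i, b) * z))\<^sup>2) \<le> (norm z)\<^sup>2"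
        by (rule LIMSEQ_le_const2) (use F i in \<open>auto simp: K_def intro!: column_contrD\<close>)
    qed
  qed
  have inv: "(\<lambda>k. t * A k * adj t) \<in> K" if A: "A \<in> K" and t: "t \<in> S" for A t
    unfolding K_def
  proof (intro CollectI conjI ballI)
    note ut = S(1)[OF t]
    have st: "supp t \<subseteq> J" using ut by (simp add: unitary_def)
    fix k assume k: "k \<in> I"
    then show "supp (t * A k * adj t) \<subseteq> J" using A st
      by (intro supp_mult_subset) (auto simp: K_def)
  next
    note ut = S(1)[OF t]
    fix s assume s: "s \<in> S"
    have "norm (t * A k * adj t - s * y k * adj s) = norm (A k - (adj t * s) * y k * adj (adj t * s))" if k: "k \<in> I" for k
    proof -
      have sA: "supp (A k) \<subseteq> J" using A k by (simp add: K_def)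
      have ss: "supp s \<subseteq> J" "supp (y k) \<subseteq> J" "supp t \<subseteq> J"
        using S(1)[OF s] ut y(1) k by (auto simp: unitary_def I_def)
      have "t * (A k - (adj t * s) * y k * adj (adj t * s)) * adj t
        = t * A k * adj t - (t * adj t) * s * y k * adj s * (t * adj t)"
        by (simp add: adj_mult algebra_simps)
      also have "\<dots> = t * A k * adj t - s * y k * adj s"
      proof -
        have "unit J * s = s" "s * y k * adj s * unit J = s * y k * adj s"
          using ss by (simp_all add: unit_mult[OF J] mult_unit[OF J] supp_mult_subset)
        then show ?thesis using ut by (simp add: unitary_def)
      qed
      finally show ?thesis
        using iso[OF t, of "A k - (adj t * s) * y k * adj (adj t * s)"] sA ss
        by (simp add: supp_mult_subset supp_diff_subset)
    qed
    then have "(\<Sum>k\<in>I. (norm (t * A k * adj t - s * y k * adj s))\<^sup>2)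
       = (\<Sum>k\<in>I. (norm (A k - (adj t * s) * y k * adj (adj t * s)))\<^sup>2)" by simp
    also have "\<dots> \<le> c" using A S(2)[OF t s] by (simp add: K_def)
    finally show "(\<Sum>k\<in>I. (norm (t * A k * adj t - s * y k * adj s))\<^sup>2) \<le> c" .
  next
    have ct: "contr t" by (rule unitary_contr[OF J S(1)[OF t]])
    fix i assume i: "i \<in> I1"
    show "column_contr I2 (\<lambda>b. t * A (i, b) * adj t)"
      unfolding column_contr_def
    proof
      fix z
      have "(\<Sum>b\<in>I2. (norm (t * A (i, b) * adj t * z))\<^sup>2) \<le> (\<Sum>b\<in>I2. (norm (A (i, b) * (adj t * z)))\<^sup>2)"
        by (intro sum_mono power_mono) (simp_all add: mult.assoc contrD[OF ct])
      also have "\<dots> \<le> (norm (adj t * z))\<^sup>2" using A i by (intro column_contrD) (auto simp: K_def)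
      also have "\<dots> \<le> (norm z)\<^sup>2" by (intro power_mono contrD contr_adj ct) simp
      finally show "(\<Sum>b\<in>I2. (norm (t * A (i, b) * adj t * z))\<^sup>2) \<le> (norm z)\<^sup>2" .
    qed
  qed
  have ne: "K \<noteq> {}" using yK by (metis empty_iff)
  have sub: "A k \<in> {x. supp x \<subseteq> J}" if "A \<in> K" "k \<in> I" for A k using that by (simp add: K_def)
  have "\<exists>A\<in>K. \<forall>B\<in>K. (\<Sum>k\<in>I. (norm (B k))\<^sup>2) = (\<Sum>k\<in>I. (norm (A k))\<^sup>2) \<longrightarrow> (\<forall>k\<in>I. B k = A k)"
  proof (rule min_norm_family[OF fI complete_supp[OF J] ne])
    show "\<And>A k. A \<in> K \<Longrightarrow> k \<in> I \<Longrightarrow> A k \<in> {x. supp x \<subseteq> J}" by (rule sub)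
    show "\<And>A B. A \<in> K \<Longrightarrow> B \<in> K \<Longrightarrow> (\<lambda>k. (1/2) *\<^sub>R (A k + B k)) \<in> K" by (rule conv)
    show "\<And>F L. (\<And>j::nat. F j \<in> K) \<Longrightarrow> (\<And>k. k \<in> I \<Longrightarrow> (\<lambda>j. F j k) \<longlonglongrightarrow> L k) \<Longrightarrow> L \<in> K" by (rule closed)
  qed
  then obtain A where A: "A \<in> K"
    and uniq: "\<And>B. B \<in> K \<Longrightarrow> (\<Sum>k\<in>I. (norm (B k))\<^sup>2) = (\<Sum>k\<in>I. (norm (A k))\<^sup>2) \<Longrightarrow> \<forall>k\<in>I. B k = A k"
    by metis
  show ?thesis
  proof (rule that[of A])
    show "supp (A k) \<subseteq> J" if "k \<in> I1 \<times> I2" for k using sub[OF A, of k] that unfolding I_def by simp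
    show "column_contr I2 (\<lambda>b. A (i, b))" if "i \<in> I1" for i using A that by (simp add: K_def)
    have "unit J * y k * adj (unit J) = y k" if "k \<in> I" for k
      using y(1) that by (simp add: I_def adj_unit[OF J] unit_mult[OF J] mult_unit[OF J])
    moreover have "(\<Sum>k\<in>I. (norm (A k - unit J * y k * adj (unit J)))\<^sup>2) \<le> c"
      using A S(3) by (simp add: K_def)
    ultimately show "(\<Sum>k\<in>I1 \<times> I2. (norm (A k - y k))\<^sup>2) \<le> c" by (simp add: I_def)
    fix k t assume k: "k \<in> I1 \<times> I2" and t: "t \<in> S"
    have sA: "supp (A k) \<subseteq> J" if "k \<in> I" for k using A that by (simp add: K_def)
    have "(\<Sum>k\<in>I. (norm (t * A k * adj t))\<^sup>2) = (\<Sum>k\<in>I. (norm (A k))\<^sup>2)"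
      using iso[OF t sA] by simp
    moreover have "k \<in> I" unfolding I_def by (rule k)
    ultimately have "t * A k * adj t = A k" using uniq[OF inv[OF A t]] by blast
    then have "t * A k * adj t * t = A k * t" by simp
    moreover have "t * A k * adj t * t = t * A k * unit J"
      using S(1)[OF t] by (simp add: unitary_def mult.assoc)
    moreover have "\<dots> = t * A k"
      using S(1)[OF t] sA[of k] k by (intro mult_unit[OF J] supp_mult_subset) (auto simp: unitary_def I_def)
    ultimately show "t * A k = A k * t" by simp
  qed
qed

text \<open>The Cayley transform of a small skew-adjoint k is a unitary with the same commutant as k.\<close>
lemma cayley_commute:
  assumes J: "finite J" and T: "\<And>t. t \<in> T \<Longrightarrow> supp t \<subseteq> J"
    and psi: "supp \<psi> \<subseteq> J" "\<And>u. unitary J u \<Longrightarrow> (\<And>t. t \<in> T \<Longrightarrow> u * t = t * u) \<Longrightarrow> u * \<psi> = \<psi> * u"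
    and k: "supp k \<subseteq> J" "adj k = - k" "\<And>t. t \<in> T \<Longrightarrow> k * t = t * k"
  shows "k * \<psi> = \<psi> * k"
proof -
  have small: "k * \<psi> = \<psi> * k"
    if k: "supp k \<subseteq> J" "adj k = - k" "\<And>t. t \<in> T \<Longrightarrow> k * t = t * k" "norm k \<le> 1 / 2" for k
  proof -
    define q where "q = unit J"
    have q: "q * x = x" "x * q = x" if "supp x \<subseteq> J" for x
      using that by (simp_all add: q_def unit_mult[OF J] mult_unit[OF J])
    have sq: "supp q \<subseteq> J" by (simp add: q_def supp_unit J)
    have aq: "adj q = q" by (simp add: q_def adj_unit J)
    \<comment> \<open>The inverse of q - l is the fixed point of r -> q + l * r, a contraction with
      factor 1/2.\<close>
    have ex: "\<exists>r. supp r \<subseteq> J \<and> (q - l) * r = q" if l: "supp l \<subseteq> J" "norm l \<le> 1 / 2" for l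
    proof -
      have "\<exists>!r\<in>{x. supp x \<subseteq> J}. q + l * r = r"
      proof (rule Banach_fix[OF complete_supp[OF J]])
        show "{x. supp x \<subseteq> J} \<noteq> {}" using sq by (metis empty_iff mem_Collect_eq)
        show "(\<lambda>r. q + l * r) ` {x. supp x \<subseteq> J} \<subseteq> {x. supp x \<subseteq> J}"
          by (intro image_subsetI CollectI supp_add_subset supp_mult_subset sq l(1)) simp
        show "\<And>x y. x \<in> {x. supp x \<subseteq> J} \<Longrightarrow> y \<in> {x. supp x \<subseteq> J} \<Longrightarrow> dist (q + l * x) (q + l * y) \<le> (1 / 2) * dist x y"
        proof -
          fix x y
          have "dist (q + l * x) (q + l * y) = norm (l * (x - y))" by (simp add: dist_norm right_diff_distrib)
          also have "\<dots> \<le> norm l * norm (x - y)" by (rule norm_mult_ineq)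
          also have "\<dots> \<le> (1 / 2) * dist x y" unfolding dist_norm by (rule mult_right_mono[OF l(2)]) simp
          finally show "dist (q + l * x) (q + l * y) \<le> (1 / 2) * dist x y" .
        qed
      qed auto
      then obtain r where r: "supp r \<subseteq> J" "q + l * r = r" by blast
      then have "(q - l) * r = q" using q[OF r(1)] by (simp add: left_diff_distrib) (metis add_diff_cancel_right' r(2))
      then show ?thesis using r by blast
    qed
    obtain r where r: "supp r \<subseteq> J" "(q - k) * r = q" using ex k by blast
    have "supp (- k) \<subseteq> J" using supp_scaleR_subset[OF k(1), of "-1"] by simp
    then obtain r' where r': "supp r' \<subseteq> J" "(q + k) * r' = q" using ex[of "- k"] k by auto
    have sm: "supp (q - k) \<subseteq> J" "supp (q + k) \<subseteq> J" using sq k(1) by (rule supp_diff_subset, rule supp_add_subset)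
    have am: "adj (q - k) = q + k" "adj (q + k) = q - k" using k(2) aq by (simp_all add: adj_diff adj_add)
    \<comment> \<open>Since k is skew-adjoint, the adjoint of a right inverse of q + k is a left
      inverse of q - k, and it must equal the right inverse r.\<close>
    have "adj r' * (q - k) = q" using arg_cong[OF r'(2), of adj] by (simp add: adj_mult am aq)
    then have ar': "adj r' = r"
      by (metis mult.assoc q(1) q(2) r(1) r(2) r'(1) supp_adj)
    then have rl: "r * (q - k) = q" using \<open>adj r' * (q - k) = q\<close> by simp
    have comm: "r * t = t * r" if t: "supp t \<subseteq> J" "k * t = t * k" for t
    proof -
      have "(q - k) * t = t * (q - k)" using t q by (simp add: algebra_simps)
      then have "r * ((q - k) * t) * r = r * (t * (q - k)) * r" by simp
      then have "r * (q - k) * t * r = r * t * ((q - k) * r)" by (simp add: mult.assoc)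
      then show ?thesis using rl r t q by (simp add: supp_mult_subset)
    qed
    have kr: "(q + k) * r = r * (q + k)" using comm[of k] k(1) q[OF r(1)] by (simp add: algebra_simps)
    define u where "u = (q + k) * r"
    have au: "adj u = r' * (q - k)" unfolding u_def ar'[symmetric] by (simp add: adj_mult am)
    have r'l: "r' * (q + k) = q"
      using arg_cong[OF r(2), of adj] ar' by (metis adj_adj adj_mult am(1) aq)
    have mm: "(q - k) * (q + k) = (q + k) * (q - k)" using q k sq by (simp add: algebra_simps)
    have "adj u * u = r' * ((q - k) * (q + k)) * r" unfolding au unfolding u_def by (simp only: mult.assoc)
    also have "\<dots> = (r' * (q + k)) * ((q - k) * r)" by (simp only: mm mult.assoc)
    also have "\<dots> = q" by (simp add: r'l r(2) q sq)
    finally have 1: "adj u * u = q" .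
    have "u * adj u = r * (((q + k) * r') * (q - k))" unfolding au unfolding u_def kr by (simp only: mult.assoc)
    also have "\<dots> = q" by (simp add: r'(2) q sm rl)
    finally have "unitary J u" using 1 sm r by (simp add: unitary_def q_def[symmetric] u_def supp_mult_subset)
    moreover have "u * t = t * u" if "t \<in> T" for t
    proof -
      have "(q + k) * t = t * (q + k)" using T[OF that] k(3)[OF that] q by (simp add: algebra_simps)
      then show ?thesis unfolding u_def using comm[OF T[OF that] k(3)[OF that]] by (metis mult.assoc)
    qed
    ultimately have up: "u * \<psi> = \<psi> * u" by (rule psi(2))
    \<comment> \<open>Adding q = (q - k) * r to u gives 2 r. So r, and then its inverse q - k,
      inherit from u the commutation with psi.\<close>
    have "q + u = (q - k) * r + (q + k) * r" by (simp add: r(2) u_def)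
    also have "\<dots> = 2 *\<^sub>R r" using q[OF r(1)] by (simp add: algebra_simps scaleR_2)
    finally have "r = (1/2) *\<^sub>R (q + u)" by simp
    then have rp: "r * \<psi> = \<psi> * r" using up q[OF psi(1)] by (simp add: algebra_simps)
    have "(q - k) * \<psi> = (q - k) * (\<psi> * (r * (q - k)))" using rl q[OF psi(1)] by simp
    also have "\<dots> = ((q - k) * r) * \<psi> * (q - k)" using rp by (metis mult.assoc)
    also have "\<dots> = \<psi> * (q - k)" using r q[OF psi(1)] by simp
    finally show ?thesis using q[OF psi(1)] by (simp add: algebra_simps)
  qed
  \<comment> \<open>Commutation is homogeneous in k, which may therefore be scaled into the range of
    the small case.\<close>
  define a where "a = 1 / (2 * (norm k + 1))"
  have a: "a > 0" by (simp add: a_def add_nonneg_pos)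
  have "(a *\<^sub>R k) * \<psi> = \<psi> * (a *\<^sub>R k)"
  proof (rule small)
    show "supp (a *\<^sub>R k) \<subseteq> J" by (rule supp_scaleR_subset[OF k(1)])
    show "adj (a *\<^sub>R k) = - (a *\<^sub>R k)" by (simp add: adj_scaleR k(2))
    show "a *\<^sub>R k * t = t * a *\<^sub>R k" if "t \<in> T" for t using k(3)[OF that] by simp
    show "norm (a *\<^sub>R k) \<le> 1 / 2" using a by (simp add: a_def field_simps add_nonneg_pos)
  qed
  then show ?thesis using a by simp
qed

text \<open>Both x - adj x and i (x + adj x) are skew-adjoint, commute with T and together recover
  x. This extends commutation from the unitaries that commute with T to all operators that commute
  with T together with their adjoints.\<close>

lemma commute_of_unitary_commute:
  assumes J: "finite J" and T: "\<And>t. t \<in> T \<Longrightarrow> supp t \<subseteq> J"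
    and psi: "supp \<psi> \<subseteq> J" "\<And>u. unitary J u \<Longrightarrow> (\<And>t. t \<in> T \<Longrightarrow> u * t = t * u) \<Longrightarrow> u * \<psi> = \<psi> * u"
    and x: "supp x \<subseteq> J" "\<And>t. t \<in> T \<Longrightarrow> x * t = t * x" "\<And>t. t \<in> T \<Longrightarrow> adj x * t = t * adj x"
  shows "x * \<psi> = \<psi> * x"
proof -
  define y where "y = x - adj x"
  define z where "z = x + adj x"
  have "y * \<psi> = \<psi> * y"
  proof (rule cayley_commute[OF J T psi])
    show "supp y \<subseteq> J" unfolding y_def using x(1) by (intro supp_diff_subset) auto
    show "adj y = - y" by (simp add: y_def adj_diff)
    show "y * t = t * y" if "t \<in> T" for t using x(2,3)[OF that] by (simp add: y_def algebra_simps)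
  qed auto
  moreover have "scaleC \<i> z * \<psi> = \<psi> * scaleC \<i> z"
  proof (rule cayley_commute[OF J T psi])
    show "supp (scaleC \<i> z) \<subseteq> J" unfolding z_def using x(1) by (intro supp_scaleC_subset supp_add_subset) auto
    show "adj (scaleC \<i> z) = - scaleC \<i> z"
      by (rule fmat_eqI) (simp add: z_def algebra_simps)
    show "scaleC \<i> z * t = t * scaleC \<i> z" if "t \<in> T" for t using x(2,3)[OF that] by (simp add: z_def algebra_simps)
  qed auto
  then have "scaleC (- \<i>) (scaleC \<i> (z * \<psi>)) = scaleC (- \<i>) (scaleC \<i> (\<psi> * z))" by simp
  then have "z * \<psi> = \<psi> * z" by simp
  moreover have "y + z = 2 *\<^sub>R x" by (simp add: y_def z_def scaleR_2)
  then have "x = (1/2) *\<^sub>R (y + z)" by simp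
  ultimately show ?thesis by (simp add: algebra_simps)
qed

section \<open>Commuting approximants of matrix units\<close>

text \<open>One of the two commuting sides: p projects onto the model space inside J, e stands for
  the matrix units of a tensor factor, a and b for two generators. The gap is stated for a * a
  because in the application the square of a belongs to the span of e while a does not.\<close>

locale half =
  fixes J :: "'i set" and p :: "'i fmat" and I :: "'b set" and e :: "'b \<times> 'b \<Rightarrow> 'i fmat"
    and a b :: "'i fmat" and C :: real
  assumes J: "finite J" and I: "finite I"
    and pp: "p * p = p" and adj_p: "adj p = p" and supp_p: "supp p \<subseteq> J"
    and e_p: "\<And>k. k \<in> I \<times> I \<Longrightarrow> p * e k = e k" "\<And>k. k \<in> I \<times> I \<Longrightarrow> e k * p = e k"
    and e_left: "\<And>z. (\<Sum>k\<in>I \<times> I. (norm (e k * z))\<^sup>2) = real (card I) * (norm (p * z))\<^sup>2"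
    and e_right: "\<And>z. (\<Sum>k\<in>I \<times> I. (norm (z * e k))\<^sup>2) = real (card I) * (norm (z * p))\<^sup>2"
    and e_col: "\<And>i. i \<in> I \<Longrightarrow> column_contr I (\<lambda>b. e (i, b))"
    and a: "p * a = a" "a * p = a" "contr a"
    and b: "p * b = b" "b * p = b" "contr b"
    and C: "C \<ge> 0"
    and gap: "\<And>x. p * x = x \<Longrightarrow> x * p = x \<Longrightarrow> (\<Sum>k\<in>I \<times> I. (norm (e k * x - x * e k))\<^sup>2)
       \<le> real (card I) * C * ((norm (a * a * x - x * (a * a)))\<^sup>2 + (norm (b * x - x * b))\<^sup>2)"
begin

text \<open>In the application this is the scalar \<open>del i\<close> times the Pauli matrix of the
  i-th qubit.\<close>

definition xs :: "'b \<Rightarrow> 'i fmat" where "xs i = compr I (\<lambda>b. e (i, b)) a"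

lemma contr_p: "contr p" by (rule contr_proj[OF pp adj_p])

lemma supp_e: "k \<in> I \<times> I \<Longrightarrow> supp (e k) \<subseteq> J"
proof -
  assume k: "k \<in> I \<times> I"
  have "unit J * e k = e k" by (metis J k e_p(1) mult.assoc supp_p unit_mult)
  moreover have "e k * unit J = e k" by (metis J k e_p(2) mult.assoc supp_p mult_unit)
  ultimately have *: "e k = unit J * e k * unit J" by simp
  show "supp (e k) \<subseteq> J"
  proof (rule supp_subsetI)
    fix i j assume ij: "i \<notin> J \<or> j \<notin> J"
    have u: "ent (unit J) i l = 0" "ent (unit J) l i = 0" if "i \<notin> J" for i l
      using that by (auto simp: ent_unit[OF J])
    show "ent (e k) i j = 0"
    proof (cases "i \<in> J")
      case True
      then have "j \<notin> J" using ij by simp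
      then have "ent (e k * unit J) i j = 0" unfolding ent_times_supp using u by simp
      then show ?thesis using \<open>e k * unit J = e k\<close> by simp
    next
      case False
      then have "ent (unit J * e k) i j = 0" unfolding ent_times_supp using u by simp
      then show ?thesis using \<open>unit J * e k = e k\<close> by simp
    qed
  qed
qed

text \<open>The gap applies to the corner x = p * s * p of s; the parts of s outside this corner are
  controlled by the distance from p to \<open>unit J\<close>.\<close>

lemma almost_commute:
  assumes s: "unitary J s" "s * U1 = U1 * s" "s * U2 = U2 * s"
    and U: "contr U1" "contr U2"
    and close: "(norm (U1 - a))\<^sup>2 \<le> \<eta>" "(norm (U2 - b))\<^sup>2 \<le> \<eta>" "(norm (unit J - p))\<^sup>2 \<le> \<eta>"
  shows "(\<Sum>k\<in>I \<times> I. (norm (e k * s - s * e k))\<^sup>2) \<le> real (card I) * (60 * C + 6) * \<eta>"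
proof -
  define N where "N = real (card I)"
  define x where "x = p * s * p"
  have N: "N \<ge> 0" by (simp add: N_def)
  have \<eta>: "\<eta> \<ge> 0" using close(1) zero_le_power2 order_trans by blast
  have cs: "contr s" by (rule unitary_contr[OF J s(1)])
  have x: "p * x = x" "x * p = x" by (simp_all add: x_def mult.assoc pp) (simp add: mult.assoc[symmetric] pp)
  have compress: "norm (p * y * p) \<le> norm y" for y
    using contr_right[OF contr_p, of "p * y"] contrD[OF contr_p, of y] by linarith
  \<comment> \<open>As s commutes with W, its commutator with c is a commutator with W - c up to
    sign, and cutting by p does not increase the norm.\<close>
  have comm_bound: "norm (c * x - x * c) \<le> 2 * norm (W - c)"
    if c: "p * c = c" "c * p = c" and W: "s * W = W * s" for c W
  proof -
    have "c * x = c * s * p" "p * (c * s) * p = c * s * p"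
      by (simp_all add: x_def c mult.assoc[symmetric])
    moreover have "x * c = p * (s * c)" "p * (s * c) * p = p * (s * c)"
      by (simp_all add: x_def c mult.assoc)
    ultimately have "c * x - x * c = p * (c * s - s * c) * p"
      by (simp only: left_diff_distrib right_diff_distrib)
    also have "c * s - s * c = s * (W - c) - (W - c) * s" using W by (simp add: algebra_simps)
    finally have "norm (c * x - x * c) \<le> norm (s * (W - c) - (W - c) * s)" using compress by simp
    also have "\<dots> \<le> norm (s * (W - c)) + norm ((W - c) * s)" by (rule norm_triangle_ineq4)
    also have "\<dots> \<le> norm (W - c) + norm (W - c)" by (intro add_mono contrD contr_right cs)
    finally show ?thesis by simp
  qed
  have aa: "norm (U1 * U1 - a * a) \<le> 2 * norm (U1 - a)"
  proof -
    have "U1 * U1 - a * a = U1 * (U1 - a) + (U1 - a) * a" by (simp add: algebra_simps)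
    then have "norm (U1 * U1 - a * a) \<le> norm (U1 * (U1 - a)) + norm ((U1 - a) * a)"
      by (simp add: norm_triangle_ineq)
    also have "\<dots> \<le> norm (U1 - a) + norm (U1 - a)" by (intro add_mono contrD contr_right U a)
    finally show ?thesis by simp
  qed
  have "norm (a * a * x - x * (a * a)) \<le> 2 * norm (U1 * U1 - a * a)"
    using a s(2) by (intro comm_bound) (metis mult.assoc)+
  then have "(norm (a * a * x - x * (a * a)))\<^sup>2 \<le> (4 * norm (U1 - a))\<^sup>2"
    using aa by (intro power_mono) auto
  then have g1: "(norm (a * a * x - x * (a * a)))\<^sup>2 \<le> 16 * \<eta>" using close(1) by (simp add: power_mult_distrib)
  have "(norm (b * x - x * b))\<^sup>2 \<le> (2 * norm (U2 - b))\<^sup>2"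
    using b s(3) by (intro power_mono comm_bound) auto
  then have g2: "(norm (b * x - x * b))\<^sup>2 \<le> 4 * \<eta>" using close(2) by (simp add: power_mult_distrib)
  have "(\<Sum>k\<in>I \<times> I. (norm (e k * x - x * e k))\<^sup>2)
      \<le> N * C * ((norm (a * a * x - x * (a * a)))\<^sup>2 + (norm (b * x - x * b))\<^sup>2)"
    unfolding N_def by (rule gap[OF x])
  \<comment> \<open>For a the distance doubles on squaring the operator and again in the commutator,
    hence 4^2; for b only the commutator doubles it, hence 2^2.\<close>
  also have "\<dots> \<le> N * C * (16 * \<eta> + 4 * \<eta>)" using g1 g2 N C by (intro mult_left_mono add_mono) auto
  finally have t1: "(\<Sum>k\<in>I \<times> I. (norm (e k * x - x * e k))\<^sup>2) \<le> N * C * 20 * \<eta>" by simp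
  define r where "r = unit J - p"
  have ss: "supp s \<subseteq> J" using s(1) by (simp add: unitary_def)
  have us: "unit J * s = s" "s * unit J = s" using unit_mult[OF J ss] mult_unit[OF J ss] .
  have "(\<Sum>k\<in>I \<times> I. (norm (e k * (s * r)))\<^sup>2) = N * (norm (p * (s * r)))\<^sup>2" by (simp only: e_left N_def)
  also have "norm (p * (s * r)) \<le> norm r" using contrD[OF contr_p, of "s * r"] contrD[OF cs, of r] by linarith
  then have "N * (norm (p * (s * r)))\<^sup>2 \<le> N * (norm r)\<^sup>2" using N by (intro mult_left_mono power_mono) auto
  also have "\<dots> \<le> N * \<eta>" using N close(3) by (intro mult_left_mono) (simp_all add: r_def)
  finally have t2: "(\<Sum>k\<in>I \<times> I. (norm (e k * (s * r)))\<^sup>2) \<le> N * \<eta>" .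
  have "(\<Sum>k\<in>I \<times> I. (norm ((r * s) * e k))\<^sup>2) = N * (norm (r * s * p))\<^sup>2" by (simp only: e_right N_def)
  also have "norm (r * s * p) \<le> norm r" using contr_right[OF contr_p, of "r * s"] contr_right[OF cs, of r] by linarith
  then have "N * (norm (r * s * p))\<^sup>2 \<le> N * (norm r)\<^sup>2" using N by (intro mult_left_mono power_mono) auto
  also have "\<dots> \<le> N * \<eta>" using N close(3) by (intro mult_left_mono) (simp_all add: r_def)
  finally have t3: "(\<Sum>k\<in>I \<times> I. (norm ((r * s) * e k))\<^sup>2) \<le> N * \<eta>" .
  have "(\<Sum>k\<in>I \<times> I. (norm (e k * s - s * e k))\<^sup>2)
    \<le> (\<Sum>k\<in>I \<times> I. 3 * ((norm (e k * x - x * e k))\<^sup>2 + (norm (e k * (s * r)))\<^sup>2 + (norm (r * s * e k))\<^sup>2))"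
  proof (rule sum_mono)
    fix k assume k: "k \<in> I \<times> I"
    have "e k * x = e k * (s * p)" using e_p(2)[OF k] by (simp add: x_def mult.assoc[symmetric])
    moreover have "x * e k = p * s * e k" using e_p(1)[OF k] by (simp add: x_def mult.assoc)
    moreover have "e k * (s * r) = e k * s - e k * (s * p)" "r * s * e k = s * e k - p * s * e k"
      using us by (simp_all add: r_def right_diff_distrib left_diff_distrib)
    \<comment> \<open>Outside the corner only s * r and r * s occur, each bounded by r. The
      three-term inequality turns 20 * C + 1 + 1 into 60 * C + 6.\<close>
    ultimately have "e k * s - s * e k = (e k * x - x * e k) + e k * (s * r) + (- (r * s * e k))"
      by simp
    then show "(norm (e k * s - s * e k))\<^sup>2
      \<le> 3 * ((norm (e k * x - x * e k))\<^sup>2 + (norm (e k * (s * r)))\<^sup>2 + (norm (r * s * e k))\<^sup>2)"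
      using norm_add3_sq_le[of "e k * x - x * e k" "e k * (s * r)" "- (r * s * e k)"] by simp
  qed
  also have "\<dots> = 3 * ((\<Sum>k\<in>I \<times> I. (norm (e k * x - x * e k))\<^sup>2) + (\<Sum>k\<in>I \<times> I. (norm (e k * (s * r)))\<^sup>2)
     + (\<Sum>k\<in>I \<times> I. (norm (r * s * e k))\<^sup>2))"
    by (simp only: sum_distrib_left[symmetric] sum.distrib)
  also have "\<dots> \<le> 3 * (N * C * 20 * \<eta> + N * \<eta> + N * \<eta>)" using t1 t2 t3 by (intro mult_left_mono add_mono) auto
  also have "\<dots> = N * (60 * C + 6) * \<eta>" by (simp add: algebra_simps)
  finally show ?thesis by (simp add: N_def)
qed

text \<open>The unitary group of the commutant of U1 and U2. Operators on the block that commute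
  with it are those of the bicommutant.\<close>

definition comm_group :: "'i fmat \<Rightarrow> 'i fmat \<Rightarrow> 'i fmat set" where
  "comm_group U1 U2 = {s. unitary J s \<and> s * U1 = U1 * s \<and> s * U2 = U2 * s}"

lemma unitary_adj_commute:
  assumes s: "unitary J s" and u: "supp u \<subseteq> J" and su: "s * u = u * s"
  shows "adj s * u = u * adj s"
proof -
  have "adj s * (s * u) * adj s = adj s * (u * s) * adj s" by (simp only: su)
  then have "(adj s * s) * u * adj s = adj s * u * (s * adj s)" by (simp only: mult.assoc)
  then show ?thesis using s u by (simp add: unitary_def unit_mult[OF J] mult_unit[OF J] supp_mult_subset)
qed

lemma adj_in_comm_group:
  assumes "unitary J U1" "unitary J U2" "s \<in> comm_group U1 U2"
  shows "adj s \<in> comm_group U1 U2"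
  using assms unitary_adj_commute by (auto simp: comm_group_def unitary_adj unitary_def[of J U1] unitary_def[of J U2])

text \<open>Averaging over \<open>comm_group U1 U2\<close> replaces e by operators A of the
  bicommutant, and compressing U1 by A stays close to \<open>xs\<close>. The constant is 6 * (60 * C
  + 6) + 3.\<close>

lemma approximants:
  assumes U: "unitary J U1" "unitary J U2"
    and close: "(norm (U1 - a))\<^sup>2 \<le> \<eta>" "(norm (U2 - b))\<^sup>2 \<le> \<eta>" "(norm (unit J - p))\<^sup>2 \<le> \<eta>"
  obtains A where "\<And>k. k \<in> I \<times> I \<Longrightarrow> supp (A k) \<subseteq> J"
    "\<And>k s. k \<in> I \<times> I \<Longrightarrow> s \<in> comm_group U1 U2 \<Longrightarrow> s * A k = A k * s"
    "\<And>i. i \<in> I \<Longrightarrow> contr (compr I (\<lambda>b. A (i, b)) U1)"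
    "(\<Sum>i\<in>I. (norm (compr I (\<lambda>b. A (i, b)) U1 - xs i))\<^sup>2) \<le> real (card I) * (360 * C + 39) * \<eta>"
proof -
  note cU = unitary_contr[OF J U(1)] unitary_contr[OF J U(2)]
  have sU: "supp U1 \<subseteq> J" "supp U2 \<subseteq> J" using U by (simp_all add: unitary_def)
  define c where "c = real (card I) * (60 * C + 6) * \<eta>"
  obtain A where A: "\<And>k. k \<in> I \<times> I \<Longrightarrow> supp (A k) \<subseteq> J"
    "\<And>k s. k \<in> I \<times> I \<Longrightarrow> s \<in> comm_group U1 U2 \<Longrightarrow> s * A k = A k * s"
    "(\<Sum>k\<in>I \<times> I. (norm (A k - e k))\<^sup>2) \<le> c"
    "\<And>i. i \<in> I \<Longrightarrow> column_contr I (\<lambda>b. A (i, b))"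
  proof (rule commuting_approximation[OF J I I, of "comm_group U1 U2" e c])
    show "unitary J s" if "s \<in> comm_group U1 U2" for s using that by (simp add: comm_group_def)
    show "unit J \<in> comm_group U1 U2"
      using sU by (simp add: comm_group_def unitary_unit[OF J] unit_mult[OF J] mult_unit[OF J])
    show "adj s * t \<in> comm_group U1 U2" if "s \<in> comm_group U1 U2" "t \<in> comm_group U1 U2" for s t
    proof -
      have "adj s \<in> comm_group U1 U2" by (rule adj_in_comm_group[OF U that(1)])
      then show ?thesis using that(2) unitary_mult[OF J] by (auto simp: comm_group_def) (metis mult.assoc)+
    qed
    show "(\<Sum>k\<in>I \<times> I. (norm (e k * s - s * e k))\<^sup>2) \<le> c" if "s \<in> comm_group U1 U2" for s
      unfolding c_def using that by (intro almost_commute[OF _ _ _ cU close]) (simp_all add: comm_group_def)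
  qed (use supp_e e_col that in \<open>assumption | blast\<close>)+
  show ?thesis
  proof (rule that[of A])
    show "contr (compr I (\<lambda>b. A (i, b)) U1)" if "i \<in> I" for i
      by (rule contr_compr[OF A(4)[OF that] cU(1)])
    have "(\<Sum>i\<in>I. (norm (compr I (\<lambda>b. A (i, b)) U1 - xs i))\<^sup>2)
      \<le> (\<Sum>i\<in>I. 6 * (\<Sum>b\<in>I. (norm (A (i, b) - e (i, b)))\<^sup>2) + 3 * (\<Sum>b\<in>I. (norm ((U1 - a) * e (i, b)))\<^sup>2))"
      unfolding xs_def by (intro sum_mono compr_close A e_col cU a)
    also have "\<dots> = 6 * (\<Sum>k\<in>I \<times> I. (norm (A k - e k))\<^sup>2) + 3 * (\<Sum>k\<in>I \<times> I. (norm ((U1 - a) * e k))\<^sup>2)"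
      by (simp add: sum.distrib sum_distrib_left[symmetric] sum.cartesian_product case_prod_beta)
    also have "\<dots> = 6 * (\<Sum>k\<in>I \<times> I. (norm (A k - e k))\<^sup>2) + 3 * (real (card I) * (norm ((U1 - a) * p))\<^sup>2)"
      by (simp only: e_right)
    also have "\<dots> \<le> 6 * c + 3 * (real (card I) * \<eta>)"
    proof (intro add_mono mult_left_mono A(3))
      have "(norm ((U1 - a) * p))\<^sup>2 \<le> (norm (U1 - a))\<^sup>2" by (intro power_mono contr_right contr_p) simp
      then show "(norm ((U1 - a) * p))\<^sup>2 \<le> \<eta>" using close(1) by linarith
    qed auto
    also have "\<dots> = real (card I) * (360 * C + 39) * \<eta>" by (simp add: c_def algebra_simps)
    finally show "(\<Sum>i\<in>I. (norm (compr I (\<lambda>b. A (i, b)) U1 - xs i))\<^sup>2) \<le> real (card I) * (360 * C + 39) * \<eta>" .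
  qed (use A in auto)
qed

end

lemma compr_commute:
  assumes "\<And>i j. i \<in> I \<Longrightarrow> j \<in> K \<Longrightarrow> A i * B j = B j * (A i :: 'i fmat)"
    "\<And>i j. i \<in> I \<Longrightarrow> j \<in> K \<Longrightarrow> adj (A i) * B j = B j * adj (A i)"
    "\<And>i. i \<in> I \<Longrightarrow> A i * V = V * A i" "\<And>i. i \<in> I \<Longrightarrow> adj (A i) * V = V * adj (A i)"
    "\<And>j. j \<in> K \<Longrightarrow> U * B j = B j * U" "\<And>j. j \<in> K \<Longrightarrow> U * adj (B j) = adj (B j) * U"
    "U * V = V * U"
  shows "compr I A U * compr K B V = compr K B V * compr I A U"
proof -
  have mult: "x * (y * z) = (y * z) * x" if "x * y = y * x" "x * z = z * x" for x y z :: "'i fmat"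
    using that by (metis mult.assoc)
  have mult': "(y * z) * x = x * (y * z)" if "y * x = x * y" "z * x = x * z" for x y z :: "'i fmat"
    using mult[of x y z] that by simp
  have AB': "A i * adj (B j) = adj (B j) * A i" "adj (A i) * adj (B j) = adj (B j) * adj (A i)"
    if "i \<in> I" "j \<in> K" for i j
    using arg_cong[OF assms(2)[OF that], of adj] arg_cong[OF assms(1)[OF that], of adj] by (simp_all add: adj_mult)
  have 1: "(adj (A i) * U * A i) * (adj (B j) * V * B j) = (adj (B j) * V * B j) * (adj (A i) * U * A i)"
    if ij: "i \<in> I" "j \<in> K" for i j
    by (intro mult mult' AB' assms ij)
  show ?thesis
    unfolding compr_def sum_product by (subst (2) sum.swap) (intro sum.cong refl 1)
qed

text \<open>The compressions X i and Y i commute, because they lie in commuting bicommutants,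
  whereas their targets anticommute. Summation over i is forced, since only the total approximation
  error is known.\<close>

theorem halves_incompatible:
  fixes J :: "'i set" and I :: "'b set"
  assumes P: "half J p I e a b C" and Q: "half J p I f a' b' C"
    and U: "unitary J U1" "unitary J U2" and V: "unitary J V1" "unitary J V2"
    and comm: "U1 * V1 = V1 * U1" "U1 * V2 = V2 * U1" "U2 * V1 = V1 * U2" "U2 * V2 = V2 * U2"
    and close: "(norm (U1 - a))\<^sup>2 \<le> \<eta>" "(norm (U2 - b))\<^sup>2 \<le> \<eta>" "(norm (V1 - a'))\<^sup>2 \<le> \<eta>"
      "(norm (V2 - b'))\<^sup>2 \<le> \<eta>" "(norm (unit J - p))\<^sup>2 \<le> \<eta>"
    and ne: "I \<noteq> {}"
    and anti: "\<And>i. i \<in> I \<Longrightarrow> half.xs I e a i * half.xs I f a' i = - (half.xs I f a' i * half.xs I e a i)"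
    and dd: "\<And>i. i \<in> I \<Longrightarrow> (norm (half.xs I e a i * half.xs I f a' i))\<^sup>2 = dd"
  shows "dd \<le> 4 * (360 * C + 39) * \<eta>"
proof -
  interpret P: half J p I e a b C by (rule P)
  interpret Q: half J p I f a' b' C by (rule Q)
  obtain A where A: "\<And>k. k \<in> I \<times> I \<Longrightarrow> supp (A k) \<subseteq> J"
    "\<And>k s. k \<in> I \<times> I \<Longrightarrow> s \<in> P.comm_group U1 U2 \<Longrightarrow> s * A k = A k * s"
    "\<And>i. i \<in> I \<Longrightarrow> contr (compr I (\<lambda>b. A (i, b)) U1)"
    "(\<Sum>i\<in>I. (norm (compr I (\<lambda>b. A (i, b)) U1 - P.xs i))\<^sup>2) \<le> real (card I) * (360 * C + 39) * \<eta>"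
    by (rule P.approximants[OF U close(1,2,5)]) (rule that; assumption)
  obtain B where B: "\<And>k. k \<in> I \<times> I \<Longrightarrow> supp (B k) \<subseteq> J"
    "\<And>k s. k \<in> I \<times> I \<Longrightarrow> s \<in> Q.comm_group V1 V2 \<Longrightarrow> s * B k = B k * s"
    "\<And>i. i \<in> I \<Longrightarrow> contr (compr I (\<lambda>b. B (i, b)) V1)"
    "(\<Sum>i\<in>I. (norm (compr I (\<lambda>b. B (i, b)) V1 - Q.xs i))\<^sup>2) \<le> real (card I) * (360 * C + 39) * \<eta>"
    by (rule Q.approximants[OF V close(3,4,5)]) (rule that; assumption)
  define X where "X i = compr I (\<lambda>b. A (i, b)) U1" for i
  define Y where "Y i = compr I (\<lambda>b. B (i, b)) V1" for i
  have V_in: "V1 \<in> P.comm_group U1 U2" "V2 \<in> P.comm_group U1 U2"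
    using V comm by (simp_all add: P.comm_group_def)
  have U_in: "U1 \<in> Q.comm_group V1 V2" "adj U1 \<in> Q.comm_group V1 V2"
    using U comm Q.adj_in_comm_group[OF V] by (simp_all add: Q.comm_group_def)
  have adjA: "adj (A k) * s = s * adj (A k)" if "k \<in> I \<times> I" "s \<in> P.comm_group U1 U2" for k s
    using arg_cong[OF A(2)[OF that(1) P.adj_in_comm_group[OF U that(2)]], of adj] by (simp add: adj_mult)
  have AB: "A k * B l = B l * A k" "adj (A k) * B l = B l * adj (A k)" if kl: "k \<in> I \<times> I" "l \<in> I \<times> I" for k l
  proof -
    have T: "supp t \<subseteq> J" if "t \<in> P.comm_group U1 U2" for t using that by (simp add: P.comm_group_def unitary_def)
    \<comment> \<open>V1 and V2 belong to the group of U1 and U2. A unitary commuting with that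
      whole group therefore lies in the group of V1 and V2, with which B commutes.\<close>
    have psi: "u * B l = B l * u" if "unitary J u" "\<And>t. t \<in> P.comm_group U1 U2 \<Longrightarrow> u * t = t * u" for u
      using that V_in by (intro B(2)[OF kl(2)]) (simp add: Q.comm_group_def)
    show "A k * B l = B l * A k"
      by (rule commute_of_unitary_commute[OF P.J T B(1)[OF kl(2)] psi A(1)[OF kl(1)]])
        (use A(2)[OF kl(1)] adjA[OF kl(1)] in auto)
    show "adj (A k) * B l = B l * adj (A k)"
      by (rule commute_of_unitary_commute[OF P.J T B(1)[OF kl(2)] psi])
        (use A(1)[OF kl(1)] A(2)[OF kl(1)] adjA[OF kl(1)] in auto)
  qed
  have XY: "X i * Y i = Y i * X i" if i: "i \<in> I" for i
    unfolding X_def Y_def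
  proof (rule compr_commute)
    fix b assume "b \<in> I"
    then have k: "(i, b) \<in> I \<times> I" using i by simp
    show "A (i, b) * V1 = V1 * A (i, b)" "adj (A (i, b)) * V1 = V1 * adj (A (i, b))"
      using A(2)[OF k V_in(1)] adjA[OF k V_in(1)] by simp_all
    show "U1 * B (i, b) = B (i, b) * U1" by (rule B(2)[OF k U_in(1)])
    show "U1 * adj (B (i, b)) = adj (B (i, b)) * U1"
      using arg_cong[OF B(2)[OF k U_in(2)], of adj] by (simp add: adj_mult)
  qed (use AB i comm in auto)
  have each: "dd \<le> 2 * (norm (X i - P.xs i))\<^sup>2 + 2 * (norm (Y i - Q.xs i))\<^sup>2" if i: "i \<in> I" for i
  proof -
    define x y where "x = P.xs i" and "y = Q.xs i"
    have cxy: "contr x" "contr y" unfolding x_def y_def P.xs_def Q.xs_def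
      by (intro contr_compr P.e_col Q.e_col i P.a(3) Q.a(3))+
    note cXY = A(3)[OF i, folded X_def] B(3)[OF i, folded Y_def]
    \<comment> \<open>Anticommutation makes the commutator of the targets twice their product. Since
      X i and Y i commute, every remaining term contains a difference from a target.\<close>
    have "2 *\<^sub>R (x * y) = x * y - y * x" using anti[OF i] by (simp add: x_def y_def scaleR_2)
    also have "\<dots> = ((x - X i) * y + X i * (y - Y i)) - ((y - Y i) * x + Y i * (x - X i))"
      using XY[OF i] by (simp add: algebra_simps)
    finally have "2 * norm (x * y) = norm (((x - X i) * y + X i * (y - Y i)) - ((y - Y i) * x + Y i * (x - X i)))"
      by (metis abs_numeral norm_scaleR)
    also have "\<dots> \<le> norm ((x - X i) * y + X i * (y - Y i)) + norm ((y - Y i) * x + Y i * (x - X i))"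
      by (rule norm_triangle_ineq4)
    also have "\<dots> \<le> (norm ((x - X i) * y) + norm (X i * (y - Y i))) + (norm ((y - Y i) * x) + norm (Y i * (x - X i)))"
      by (intro add_mono norm_triangle_ineq)
    also have "\<dots> \<le> (norm (x - X i) + norm (y - Y i)) + (norm (y - Y i) + norm (x - X i))"
      by (intro add_mono contrD contr_right cxy cXY)
    finally have "norm (x * y) \<le> norm (x - X i) + norm (y - Y i)" by simp
    then have "(norm (x * y))\<^sup>2 \<le> (norm (x - X i) + norm (y - Y i))\<^sup>2" by (intro power_mono) auto
    also have "\<dots> \<le> 2 * (norm (x - X i))\<^sup>2 + 2 * (norm (y - Y i))\<^sup>2"
      using zero_le_power2[of "norm (x - X i) - norm (y - Y i)"] by (simp add: power2_sum power2_diff)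
    finally show ?thesis using dd[OF i] by (simp add: x_def y_def norm_minus_commute)
  qed
  have "real (card I) * dd = (\<Sum>i\<in>I. dd)" by simp
  also have "\<dots> \<le> (\<Sum>i\<in>I. 2 * (norm (X i - P.xs i))\<^sup>2 + 2 * (norm (Y i - Q.xs i))\<^sup>2)"
    by (intro sum_mono each)
  also have "\<dots> = 2 * (\<Sum>i\<in>I. (norm (X i - P.xs i))\<^sup>2) + 2 * (\<Sum>i\<in>I. (norm (Y i - Q.xs i))\<^sup>2)"
    by (simp add: sum.distrib sum_distrib_left)
  also have "\<dots> \<le> 2 * (real (card I) * (360 * C + 39) * \<eta>) + 2 * (real (card I) * (360 * C + 39) * \<eta>)"
    using A(4) B(4) by (intro add_mono mult_left_mono) (simp_all add: X_def Y_def)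
  also have "\<dots> = real (card I) * (4 * (360 * C + 39) * \<eta>)" by (simp add: algebra_simps)
  finally show ?thesis using ne P.I by (simp add: card_gt_0_iff)
qed

section \<open>Tensor factors\<close>

lemma ent_sum: "ent (\<Sum>i\<in>A. f i) x y = (\<Sum>i\<in>A. ent (f i) x y)"
  by (induction A rule: infinite_finite_induct) auto

lemma supp_zero [simp]: "supp 0 = {}" by (simp add: supp_def)

lemma supp_sum_subset: "(\<And>i. i \<in> A \<Longrightarrow> supp (f i) \<subseteq> L) \<Longrightarrow> supp (\<Sum>i\<in>A. f i) \<subseteq> L"
  by (induction A rule: infinite_finite_induct) (simp_all add: supp_add_subset)

lemma scaleC_sum: "scaleC c (\<Sum>i\<in>A. f i) = (\<Sum>i\<in>A. scaleC c (f i))"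
  by (rule fmat_eqI) (simp add: ent_sum sum_distrib_left)

text \<open>The index set K is a product of B and Rs, with coordinates pr and rs, and am m is
  m tensored with the identity.\<close>
locale amp =
  fixes B :: "'b set" and Rs :: "'r set" and \<kappa> :: "'r \<Rightarrow> 'b \<Rightarrow> 'i" and pr :: "'i \<Rightarrow> 'b" and rs :: "'i \<Rightarrow> 'r"
  assumes finB: "finite B" and finRs: "finite Rs"
    and pr: "pr (\<kappa> r b) = b" and rs: "rs (\<kappa> r b) = r"
begin

definition K :: "'i set" where "K = (\<lambda>(r, b). \<kappa> r b) ` (Rs \<times> B)"

definition am :: "('b \<Rightarrow> 'b \<Rightarrow> complex) \<Rightarrow> 'i fmat" where
  "am m = mkf K (\<lambda>x y. if rs x = rs y then m (pr x) (pr y) else 0)"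

lemma finK [simp]: "finite K" using finB finRs by (simp add: K_def)

lemma kappa_in: "r \<in> Rs \<Longrightarrow> b \<in> B \<Longrightarrow> \<kappa> r b \<in> K" by (auto simp: K_def)

lemma kappa_cases:
  assumes "x \<in> K" obtains r b where "r \<in> Rs" "b \<in> B" "x = \<kappa> r b"
  using assms unfolding K_def by force

lemma kappa_eq [simp]: "\<kappa> r b = \<kappa> r' b' \<longleftrightarrow> r = r' \<and> b = b'" by (metis pr rs)

lemma sum_K: "(\<Sum>x\<in>K. f x) = (\<Sum>r\<in>Rs. \<Sum>b\<in>B. f (\<kappa> r b))"
proof -
  have "inj_on (\<lambda>(r, b). \<kappa> r b) (Rs \<times> B)" by (auto simp: inj_on_def)
  then show ?thesis unfolding K_def
    by (subst sum.reindex) (simp_all add: sum.cartesian_product case_prod_beta)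
qed

lemma supp_am: "supp (am m) \<subseteq> K" by (simp add: am_def supp_mkf)

lemma ent_am: "r \<in> Rs \<Longrightarrow> r' \<in> Rs \<Longrightarrow> b \<in> B \<Longrightarrow> c \<in> B \<Longrightarrow>
    ent (am m) (\<kappa> r b) (\<kappa> r' c) = (if r = r' then m b c else 0)"
  by (simp add: am_def ent_mkf kappa_in pr rs)

lemma eqI_K:
  assumes "supp x \<subseteq> K" "supp y \<subseteq> K"
    "\<And>r b r' c. r \<in> Rs \<Longrightarrow> r' \<in> Rs \<Longrightarrow> b \<in> B \<Longrightarrow> c \<in> B \<Longrightarrow> ent x (\<kappa> r b) (\<kappa> r' c) = ent y (\<kappa> r b) (\<kappa> r' c)"
  shows "x = y"
proof (rule fmat_eqI)
  fix i j
  show "ent x i j = ent y i j"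
  proof (cases "i \<in> K \<and> j \<in> K")
    case True
    then obtain r b r' c where "r \<in> Rs" "b \<in> B" "r' \<in> Rs" "c \<in> B" "i = \<kappa> r b" "j = \<kappa> r' c"
      using kappa_cases by metis
    then show ?thesis using assms(3) by simp
  next
    case False
    then have "i \<notin> supp x \<or> j \<notin> supp x" "i \<notin> supp y \<or> j \<notin> supp y" using assms(1,2) by (meson subsetD)+
    then show ?thesis by (simp add: not_supp)
  qed
qed

lemma ent_am_mult:
  assumes "r \<in> Rs" "b \<in> B"
  shows "ent (am m * x) (\<kappa> r b) y = (\<Sum>c\<in>B. m b c * ent x (\<kappa> r c) y)"
proof -
  have "ent (am m * x) (\<kappa> r b) y = (\<Sum>k\<in>K. ent (am m) (\<kappa> r b) k * ent x k y)"
    using supp_am[of m] by (intro ent_times) (auto intro: le_infI1)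
  also have "\<dots> = (\<Sum>r'\<in>Rs. if r' = r then \<Sum>c\<in>B. m b c * ent x (\<kappa> r c) y else 0)"
    unfolding sum_K using assms by (intro sum.cong refl) (auto simp: ent_am)
  also have "\<dots> = (\<Sum>c\<in>B. m b c * ent x (\<kappa> r c) y)" using assms finRs by simp
  finally show ?thesis .
qed

lemma ent_mult_am:
  assumes "r \<in> Rs" "c \<in> B"
  shows "ent (x * am m) y (\<kappa> r c) = (\<Sum>b\<in>B. ent x y (\<kappa> r b) * m b c)"
proof -
  have "ent (x * am m) y (\<kappa> r c) = (\<Sum>k\<in>K. ent x y k * ent (am m) k (\<kappa> r c))"
    using supp_am[of m] by (intro ent_times) (auto intro: le_infI2)
  also have "\<dots> = (\<Sum>r'\<in>Rs. if r' = r then \<Sum>b\<in>B. ent x y (\<kappa> r b) * m b c else 0)"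
    unfolding sum_K using assms by (intro sum.cong refl) (auto simp: ent_am)
  also have "\<dots> = (\<Sum>b\<in>B. ent x y (\<kappa> r b) * m b c)" using assms finRs by simp
  finally show ?thesis .
qed

text \<open>The hypothesis says that x acts as the identity on the B coordinate.\<close>
lemma am_commute:
  assumes x: "supp x \<subseteq> K"
    and f: "\<And>r r' b c. r \<in> Rs \<Longrightarrow> r' \<in> Rs \<Longrightarrow> b \<in> B \<Longrightarrow> c \<in> B \<Longrightarrow>
      ent x (\<kappa> r b) (\<kappa> r' c) = (if b = c then f r r' else 0)"
  shows "am m * x = x * am m"
proof (rule eqI_K)
  fix r b r' c assume a: "r \<in> Rs" "r' \<in> Rs" "b \<in> B" "c \<in> B"
  have "ent (am m * x) (\<kappa> r b) (\<kappa> r' c) = (\<Sum>d\<in>B. if d = c then m b c * f r r' else 0)"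
    unfolding ent_am_mult[OF a(1,3)] using a by (intro sum.cong refl) (auto simp: f)
  moreover have "ent (x * am m) (\<kappa> r b) (\<kappa> r' c) = (\<Sum>d\<in>B. if d = b then f r r' * m b c else 0)"
    unfolding ent_mult_am[OF a(2,4)] using a by (intro sum.cong refl) (auto simp: f)
  ultimately show "ent (am m * x) (\<kappa> r b) (\<kappa> r' c) = ent (x * am m) (\<kappa> r b) (\<kappa> r' c)"
    using a finB by (simp add: sum.delta mult.commute)
qed (intro supp_mult_subset supp_am x)+

lemma am_cong: "(\<And>b c. b \<in> B \<Longrightarrow> c \<in> B \<Longrightarrow> m b c = m' b c) \<Longrightarrow> am m = am m'"
  by (rule eqI_K[OF supp_am supp_am]) (simp add: ent_am)

lemma am_mult: "am m * am m' = am (\<lambda>b c. \<Sum>d\<in>B. m b d * m' d c)"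
  by (rule eqI_K[OF supp_mult_subset[OF supp_am supp_am] supp_am]) (simp add: ent_am_mult ent_am)

lemma am_adj: "adj (am m) = am (\<lambda>b c. cnj (m c b))"
  by (rule eqI_K) (simp_all add: supp_am ent_am)

lemma am_scaleC: "scaleC c (am m) = am (\<lambda>x y. c * m x y)"
  by (rule eqI_K[OF supp_scaleC_subset[OF supp_am] supp_am]) (simp add: ent_am)

lemma am_id: "am (\<lambda>b c. if b = c then 1 else 0) = unit K"
  by (rule eqI_K[OF supp_am supp_unit]) (auto simp: ent_am ent_unit kappa_in)

definition E :: "'b \<Rightarrow> 'b \<Rightarrow> 'i fmat" where
  "E i b = am (\<lambda>x y. if x = i \<and> y = b then 1 else 0)"

lemma supp_E: "supp (E i b) \<subseteq> K" by (simp add: E_def supp_am)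

lemma adj_E: "adj (E i b) = E b i"
  unfolding E_def am_adj by (rule am_cong) auto

lemma E_mult: assumes "b \<in> B" shows "E i b * E j c = (if b = j then E i c else 0)"
proof -
  have "E i b * E j c = am (\<lambda>x y. \<Sum>d\<in>B. if d = b then (if x = i \<and> b = j \<and> y = c then 1 else 0) else 0)"
    unfolding E_def am_mult by (intro am_cong sum.cong) auto
  also have "\<dots> = am (\<lambda>x y. if x = i \<and> b = j \<and> y = c then 1 else 0)" using assms finB by simp
  also have "\<dots> = (if b = j then E i c else 0)"
  proof (cases "b = j")
    case False
    then show ?thesis by (intro fmat_eqI) (simp add: am_def ent_mkf)
  qed (simp add: E_def)
  finally show ?thesis .
qed

lemma diag_sum: "(\<Sum>b\<in>B. scaleC (c b) (E b b)) = am (\<lambda>x y. if x = y then c x else 0)"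
proof (rule eqI_K)
  show "supp (\<Sum>b\<in>B. scaleC (c b) (E b b)) \<subseteq> K" by (intro supp_sum_subset supp_scaleC_subset supp_E)
  fix r b r' d assume a: "r \<in> Rs" "r' \<in> Rs" "b \<in> B" "d \<in> B"
  have "ent (\<Sum>b\<in>B. scaleC (c b) (E b b)) (\<kappa> r b) (\<kappa> r' d)
      = (\<Sum>x\<in>B. if x = b then (if r = r' \<and> b = d then c b else 0) else 0)"
    unfolding ent_sum using a by (intro sum.cong refl) (auto simp: E_def ent_am)
  also have "\<dots> = ent (am (\<lambda>x y. if x = y then c x else 0)) (\<kappa> r b) (\<kappa> r' d)"
    using a finB by (simp add: ent_am)
  finally show "ent (\<Sum>b\<in>B. scaleC (c b) (E b b)) (\<kappa> r b) (\<kappa> r' d)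
      = ent (am (\<lambda>x y. if x = y then c x else 0)) (\<kappa> r b) (\<kappa> r' d)" .
qed (rule supp_am)

lemma E_sum: "(\<Sum>b\<in>B. E b b) = unit K"
  using diag_sum[of "\<lambda>_. 1"] by (simp add: am_id)

lemma norm_unit_mult: "(norm (unit K * z))\<^sup>2 = inner z (unit K * z)"
  by (simp add: power2_norm_eq_inner inner_mult_left adj_unit unit_mult supp_unit mult.assoc[symmetric])

lemma E_col_sum: assumes "i \<in> B" shows "(\<Sum>b\<in>B. (norm (E i b * z))\<^sup>2) = (norm (unit K * z))\<^sup>2"
proof -
  have "(norm (E i b * z))\<^sup>2 = inner z (E b b * z)" if "b \<in> B" for b
    by (simp add: power2_norm_eq_inner inner_mult_left adj_E mult.assoc[symmetric] E_mult assms)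
  then have "(\<Sum>b\<in>B. (norm (E i b * z))\<^sup>2) = inner z ((\<Sum>b\<in>B. E b b) * z)"
    by (simp add: inner_sum_right sum_distrib_right)
  then show ?thesis by (simp add: E_sum norm_unit_mult)
qed

lemma E_column_contr: "i \<in> B \<Longrightarrow> column_contr B (\<lambda>b. E i b)"
  unfolding column_contr_def by (simp add: E_col_sum contrD[OF contr_unit] power_mono)

lemma E_left: "(\<Sum>k\<in>B \<times> B. (norm (E (fst k) (snd k) * z))\<^sup>2) = real (card B) * (norm (unit K * z))\<^sup>2"
proof -
  have "(\<Sum>k\<in>B \<times> B. (norm (E (fst k) (snd k) * z))\<^sup>2) = (\<Sum>i\<in>B. \<Sum>b\<in>B. (norm (E i b * z))\<^sup>2)"
    by (simp add: sum.cartesian_product case_prod_beta)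
  also have "\<dots> = (\<Sum>i\<in>B. (norm (unit K * z))\<^sup>2)" by (intro sum.cong refl E_col_sum)
  finally show ?thesis by simp
qed

lemma E_right: "(\<Sum>k\<in>B \<times> B. (norm (z * E (fst k) (snd k)))\<^sup>2) = real (card B) * (norm (z * unit K))\<^sup>2"
proof -
  have adj: "norm (z * E i b) = norm (E b i * adj z)" for i b
    by (metis adj_E adj_mult norm_adj)
  have "norm (z * unit K) = norm (unit K * adj z)" by (metis adj_unit adj_mult norm_adj finK)
  moreover have "(\<Sum>k\<in>B \<times> B. (norm (z * E (fst k) (snd k)))\<^sup>2) = (\<Sum>i\<in>B. \<Sum>b\<in>B. (norm (E b i * adj z))\<^sup>2)"
    by (simp add: sum.cartesian_product case_prod_beta adj)
  moreover have "\<dots> = (\<Sum>b\<in>B. \<Sum>i\<in>B. (norm (E b i * adj z))\<^sup>2)" by (rule sum.swap)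
  moreover have "\<dots> = (\<Sum>b\<in>B. (norm (unit K * adj z))\<^sup>2)" by (intro sum.cong refl E_col_sum)
  ultimately show ?thesis by simp
qed

lemma norm_slices:
  assumes "supp x \<subseteq> K"
  shows "(norm x)\<^sup>2 = (\<Sum>r\<in>Rs. \<Sum>r'\<in>Rs. \<Sum>b\<in>B. \<Sum>c\<in>B. (cmod (ent x (\<kappa> r b) (\<kappa> r' c)))\<^sup>2)"
  unfolding norm_fmat_sq[OF finK assms] sum_K by (rule sum.cong[OF refl], rule sum.swap)

lemma inner_E:
  assumes x: "supp x \<subseteq> K" and "i \<in> B" "b \<in> B"
  shows "inner (E i b * x) (x * E i b) =
    (\<Sum>r\<in>Rs. \<Sum>r'\<in>Rs. Re (ent x (\<kappa> r b) (\<kappa> r' b) * cnj (ent x (\<kappa> r i) (\<kappa> r' i))))"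
proof -
  have "inner (E i b * x) (x * E i b) = (\<Sum>r\<in>Rs. \<Sum>a\<in>B. \<Sum>r'\<in>Rs. \<Sum>c\<in>B.
      Re (ent (E i b * x) (\<kappa> r a) (\<kappa> r' c) * cnj (ent (x * E i b) (\<kappa> r a) (\<kappa> r' c))))"
    using supp_mult_subset[OF supp_E x, of i b]
    by (subst inner_fmat_eq[of K]) (auto simp: sum_K intro: le_infI1)
  also have "\<dots> = (\<Sum>r\<in>Rs. \<Sum>a\<in>B. \<Sum>r'\<in>Rs. \<Sum>c\<in>B. if c = b then (if a = i then
      Re (ent x (\<kappa> r b) (\<kappa> r' b) * cnj (ent x (\<kappa> r i) (\<kappa> r' i))) else 0) else 0)"
  proof (intro sum.cong refl)
    fix r a r' c assume a: "r \<in> Rs" "a \<in> B" "r' \<in> Rs" "c \<in> B"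
    have "ent (E i b * x) (\<kappa> r a) (\<kappa> r' c) = (\<Sum>d\<in>B. if d = b then (if a = i then ent x (\<kappa> r b) (\<kappa> r' c) else 0) else 0)"
      unfolding E_def ent_am_mult[OF a(1,2)] by (intro sum.cong) auto
    moreover have "ent (x * E i b) (\<kappa> r a) (\<kappa> r' c) = (\<Sum>d\<in>B. if d = i then (if c = b then ent x (\<kappa> r a) (\<kappa> r' i) else 0) else 0)"
      unfolding E_def ent_mult_am[OF a(3,4)] by (intro sum.cong) auto
    ultimately show "Re (ent (E i b * x) (\<kappa> r a) (\<kappa> r' c) * cnj (ent (x * E i b) (\<kappa> r a) (\<kappa> r' c)))
       = (if c = b then (if a = i then
      Re (ent x (\<kappa> r b) (\<kappa> r' b) * cnj (ent x (\<kappa> r i) (\<kappa> r' i))) else 0) else 0)"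
      using finB assms(2,3) by (simp add: sum.delta)
  qed
  also have "\<dots> = (\<Sum>r\<in>Rs. \<Sum>a\<in>B. if a = i then (\<Sum>r'\<in>Rs.
      Re (ent x (\<kappa> r b) (\<kappa> r' b) * cnj (ent x (\<kappa> r i) (\<kappa> r' i)))) else 0)"
    using finB assms(3) by (intro sum.cong refl) (simp add: sum.delta)
  also have "\<dots> = (\<Sum>r\<in>Rs. \<Sum>r'\<in>Rs. Re (ent x (\<kappa> r b) (\<kappa> r' b) * cnj (ent x (\<kappa> r i) (\<kappa> r' i))))"
    using finB assms(2) by (simp add: sum.delta)
  finally show ?thesis .
qed

text \<open>Expanding the squares leaves the cross terms, which are traces of slices. For fixed r
  and r' the slice is a matrix over B, and the summand is card B times its squared distance to the
  scalars, the left side of \<open>numeric_gap\<close>.\<close>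

lemma commutator_slices:
  assumes x: "supp x \<subseteq> K"
  shows "(\<Sum>k\<in>B \<times> B. (norm (E (fst k) (snd k) * x - x * E (fst k) (snd k)))\<^sup>2)
    = 2 * (\<Sum>r\<in>Rs. \<Sum>r'\<in>Rs. real (card B) * (\<Sum>b\<in>B. \<Sum>c\<in>B. (cmod (ent x (\<kappa> r b) (\<kappa> r' c)))\<^sup>2)
        - (cmod (\<Sum>b\<in>B. ent x (\<kappa> r b) (\<kappa> r' b)))\<^sup>2)"
proof -
  have ux: "unit K * x = x" "x * unit K = x" by (simp_all add: unit_mult mult_unit x)
  have "(\<Sum>k\<in>B \<times> B. inner (E (fst k) (snd k) * x) (x * E (fst k) (snd k)))
      = (\<Sum>i\<in>B. \<Sum>b\<in>B. inner (E i b * x) (x * E i b))"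
    by (simp add: sum.cartesian_product case_prod_beta)
  also have "\<dots> = (\<Sum>i\<in>B. \<Sum>b\<in>B. \<Sum>r\<in>Rs. \<Sum>r'\<in>Rs. Re (ent x (\<kappa> r b) (\<kappa> r' b) * cnj (ent x (\<kappa> r i) (\<kappa> r' i))))"
    by (intro sum.cong refl inner_E x)
  also have "\<dots> = (\<Sum>i\<in>B. \<Sum>r\<in>Rs. \<Sum>r'\<in>Rs. \<Sum>b\<in>B. Re (ent x (\<kappa> r b) (\<kappa> r' b) * cnj (ent x (\<kappa> r i) (\<kappa> r' i))))"
    by (rule sum.cong[OF refl], subst sum.swap, rule sum.cong[OF refl], rule sum.swap)
  also have "\<dots> = (\<Sum>r\<in>Rs. \<Sum>r'\<in>Rs. \<Sum>i\<in>B. \<Sum>b\<in>B. Re (ent x (\<kappa> r b) (\<kappa> r' b) * cnj (ent x (\<kappa> r i) (\<kappa> r' i))))"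
    by (subst sum.swap, rule sum.cong[OF refl], rule sum.swap)
  also have "\<dots> = (\<Sum>r\<in>Rs. \<Sum>r'\<in>Rs. (cmod (\<Sum>b\<in>B. ent x (\<kappa> r b) (\<kappa> r' b)))\<^sup>2)"
    unfolding Re_mult_cnj_self[symmetric] cnj_sum sum_product Re_sum
    by (rule sum.cong[OF refl], rule sum.cong[OF refl], rule sum.swap)
  finally have inn: "(\<Sum>k\<in>B \<times> B. inner (E (fst k) (snd k) * x) (x * E (fst k) (snd k)))
      = (\<Sum>r\<in>Rs. \<Sum>r'\<in>Rs. (cmod (\<Sum>b\<in>B. ent x (\<kappa> r b) (\<kappa> r' b)))\<^sup>2)" .
  have "(norm (u - v))\<^sup>2 = (norm u)\<^sup>2 + (norm v)\<^sup>2 - 2 * inner u v" for u v :: "'i fmat"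
    by (simp add: power2_norm_eq_inner inner_simps inner_commute)
  then have "(\<Sum>k\<in>B \<times> B. (norm (E (fst k) (snd k) * x - x * E (fst k) (snd k)))\<^sup>2)
    = (\<Sum>k\<in>B \<times> B. (norm (E (fst k) (snd k) * x))\<^sup>2) + (\<Sum>k\<in>B \<times> B. (norm (x * E (fst k) (snd k)))\<^sup>2)
      - 2 * (\<Sum>k\<in>B \<times> B. inner (E (fst k) (snd k) * x) (x * E (fst k) (snd k)))"
    by (simp add: sum.distrib sum_subtractf sum_distrib_left)
  also have "\<dots> = 2 * (real (card B) * (norm x)\<^sup>2 - (\<Sum>r\<in>Rs. \<Sum>r'\<in>Rs. (cmod (\<Sum>b\<in>B. ent x (\<kappa> r b) (\<kappa> r' b)))\<^sup>2))"
    unfolding E_left E_right inn ux by simp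
  finally show ?thesis
    unfolding norm_slices[OF x] by (simp add: sum_subtractf sum_distrib_left)
qed

lemma ent_am_conj:
  assumes "r \<in> Rs" "r' \<in> Rs" "b \<in> B" "c \<in> B"
  shows "ent (am m * x * adj (am m)) (\<kappa> r b) (\<kappa> r' c)
    = (\<Sum>i\<in>B. \<Sum>j\<in>B. m b i * ent x (\<kappa> r i) (\<kappa> r' j) * cnj (m c j))"
proof -
  have "ent (am m * x * adj (am m)) (\<kappa> r b) (\<kappa> r' c) = (\<Sum>j\<in>B. \<Sum>i\<in>B. m b i * ent x (\<kappa> r i) (\<kappa> r' j) * cnj (m c j))"
    unfolding am_adj ent_mult_am[OF assms(2,4)] ent_am_mult[OF assms(1,3)] by (simp add: sum_distrib_right)
  then show ?thesis by (subst sum.swap)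
qed

lemma norm_conj_diff:
  assumes u: "u * adj u = unit K" and x: "supp x \<subseteq> K"
  shows "norm (u * x * adj u - x) \<le> norm (u * x - x * u)"
proof -
  have "contr (adj u)" by (rule contr_of_isometry) (simp add: u contr_unit)
  moreover have "u * x * adj u - x = (u * x - x * u) * adj u"
    using u x by (simp add: left_diff_distrib mult.assoc mult_unit)
  ultimately show ?thesis using contr_right by metis
qed

end

section \<open>Chirp and Fourier operators on one tensor factor\<close>

locale camp = cyc h + amp "cyc.R h" Rs \<kappa> pr rs
  for h :: nat and Rs :: "'r set" and \<kappa> :: "'r \<Rightarrow> int \<Rightarrow> 'i" and pr rs
begin

definition chirp_op :: "'i fmat" where "chirp_op = am (\<lambda>x y. if x = y then chirp x else 0)"
definition fourier_op :: "'i fmat" where "fourier_op = am (\<lambda>k i. w (k * i) / of_real (sqrt (of_int n)))"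

lemma supp_chirp_op: "supp chirp_op \<subseteq> K" by (simp add: chirp_op_def supp_am)

lemma supp_fourier_op: "supp fourier_op \<subseteq> K" by (simp add: fourier_op_def supp_am)

lemma real_card_R: "real (card R) = of_int n" by (metis card_R of_int_of_nat_eq)

lemma chirp_cnj [simp]: "chirp i * cnj (chirp i) = 1" by (simp add: chirp_def)

lemma chirp_op_unitary: "chirp_op * adj chirp_op = unit K"
proof -
  have "chirp_op * adj chirp_op = am (\<lambda>x y. \<Sum>d\<in>R. if d = x then (if x = y then 1 else 0) else 0)"
    unfolding chirp_op_def am_adj am_mult by (intro am_cong sum.cong refl) auto
  also have "\<dots> = am (\<lambda>x y. if x = y then 1 else 0)" by (rule am_cong) (simp add: sum.delta)
  finally show ?thesis by (simp add: am_id)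
qed

lemma sqrt_n: "complex_of_real (sqrt (of_int n)) * complex_of_real (sqrt (of_int n)) = of_int n"
  using n_pos by (simp flip: of_real_mult)

lemma fourier_op_unitary: "fourier_op * adj fourier_op = unit K" "adj fourier_op * fourier_op = unit K"
proof -
  have n0: "complex_of_int n \<noteq> 0" using n_pos by simp
  have "fourier_op * adj fourier_op = am (\<lambda>k l. \<Sum>d\<in>R. w ((k - l) * d) / of_int n)"
    unfolding fourier_op_def am_adj am_mult
  proof (intro am_cong sum.cong refl)
    fix k l d
    have "w ((k - l) * d) = w (k * d) * cnj (w (l * d))" by (simp add: left_diff_distrib w_diff)
    then show "w (k * d) / of_real (sqrt (of_int n)) * cnj (w (l * d) / of_real (sqrt (of_int n))) = w ((k - l) * d) / of_int n"
      by (simp add: sqrt_n)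
  qed
  also have "\<dots> = am (\<lambda>k l. if k = l then 1 else 0)"
    using n0 by (intro am_cong) (simp add: sum_divide_distrib[symmetric] sum_w dvd_diff_R)
  finally show "fourier_op * adj fourier_op = unit K" by (simp add: am_id)
  have "adj fourier_op * fourier_op = am (\<lambda>k l. \<Sum>d\<in>R. w ((l - k) * d) / of_int n)"
    unfolding fourier_op_def am_adj am_mult
  proof (intro am_cong sum.cong refl)
    fix k l d
    have "w ((l - k) * d) = w (d * l) * cnj (w (d * k))" 
      unfolding mult.commute[of "l - k" d] right_diff_distrib w_diff ..
    then show "cnj (w (d * k) / of_real (sqrt (of_int n))) * (w (d * l) / of_real (sqrt (of_int n))) = w ((l - k) * d) / of_int n"
      by (simp add: sqrt_n)
  qed
  also have "\<dots> = am (\<lambda>k l. if k = l then 1 else 0)"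
    using n0 by (intro am_cong) (auto simp: sum_divide_distrib[symmetric] sum_w dvd_diff_R)
  finally show "adj fourier_op * fourier_op = unit K" by (simp add: am_id)
qed

text \<open>Each slice satisfies the scalar gap with the same constant, so tensoring with another
  space costs nothing. The factor 2 in \<open>commutator_slices\<close> turns 4500 into
  9000.\<close>

lemma am_gap:
  assumes x: "supp x \<subseteq> K"
  shows "(\<Sum>k\<in>R \<times> R. (norm (E (fst k) (snd k) * x - x * E (fst k) (snd k)))\<^sup>2)
    \<le> real (card R) * 9000 * ((norm (chirp_op * x - x * chirp_op))\<^sup>2 + (norm (fourier_op * x - x * fourier_op))\<^sup>2)"
proof -
  define X where "X r r' b c = ent x (\<kappa> r b) (\<kappa> r' c)" for r r' b c
  have sx: "supp (u * x * adj u - x) \<subseteq> K" if "supp u \<subseteq> K" for u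
    using that x by (intro supp_diff_subset supp_mult_subset) auto
  have c: "(norm (chirp_op * x * adj chirp_op - x))\<^sup>2
    = (\<Sum>r\<in>Rs. \<Sum>r'\<in>Rs. \<Sum>b\<in>R. \<Sum>c\<in>R. (cmod (chirp b * X r r' b c * cnj (chirp c) - X r r' b c))\<^sup>2)"
    unfolding norm_slices[OF sx[OF supp_chirp_op]]
  proof (intro sum.cong refl)
    fix r r' b c assume a: "r \<in> Rs" "r' \<in> Rs" "b \<in> R" "c \<in> R"
    have "ent (chirp_op * x * adj chirp_op) (\<kappa> r b) (\<kappa> r' c)
      = (\<Sum>i\<in>R. \<Sum>j\<in>R. if j = c then (if i = b then chirp b * X r r' b c * cnj (chirp c) else 0) else 0)"
      unfolding chirp_op_def ent_am_conj[OF a] by (intro sum.cong refl) (auto simp: X_def)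
    also have "\<dots> = chirp b * X r r' b c * cnj (chirp c)" using a by (simp add: sum.delta)
    finally show "(cmod (ent (chirp_op * x * adj chirp_op - x) (\<kappa> r b) (\<kappa> r' c)))\<^sup>2
       = (cmod (chirp b * X r r' b c * cnj (chirp c) - X r r' b c))\<^sup>2" by (simp add: X_def)
  qed
  have f: "(norm (fourier_op * x * adj fourier_op - x))\<^sup>2
    = (\<Sum>r\<in>Rs. \<Sum>r'\<in>Rs. \<Sum>b\<in>R. \<Sum>c\<in>R. (cmod (fconj (X r r') b c - X r r' b c))\<^sup>2)"
    unfolding norm_slices[OF sx[OF supp_fourier_op]]
  proof (intro sum.cong refl)
    fix r r' b c assume a: "r \<in> Rs" "r' \<in> Rs" "b \<in> R" "c \<in> R"
    have "ent (fourier_op * x * adj fourier_op) (\<kappa> r b) (\<kappa> r' c)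
      = (\<Sum>i\<in>R. \<Sum>j\<in>R. w (b * i) * X r r' i j * w (- (c * j)) / of_int n)"
      unfolding fourier_op_def ent_am_conj[OF a]
      by (intro sum.cong refl) (simp add: X_def w_uminus sqrt_n)
    also have "\<dots> = fconj (X r r') b c" by (simp add: fconj_def sum_divide_distrib)
    finally show "(cmod (ent (fourier_op * x * adj fourier_op - x) (\<kappa> r b) (\<kappa> r' c)))\<^sup>2
       = (cmod (fconj (X r r') b c - X r r' b c))\<^sup>2" by (simp add: X_def)
  qed
  have "(\<Sum>k\<in>R \<times> R. (norm (E (fst k) (snd k) * x - x * E (fst k) (snd k)))\<^sup>2)
    = 2 * (\<Sum>r\<in>Rs. \<Sum>r'\<in>Rs. of_int n * (\<Sum>b\<in>R. \<Sum>c\<in>R. (cmod (X r r' b c))\<^sup>2) - (cmod (\<Sum>b\<in>R. X r r' b b))\<^sup>2)"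
    unfolding commutator_slices[OF x] real_card_R X_def ..
  also have "\<dots> \<le> 2 * (\<Sum>r\<in>Rs. \<Sum>r'\<in>Rs. 4500 * of_int n *
      ((\<Sum>b\<in>R. \<Sum>c\<in>R. (cmod (chirp b * X r r' b c * cnj (chirp c) - X r r' b c))\<^sup>2)
       + (\<Sum>b\<in>R. \<Sum>c\<in>R. (cmod (fconj (X r r') b c - X r r' b c))\<^sup>2)))"
    by (intro mult_left_mono sum_mono numeric_gap) simp
  also have "\<dots> = of_int n * 9000 * ((norm (chirp_op * x * adj chirp_op - x))\<^sup>2 + (norm (fourier_op * x * adj fourier_op - x))\<^sup>2)"
    unfolding c f by (simp add: sum_distrib_left[symmetric] sum.distrib)
  also have "\<dots> \<le> of_int n * 9000 * ((norm (chirp_op * x - x * chirp_op))\<^sup>2 + (norm (fourier_op * x - x * fourier_op))\<^sup>2)"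
    using n_pos by (intro mult_left_mono add_mono power_mono norm_conj_diff chirp_op_unitary fourier_op_unitary x) auto
  finally show ?thesis by (simp only: real_card_R)
qed

text \<open>A square root of \<open>chirp\<close>, obtained by halving the angle. It need not be
  periodic modulo n and is used on the representatives in R.\<close>

definition del :: "int \<Rightarrow> complex" where "del b = cis (pi * of_int (- b * b + beta * b) / of_int n)"

lemma del_sq: "del b * del b = chirp b"
  by (simp add: del_def chirp_def w_def cis_mult add_divide_distrib[symmetric]) (simp only: mult.assoc)

lemma norm_del [simp]: "cmod (del b) = 1" by (simp add: del_def)

lemma del_cnj [simp]: "del b * cnj (del b) = 1" "cnj (del b) * del b = 1"
  by (simp_all add: del_def cis_cnj cis_mult)

text \<open>The square of tw del t does not depend on t, so it still generates, together with the Fourier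
  matrix, the first tensor factor; compressing tw del t by matrix units recovers t.\<close>
definition tw :: "(int \<Rightarrow> complex) \<Rightarrow> (int \<Rightarrow> 'i fmat) \<Rightarrow> 'i fmat" where
  "tw c t = (\<Sum>b\<in>R. scaleC (c b) (E b b * t b))"

text \<open>Commutation with every \<open>am m\<close> makes t b act on the other tensor factors. In
  the model t b is a Pauli matrix of the b-th qubit.\<close>

definition twist :: "(int \<Rightarrow> 'i fmat) \<Rightarrow> bool" where
  "twist t \<longleftrightarrow> (\<forall>b\<in>R. (\<forall>m. t b * am m = am m * t b) \<and> t b * t b = unit K \<and> adj (t b) = t b \<and> supp (t b) \<subseteq> K)"

lemma twistD:
  assumes "twist t" "b \<in> R"
  shows "t b * E i j = E i j * t b" "t b * t b = unit K" "adj (t b) = t b" "supp (t b) \<subseteq> K"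
  using assms by (auto simp: twist_def E_def)

lemma supp_tw: "twist t \<Longrightarrow> supp (tw c t) \<subseteq> K"
  unfolding tw_def by (intro supp_sum_subset supp_scaleC_subset supp_mult_subset supp_E twistD(4))

lemma adj_tw: "twist t \<Longrightarrow> adj (tw c t) = tw (\<lambda>b. cnj (c b)) t"
  unfolding tw_def adj_sum by (intro sum.cong refl) (simp add: adj_scaleC adj_mult adj_E twistD)

text \<open>Distinct diagonal blocks are orthogonal, and within a block the two copies of t b
  cancel.\<close>

lemma tw_mult:
  assumes t: "twist t"
  shows "tw c t * tw c' t = am (\<lambda>x y. if x = y then c x * c' x else 0)"
proof -
  have "E b b * t b * (E d d * t d) = (if d = b then E b b else 0)" if bd: "b \<in> R" "d \<in> R" for b d
  proof -
    have "E b b * t b * (E d d * t d) = E b b * (t b * E d d) * t d" by (simp add: mult.assoc)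
    also have "\<dots> = (E b b * E d d) * (t b * t d)" by (simp add: twistD[OF t] bd mult.assoc)
    also have "\<dots> = (if d = b then E b b else 0)"
      using bd by (simp add: E_mult twistD[OF t] mult_unit supp_E)
    finally show ?thesis .
  qed
  then have "tw c t * tw c' t = (\<Sum>b\<in>R. \<Sum>d\<in>R. if d = b then scaleC (c b * c' b) (E b b) else 0)"
    unfolding tw_def sum_product by (intro sum.cong refl) (auto simp: mult.commute intro!: fmat_eqI)
  also have "\<dots> = (\<Sum>b\<in>R. scaleC (c b * c' b) (E b b))" by (simp add: sum.delta)
  finally show ?thesis by (simp add: diag_sum)
qed

lemma tw_unitary:
  assumes t: "twist t"
  shows "tw del t * adj (tw del t) = unit K" "adj (tw del t) * tw del t = unit K"
proof -
  have "am (\<lambda>x y. if x = y then del x * cnj (del x) else 0) = unit K"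
    "am (\<lambda>x y. if x = y then cnj (del x) * del x else 0) = unit K"
    unfolding am_id[symmetric] by (rule am_cong, simp)+
  then show "tw del t * adj (tw del t) = unit K" "adj (tw del t) * tw del t = unit K"
    by (simp_all only: adj_tw[OF t] tw_mult[OF t])
qed

lemma tw_sq: "twist t \<Longrightarrow> tw del t * tw del t = chirp_op"
  by (simp only: tw_mult chirp_op_def, rule am_cong) (simp add: del_sq)

text \<open>The gap concerns the square of the twisted operator, which is the untwisted chirp. J is
  left free so that the result can be used inside a larger space.\<close>

lemma twist_half:
  assumes t: "twist t" and J: "finite J" "K \<subseteq> J"
  shows "half J (unit K) R (\<lambda>k. E (fst k) (snd k)) (tw del t) fourier_op 9000"
proof
  have sK: "supp (unit K) \<subseteq> K" by (simp add: supp_unit)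
  show "unit K * unit K = unit K" "adj (unit K) = unit K"
    by (simp_all add: unit_mult supp_unit adj_unit)
  show "supp (unit K) \<subseteq> J" using sK J(2) by (rule order_trans)
  show "unit K * E (fst k) (snd k) = E (fst k) (snd k)" "E (fst k) (snd k) * unit K = E (fst k) (snd k)" for k
    by (simp_all add: unit_mult mult_unit supp_E)
  show "(\<Sum>k\<in>R \<times> R. (norm (E (fst k) (snd k) * z))\<^sup>2) = real (card R) * (norm (unit K * z))\<^sup>2" for z
    by (rule E_left)
  show "(\<Sum>k\<in>R \<times> R. (norm (z * E (fst k) (snd k)))\<^sup>2) = real (card R) * (norm (z * unit K))\<^sup>2" for z
    by (rule E_right)
  show "column_contr R (\<lambda>b. E (fst (i, b)) (snd (i, b)))" if "i \<in> R" for i using E_column_contr[OF that] by simp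
  show "unit K * tw del t = tw del t" "tw del t * unit K = tw del t"
    by (simp_all add: unit_mult mult_unit supp_tw[OF t])
  show "contr (tw del t)" by (rule contr_of_isometry) (simp add: tw_unitary[OF t] contr_unit)
  show "unit K * fourier_op = fourier_op" "fourier_op * unit K = fourier_op"
    by (simp_all add: unit_mult mult_unit fourier_op_def supp_am)
  show "contr fourier_op" by (rule contr_of_isometry) (simp add: fourier_op_unitary contr_unit)
  fix x assume x: "unit K * x = x" "x * unit K = x"
  have "supp (unit K * x * unit K) \<subseteq> K"
  proof (rule supp_subsetI)
    fix i j assume ij: "i \<notin> K \<or> j \<notin> K"
    show "ent (unit K * x * unit K) i j = 0"
      using ij by (auto simp: ent_times_supp ent_unit intro!: sum.neutral)
  qed
  then have "supp x \<subseteq> K" using x by simp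
  from am_gap[OF this]
  show "(\<Sum>k\<in>R \<times> R. (norm (E (fst k) (snd k) * x - x * E (fst k) (snd k)))\<^sup>2)
       \<le> real (card R) * 9000 * ((norm (tw del t * tw del t * x - x * (tw del t * tw del t)))\<^sup>2
          + (norm (fourier_op * x - x * fourier_op))\<^sup>2)"
    by (simp add: tw_sq[OF t])
qed (use J in auto)

lemma E_tw:
  assumes i: "i \<in> R"
  shows "E b i * tw c t = scaleC (c i) (E b i * t i)"
proof -
  have "E b i * tw c t = (\<Sum>j\<in>R. if j = i then scaleC (c i) (E b i * t i) else 0)"
    unfolding tw_def sum_distrib_left
    using i by (intro sum.cong refl) (auto simp: mult.assoc[symmetric] E_mult intro!: fmat_eqI)
  then show ?thesis using i by (simp add: sum.delta)
qed

text \<open>Multiplying by e_bi keeps only the i-th block and moves it to position b; summing over b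
  spreads t i over the whole first factor.\<close>

lemma tw_xs:
  assumes t: "twist t" and i: "i \<in> R"
  shows "half.xs R (\<lambda>k. E (fst k) (snd k)) (tw del t) i = scaleC (del i) (t i)"
proof -
  have e: "E b i * tw del t * E i b = scaleC (del i) (E b b * t i)" if b: "b \<in> R" for b
  proof -
    have "E b i * tw del t = scaleC (del i) (E b i * t i)" by (rule E_tw[OF i])
    then have "E b i * tw del t * E i b = scaleC (del i) (E b i * (t i * E i b))" by (simp add: mult.assoc)
    also have "\<dots> = scaleC (del i) (E b i * E i b * t i)" by (simp add: twistD[OF t i] mult.assoc)
    finally show ?thesis using i by (simp add: E_mult)
  qed
  have "compr R (\<lambda>b. E i b) (tw del t) = (\<Sum>b\<in>R. scaleC (del i) (E b b * t i))"
    unfolding compr_def by (intro sum.cong refl) (simp add: adj_E e)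
  also have "\<dots> = scaleC (del i) ((\<Sum>b\<in>R. E b b) * t i)" by (simp add: scaleC_sum sum_distrib_right)
  also have "\<dots> = scaleC (del i) (t i)" by (simp add: E_sum unit_mult twistD[OF t i])
  finally show ?thesis
    by (subst half.xs_def[OF twist_half[OF t finK order.refl]]) simp
qed

end

section \<open>The almost commuting generators\<close>

type_synonym idx = "(int \<times> int \<times> int set) + nat"

lemma sum_pick:
  fixes f :: "'a \<Rightarrow> complex"
  assumes "finite A" "c \<in> A"
  shows "(\<Sum>d\<in>A. f d * (if d = c \<and> P then z else 0)) = (if P then f c * z else 0)"
proof -
  have "(\<Sum>d\<in>A. f d * (if d = c \<and> P then z else 0)) = (\<Sum>d\<in>A. if d = c then (if P then f c * z else 0) else 0)"
    by (intro sum.cong refl) auto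
  then show ?thesis using assms by simp
qed

lemma norm_unit_sq: "finite L \<Longrightarrow> (norm (unit L))\<^sup>2 = card L"
proof -
  assume L: "finite L"
  have "(norm (unit L))\<^sup>2 = (\<Sum>i\<in>L. \<Sum>j\<in>L. if j = i then 1 else 0)"
    unfolding norm_fmat_sq[OF L supp_unit[OF L]] by (intro sum.cong refl) (auto simp: ent_unit[OF L])
  also have "\<dots> = card L" using L by simp
  finally show ?thesis .
qed

text \<open>A subset of R encodes a basis vector of the qubits.\<close>
definition toggle :: "int \<Rightarrow> int set \<Rightarrow> int set" where
  "toggle b S = (if b \<in> S then S - {b} else insert b S)"
definition pauliX :: "int \<Rightarrow> int set \<Rightarrow> int set \<Rightarrow> complex" where
  "pauliX b S T = (if T = toggle b S then 1 else 0)"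
definition pauliZ :: "int \<Rightarrow> int set \<Rightarrow> int set \<Rightarrow> complex" where
  "pauliZ b S T = (if T = S then (if b \<in> S then - 1 else 1) else 0)"

lemma toggle_toggle [simp]: "toggle b (toggle b S) = S" by (auto simp: toggle_def)

lemma toggle_eq: "T = toggle b S \<longleftrightarrow> S = toggle b T" by (metis toggle_toggle)

lemma in_toggle: "c \<in> toggle b S \<longleftrightarrow> (if b = c then c \<notin> S else c \<in> S)" by (auto simp: toggle_def)

text \<open>Basis vectors are the triples Inl (b, g, S); the right summand of the index type leaves room for
  the larger space of the representations.\<close>
locale model = cyc h for h
begin

text \<open>The same index set is read as a tensor product in three ways, singling out the first
  coordinate, the second one and the qubits.\<close>

definition \<kappa>1 :: "int \<times> int set \<Rightarrow> int \<Rightarrow> idx" where "\<kappa>1 r b = Inl (b, r)"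
definition pr1 :: "idx \<Rightarrow> int" where "pr1 x = fst (projl x)"
definition rs1 :: "idx \<Rightarrow> int \<times> int set" where "rs1 x = snd (projl x)"
definition \<kappa>2 :: "int \<times> int set \<Rightarrow> int \<Rightarrow> idx" where "\<kappa>2 r g = Inl (fst r, g, snd r)"
definition pr2 :: "idx \<Rightarrow> int" where "pr2 x = fst (snd (projl x))"
definition rs2 :: "idx \<Rightarrow> int \<times> int set" where "rs2 x = (fst (projl x), snd (snd (projl x)))"
definition \<kappa>3 :: "int \<times> int \<Rightarrow> int set \<Rightarrow> idx" where "\<kappa>3 r S = Inl (fst r, snd r, S)"
definition pr3 :: "idx \<Rightarrow> int set" where "pr3 x = snd (snd (projl x))"
definition rs3 :: "idx \<Rightarrow> int \<times> int" where "rs3 x = (fst (projl x), fst (snd (projl x)))"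

sublocale A1: camp h "R \<times> Pow R" \<kappa>1 pr1 rs1
  by unfold_locales (auto simp: \<kappa>1_def pr1_def rs1_def)

sublocale A2: camp h "R \<times> Pow R" \<kappa>2 pr2 rs2
  by unfold_locales (auto simp: \<kappa>2_def pr2_def rs2_def)

sublocale A3: amp "Pow R" "R \<times> R" \<kappa>3 pr3 rs3
  by unfold_locales (auto simp: \<kappa>3_def pr3_def rs3_def)

definition I0 :: "idx set" where "I0 = Inl ` (R \<times> R \<times> Pow R)"

lemma K_eq [simp]: "A1.K = I0" "A2.K = I0" "A3.K = I0"
proof -
  have I0: "\<exists>b g S. b \<in> R \<and> g \<in> R \<and> S \<in> Pow R \<and> x = Inl (b, g, S)" if "x \<in> I0" for x
    using that unfolding I0_def by blast
  have in_I0: "Inl (b, g, S) \<in> I0" if "b \<in> R" "g \<in> R" "S \<in> Pow R" for b g S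
    using that unfolding I0_def by blast
  show "A1.K = I0"
  proof (rule equalityI)
    show "A1.K \<subseteq> I0" unfolding A1.K_def \<kappa>1_def using in_I0 by auto
    show "I0 \<subseteq> A1.K"
    proof
      fix x assume "x \<in> I0"
      then obtain b g S where x: "b \<in> R" "g \<in> R" "S \<in> Pow R" "x = Inl (b, g, S)" using I0 by blast
      then show "x \<in> A1.K" using A1.kappa_in[of "(g, S)" b] by (simp add: \<kappa>1_def)
    qed
  qed
  show "A2.K = I0"
  proof (rule equalityI)
    show "A2.K \<subseteq> I0" unfolding A2.K_def \<kappa>2_def using in_I0 by auto
    show "I0 \<subseteq> A2.K"
    proof
      fix x assume "x \<in> I0"
      then obtain b g S where x: "b \<in> R" "g \<in> R" "S \<in> Pow R" "x = Inl (b, g, S)" using I0 by blast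
      then show "x \<in> A2.K" using A2.kappa_in[of "(b, S)" g] by (simp add: \<kappa>2_def)
    qed
  qed
  show "A3.K = I0"
  proof (rule equalityI)
    show "A3.K \<subseteq> I0" unfolding A3.K_def \<kappa>3_def using in_I0 by auto
    show "I0 \<subseteq> A3.K"
    proof
      fix x assume "x \<in> I0"
      then obtain b g S where x: "b \<in> R" "g \<in> R" "S \<in> Pow R" "x = Inl (b, g, S)" using I0 by blast
      then show "x \<in> A3.K" using A3.kappa_in[of "(b, g)" S] by (simp add: \<kappa>3_def)
    qed
  qed
qed

lemma finite_I0 [simp]: "finite I0" by (simp add: I0_def)

lemma card_I0: "card I0 = card R * card R * 2 ^ card R"
  unfolding I0_def by (subst card_image) (simp_all add: card_cartesian_product card_Pow inj_on_def)

lemma ent2: "\<lbrakk>b \<in> R; c \<in> R; g \<in> R; g' \<in> R; S \<in> Pow R; S' \<in> Pow R\<rbrakk> \<Longrightarrow>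
    ent (A2.am m) (Inl (b, g, S)) (Inl (c, g', S')) = (if b = c \<and> S = S' then m g g' else 0)"
  using A2.ent_am[of "(b, S)" "(c, S')" g g' m] by (simp add: \<kappa>2_def)

lemma ent3: "\<lbrakk>b \<in> R; c \<in> R; g \<in> R; g' \<in> R; S \<in> Pow R; S' \<in> Pow R\<rbrakk> \<Longrightarrow>
    ent (A3.am m) (Inl (b, g, S)) (Inl (c, g', S')) = (if b = c \<and> g = g' then m S S' else 0)"
  using A3.ent_am[of "(b, g)" "(c, g')" S S' m] by (simp add: \<kappa>3_def)

lemma mult1: "\<lbrakk>b \<in> R; g \<in> R; S \<in> Pow R\<rbrakk> \<Longrightarrow>
    ent (A1.am m * x) (Inl (b, g, S)) y = (\<Sum>c\<in>R. m b c * ent x (Inl (c, g, S)) y)"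
  using A1.ent_am_mult[of "(g, S)" b m x y] by (simp add: \<kappa>1_def)

lemma supp_am_I0: "supp (A1.am m) \<subseteq> I0" "supp (A2.am m) \<subseteq> I0" "supp (A3.am m') \<subseteq> I0"
  using A1.supp_am A2.supp_am A3.supp_am by simp_all

lemma commute12: "A1.am m * A2.am m' = A2.am m' * A1.am m"
proof (rule A1.am_commute[of _ "\<lambda>r r'. if snd r = snd r' then m' (fst r) (fst r') else 0"])
  show "ent (A2.am m') (\<kappa>1 r b) (\<kappa>1 r' c) = (if b = c then if snd r = snd r' then m' (fst r) (fst r') else 0 else 0)"
    if "r \<in> R \<times> Pow R" "r' \<in> R \<times> Pow R" "b \<in> R" "c \<in> R" for r r' b c
    using ent2[of b c "fst r" "fst r'" "snd r" "snd r'" m'] that by (simp add: \<kappa>1_def mem_Times_iff)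
qed (simp add: supp_am_I0)

lemma commute13: "A3.am m' * A1.am m = A1.am m * A3.am m'"
proof (rule A1.am_commute[of _ "\<lambda>r r'. if fst r = fst r' then m' (snd r) (snd r') else 0", symmetric])
  show "ent (A3.am m') (\<kappa>1 r b) (\<kappa>1 r' c) = (if b = c then if fst r = fst r' then m' (snd r) (snd r') else 0 else 0)"
    if "r \<in> R \<times> Pow R" "r' \<in> R \<times> Pow R" "b \<in> R" "c \<in> R" for r r' b c
    using ent3[of b c "fst r" "fst r'" "snd r" "snd r'" m'] that by (simp add: \<kappa>1_def mem_Times_iff)
qed (simp add: supp_am_I0)

lemma commute23: "A3.am m' * A2.am m = A2.am m * A3.am m'"
proof (rule A2.am_commute[of _ "\<lambda>r r'. if fst r = fst r' then m' (snd r) (snd r') else 0", symmetric])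
  show "ent (A3.am m') (\<kappa>2 r g) (\<kappa>2 r' g') = (if g = g' then if fst r = fst r' then m' (snd r) (snd r') else 0 else 0)"
    if "r \<in> R \<times> Pow R" "r' \<in> R \<times> Pow R" "g \<in> R" "g' \<in> R" for r r' g g'
    using ent3[of "fst r" "fst r'" g g' "snd r" "snd r'" m'] that by (simp add: \<kappa>2_def mem_Times_iff)
qed (simp add: supp_am_I0)

section \<open>Pauli operators on the qubits\<close>

definition X :: "int \<Rightarrow> idx fmat" where "X b = A3.am (pauliX b)"
definition Z :: "int \<Rightarrow> idx fmat" where "Z b = A3.am (pauliZ b)"

lemma toggle_Pow: "b \<in> R \<Longrightarrow> S \<in> Pow R \<Longrightarrow> toggle b S \<in> Pow R" by (auto simp: toggle_def)

lemma X_sq: assumes b: "b \<in> R" shows "X b * X b = unit I0"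
proof -
  have "A3.am (pauliX b) * A3.am (pauliX b) = A3.am (\<lambda>S T. if S = T then 1 else 0)"
    unfolding A3.am_mult
  proof (rule A3.am_cong)
    fix S T assume "S \<in> Pow R" "T \<in> Pow R"
    have "(\<Sum>d\<in>Pow R. pauliX b S d * pauliX b d T) = (\<Sum>d\<in>Pow R. if d = toggle b S then (if S = T then 1 else 0) else 0)"
      by (intro sum.cong refl) (auto simp: pauliX_def)
    then show "(\<Sum>d\<in>Pow R. pauliX b S d * pauliX b d T) = (if S = T then 1 else 0)"
      using toggle_Pow[OF b \<open>S \<in> Pow R\<close>] by (simp add: sum.delta)
  qed
  then show ?thesis by (simp add: X_def A3.am_id)
qed

lemma Z_sq: "Z b * Z b = unit I0"
proof -
  have "A3.am (pauliZ b) * A3.am (pauliZ b) = A3.am (\<lambda>S T. if S = T then 1 else 0)"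
    unfolding A3.am_mult
  proof (rule A3.am_cong)
    fix S T assume "S \<in> Pow R" "T \<in> Pow R"
    have "(\<Sum>d\<in>Pow R. pauliZ b S d * pauliZ b d T) = (\<Sum>d\<in>Pow R. if d = S then (if S = T then 1 else 0) else 0)"
      by (intro sum.cong refl) (auto simp: pauliZ_def)
    then show "(\<Sum>d\<in>Pow R. pauliZ b S d * pauliZ b d T) = (if S = T then 1 else 0)"
      using \<open>S \<in> Pow R\<close> by (simp add: sum.delta)
  qed
  then show ?thesis by (simp add: Z_def A3.am_id)
qed

lemma adj_X: "adj (X b) = X b"
  unfolding X_def A3.am_adj by (rule A3.am_cong) (auto simp: pauliX_def toggle_eq[of _ b])

lemma adj_Z: "adj (Z b) = Z b"
  unfolding Z_def A3.am_adj by (rule A3.am_cong) (auto simp: pauliZ_def)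

text \<open>Toggling b changes the membership of g exactly when b = g, and this produces the
  sign.\<close>

lemma ZX: assumes "b \<in> R" shows "Z g * X b = scaleC (if b = g then - 1 else 1) (X b * Z g)"
  unfolding X_def Z_def A3.am_mult A3.am_scaleC
proof (rule A3.am_cong)
  fix S T assume S: "S \<in> Pow R" "T \<in> Pow R"
  have "(\<Sum>d\<in>Pow R. pauliX b S d * pauliZ g d T)
     = (\<Sum>d\<in>Pow R. if d = toggle b S then (if T = toggle b S then if g \<in> T then - 1 else 1 else 0) else 0)"
    by (intro sum.cong refl) (auto simp: pauliX_def pauliZ_def)
  then have 1: "(\<Sum>d\<in>Pow R. pauliX b S d * pauliZ g d T) = (if T = toggle b S then if g \<in> T then - 1 else 1 else 0)"
    using toggle_Pow[OF assms S(1)] by (simp add: sum.delta)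
  have "(\<Sum>d\<in>Pow R. pauliZ g S d * pauliX b d T)
     = (\<Sum>d\<in>Pow R. if d = S then (if T = toggle b S then if g \<in> S then - 1 else 1 else 0) else 0)"
    by (intro sum.cong refl) (auto simp: pauliX_def pauliZ_def)
  then have 2: "(\<Sum>d\<in>Pow R. pauliZ g S d * pauliX b d T) = (if T = toggle b S then if g \<in> S then - 1 else 1 else 0)"
    using S(1) by (simp add: sum.delta)
  show "(\<Sum>d\<in>Pow R. pauliZ g S d * pauliX b d T)
     = (if b = g then - 1 else 1) * (\<Sum>d\<in>Pow R. pauliX b S d * pauliZ g d T)"
    unfolding 1 2 by (cases "T = toggle b S"; cases "b = g") (auto simp: in_toggle)
qed

lemma twist_X: "A1.twist X"
  unfolding A1.twist_def using X_sq adj_X commute13 supp_am_I0 by (simp add: X_def)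

lemma twist_Z: "A2.twist Z"
  unfolding A2.twist_def using Z_sq adj_Z commute23 supp_am_I0 by (simp add: Z_def)

section \<open>The four generators and their commutator\<close>

definition aP :: "idx fmat" where "aP = A1.tw A1.del X"
definition bP :: "idx fmat" where "bP = A1.fourier_op"
definition aQ :: "idx fmat" where "aQ = A2.tw A1.del Z"
definition bQ :: "idx fmat" where "bQ = A2.fourier_op"

lemma unitaries: "unitary I0 aP" "unitary I0 bP" "unitary I0 aQ" "unitary I0 bQ"
  using A1.tw_unitary[OF twist_X] A2.tw_unitary[OF twist_Z] A1.fourier_op_unitary A2.fourier_op_unitary
    A1.supp_tw[OF twist_X] A2.supp_tw[OF twist_Z] A1.supp_fourier_op A2.supp_fourier_op
  by (simp_all add: unitary_def aP_def bP_def aQ_def bQ_def)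

lemma fourier_commute: "bP * bQ = bQ * bP"
  unfolding bP_def bQ_def A1.fourier_op_def A2.fourier_op_def by (rule commute12)

lemma aP_commute: "aP * A2.am m = A2.am m * aP"
proof -
  have "A1.E b b * X b * A2.am m = A2.am m * (A1.E b b * X b)" for b
    unfolding A1.E_def X_def mult.assoc commute23 by (simp only: commute12 mult.assoc[symmetric])
  then show ?thesis unfolding aP_def A1.tw_def sum_distrib_left sum_distrib_right by simp
qed

lemma aQ_commute: "aQ * A1.am m = A1.am m * aQ"
proof -
  have "A2.E b b * Z b * A1.am m = A1.am m * (A2.E b b * Z b)" for b
    unfolding A2.E_def Z_def mult.assoc commute13 by (simp only: commute12[symmetric] mult.assoc[symmetric])
  then show ?thesis unfolding aQ_def A2.tw_def sum_distrib_left sum_distrib_right by simp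
qed

lemma mixed_commute: "aP * bQ = bQ * aP" "bP * aQ = aQ * bP"
  unfolding bP_def bQ_def A1.fourier_op_def A2.fourier_op_def by (simp_all only: aP_commute aQ_commute)

text \<open>The projection onto the blocks b = g, where the two twisted generators anticommute. Its
  share of the dimension is 1 / n.\<close>

definition W :: "idx fmat" where "W = (\<Sum>c\<in>R. A1.E c c * A2.E c c)"

lemma ent_W:
  assumes "r \<in> R \<times> Pow R" "r' \<in> R \<times> Pow R" "b \<in> R" "c \<in> R"
  shows "ent W (\<kappa>1 r b) (\<kappa>1 r' c) = (if c = fst r then if b = fst r then if r' = r then 1 else 0 else 0 else 0)"
proof -
  obtain g S g' S' where r: "r = (g, S)" "r' = (g', S')" by force
  have a: "g \<in> R" "g' \<in> R" "S \<in> Pow R" "S' \<in> Pow R" using assms r by auto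
  have "ent W (\<kappa>1 r b) (\<kappa>1 r' c) = (\<Sum>d\<in>R. if d = b then
      (if c = g then if b = g then if r' = r then 1 else 0 else 0 else 0) else 0)"
    unfolding W_def ent_sum
  proof (intro sum.cong refl)
    fix d assume d: "d \<in> R"
    have "ent (A1.E d d * A2.E d d) (\<kappa>1 r b) (\<kappa>1 r' c)
      = (\<Sum>x\<in>R. (if b = d then 1 else 0) * (if x = d \<and> (d = c \<and> S = S' \<and> g = d \<and> g' = d) then 1 else 0))"
      unfolding A1.E_def \<kappa>1_def r mult1[OF assms(3) a(1,3)] A2.E_def using a assms
      by (intro sum.cong refl) (auto simp: ent2)
    also have "\<dots> = (if d = c \<and> S = S' \<and> g = d \<and> g' = d then (if b = d then 1 else 0) * 1 else 0)"
      by (rule sum_pick[OF finite_R d])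
    finally show "ent (A1.E d d * A2.E d d) (\<kappa>1 r b) (\<kappa>1 r' c)
      = (if d = b then (if c = g then if b = g then if r' = r then 1 else 0 else 0 else 0) else 0)"
      by (auto simp: r)
  qed
  then show ?thesis using assms(3) by (simp add: sum.delta r)
qed

lemma norm_W: "(norm W)\<^sup>2 = real (card R * 2 ^ card R)"
proof -
  have "supp W \<subseteq> I0" unfolding W_def
    by (intro supp_sum_subset supp_mult_subset) (use A1.supp_E A2.supp_E in simp_all)
  then have "(norm W)\<^sup>2 = (\<Sum>r\<in>R \<times> Pow R. \<Sum>r'\<in>R \<times> Pow R. \<Sum>b\<in>R. \<Sum>c\<in>R. (cmod (ent W (\<kappa>1 r b) (\<kappa>1 r' c)))\<^sup>2)"
    by (intro A1.norm_slices) simp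
  also have "\<dots> = (\<Sum>r\<in>R \<times> Pow R. \<Sum>r'\<in>R \<times> Pow R. \<Sum>b\<in>R. \<Sum>c\<in>R.
      if c = fst r then if b = fst r then if r' = r then 1 else 0 else 0 else 0)"
    by (intro sum.cong refl) (auto simp: ent_W)
  also have "\<dots> = (\<Sum>r\<in>R \<times> Pow R. \<Sum>r'\<in>R \<times> Pow R. if r' = r then 1 else 0)"
    by (intro sum.cong refl) (auto simp: sum.delta)
  also have "\<dots> = (\<Sum>r\<in>R \<times> Pow R. 1)"
    by (intro sum.cong refl) (simp add: sum.delta)
  also have "\<dots> = real (card R * 2 ^ card R)" by (simp add: card_cartesian_product card_Pow)
  finally show ?thesis .
qed

text \<open>Blocks with b different from g commute and cancel. On the others exchanging the factors
  changes the sign, which leaves twice the product, cut down by W.\<close>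

lemma commutator_eq: "aP * aQ - aQ * aP = 2 *\<^sub>R (W * (aP * aQ))"
proof -
  define T where "T b g = scaleC (A1.del b * A1.del g) (A1.E b b * X b * (A2.E g g * Z g))" for b g
  have "aP * aQ = (\<Sum>b\<in>R. \<Sum>g\<in>R. T b g)"
    unfolding aP_def aQ_def A1.tw_def A2.tw_def sum_product T_def
    by (intro sum.cong refl) (simp add: mult.commute)
  moreover have "aQ * aP = (\<Sum>b\<in>R. \<Sum>g\<in>R. scaleC (if b = g then - 1 else 1) (T b g))"
  proof -
    have "aQ * aP = (\<Sum>b\<in>R. \<Sum>g\<in>R. scaleC (A1.del g) (A2.E g g * Z g) * scaleC (A1.del b) (A1.E b b * X b))"
      unfolding aP_def aQ_def A1.tw_def A2.tw_def sum_product by (rule sum.swap)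
    also have "\<dots> = (\<Sum>b\<in>R. \<Sum>g\<in>R. scaleC (if b = g then - 1 else 1) (T b g))"
    proof (intro sum.cong refl)
      fix b g assume bg: "b \<in> R" "g \<in> R"
      have "A2.E g g * Z g * (A1.E b b * X b) = A2.E g g * (Z g * A1.E b b) * X b" by (simp only: mult.assoc)
      also have "\<dots> = (A2.E g g * A1.E b b) * (Z g * X b)"
        unfolding Z_def A1.E_def commute13 by (simp only: mult.assoc)
      also have "\<dots> = scaleC (if b = g then - 1 else 1) (A1.E b b * A2.E g g * (X b * Z g))"
        unfolding ZX[OF bg(1)] A1.E_def A2.E_def commute12 by simp
      also have "A1.E b b * A2.E g g * (X b * Z g) = A1.E b b * X b * (A2.E g g * Z g)"
      proof -
        have "A2.E g g * X b = X b * A2.E g g" unfolding X_def A2.E_def by (rule commute23[symmetric])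
        then have "A1.E b b * (A2.E g g * X b) * Z g = A1.E b b * (X b * A2.E g g) * Z g" by simp
        then show ?thesis by (simp only: mult.assoc)
      qed
      finally show "scaleC (A1.del g) (A2.E g g * Z g) * scaleC (A1.del b) (A1.E b b * X b)
        = scaleC (if b = g then - 1 else 1) (T b g)" by (simp add: T_def mult.commute)
    qed
    finally show ?thesis .
  qed
  ultimately have "aP * aQ - aQ * aP = (\<Sum>b\<in>R. \<Sum>g\<in>R. T b g - scaleC (if b = g then - 1 else 1) (T b g))"
    by (simp only: sum_subtractf)
  also have "\<dots> = (\<Sum>b\<in>R. \<Sum>g\<in>R. if g = b then 2 *\<^sub>R T b b else 0)"
    by (intro sum.cong refl) (auto simp: scaleC_minus_one scaleR_2)
  also have "\<dots> = 2 *\<^sub>R (\<Sum>b\<in>R. T b b)" by (simp add: sum.delta scaleR_sum_right)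
  also have "(\<Sum>b\<in>R. T b b) = W * (aP * aQ)"
    unfolding W_def sum_distrib_right
  proof (intro sum.cong refl)
    fix c assume c: "c \<in> R"
    have 1: "A1.E c c * aP = scaleC (A1.del c) (A1.E c c * X c)" unfolding aP_def by (rule A1.E_tw[OF c])
    have 2: "A2.E c c * aQ = scaleC (A1.del c) (A2.E c c * Z c)" unfolding aQ_def by (rule A2.E_tw[OF c])
    have "A1.E c c * A2.E c c * (aP * aQ) = A1.E c c * (A2.E c c * aP) * aQ" by (simp only: mult.assoc)
    also have "\<dots> = (A1.E c c * aP) * (A2.E c c * aQ)"
      unfolding A2.E_def aP_commute[symmetric] by (simp only: mult.assoc)
    also have "\<dots> = T c c" unfolding 1 2 T_def by simp
    finally show "T c c = A1.E c c * A2.E c c * (aP * aQ)" by simp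
  qed
  finally show ?thesis .
qed

lemma commutator_small: "(norm (aP * aQ - aQ * aP))\<^sup>2 * real (card R) \<le> 4 * real (card I0)"
proof -
  have "contr (aP * aQ)" by (intro contr_mult unitary_contr[OF finite_I0] unitaries)
  then have "norm (W * (aP * aQ)) \<le> norm W" by (rule contr_right)
  then have "(norm (aP * aQ - aQ * aP))\<^sup>2 \<le> (2 * norm W)\<^sup>2"
    unfolding commutator_eq by (intro power_mono) auto
  also have "\<dots> = 4 * real (card R * 2 ^ card R)" by (simp add: power_mult_distrib norm_W)
  finally have "(norm (aP * aQ - aQ * aP))\<^sup>2 * real (card R) \<le> 4 * real (card R * 2 ^ card R) * real (card R)"
    by (intro mult_right_mono) auto
  then show ?thesis by (simp add: card_I0 algebra_simps)
qed

theorem no_close_commuting_unitaries: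
  assumes J: "finite J" "I0 \<subseteq> J"
    and U: "unitary J U1" "unitary J U2" and V: "unitary J V1" "unitary J V2"
    and comm: "U1 * V1 = V1 * U1" "U1 * V2 = V2 * U1" "U2 * V1 = V1 * U2" "U2 * V2 = V2 * U2"
    and close: "(norm (U1 - aP))\<^sup>2 \<le> \<eta>" "(norm (U2 - bP))\<^sup>2 \<le> \<eta>" "(norm (V1 - aQ))\<^sup>2 \<le> \<eta>"
      "(norm (V2 - bQ))\<^sup>2 \<le> \<eta>" "(norm (unit J - unit I0))\<^sup>2 \<le> \<eta>"
  shows "real (card I0) \<le> 13000000 * \<eta>"
proof -
  note P = A1.twist_half[OF twist_X J(1), unfolded K_eq, OF J(2), folded aP_def bP_def]
  note Q = A2.twist_half[OF twist_Z J(1), unfolded K_eq, OF J(2), folded aQ_def bQ_def]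
  note xP = A1.tw_xs[OF twist_X, folded aP_def] and xQ = A2.tw_xs[OF twist_Z, folded aQ_def]
  have "real (card I0) \<le> 4 * (360 * 9000 + 39) * \<eta>"
  proof (rule halves_incompatible[OF P Q U V comm close])
    show "R \<noteq> {}" by (auto simp: R_def)
    fix i assume i: "i \<in> R"
    show "half.xs R (\<lambda>k. A1.E (fst k) (snd k)) aP i * half.xs R (\<lambda>k. A2.E (fst k) (snd k)) aQ i
      = - (half.xs R (\<lambda>k. A2.E (fst k) (snd k)) aQ i * half.xs R (\<lambda>k. A1.E (fst k) (snd k)) aP i)"
      unfolding xP[OF i] xQ[OF i] using ZX[OF i, of i] by (simp add: scaleC_minus_one[symmetric] del: scaleC_scaleC) simp
    have u: "unitary I0 (X i)" "unitary I0 (Z i)"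
      using X_sq[OF i] Z_sq[of i] supp_am_I0 by (simp_all add: unitary_def adj_X adj_Z) (simp_all add: X_def Z_def)
    \<comment> \<open>The anticommuting product is unitary, so its squared norm is the full
      dimension: this is the quantity that cannot be small.\<close>
    have "norm (X i * Z i) = norm (unit I0)"
    proof -
      have "unitary I0 (X i * Z i)" by (intro unitary_mult u finite_I0)
      from norm_unitary_left[OF finite_I0 this supp_unit[OF finite_I0]] this show ?thesis
        by (simp add: mult_unit unitary_def)
    qed
    then show "(norm (half.xs R (\<lambda>k. A1.E (fst k) (snd k)) aP i * half.xs R (\<lambda>k. A2.E (fst k) (snd k)) aQ i))\<^sup>2 = real (card I0)"
      unfolding xP[OF i] xQ[OF i] by (simp add: norm_scaleC norm_mult norm_unit_sq)
  qed
  \<comment> \<open>4 * (360 * 9000 + 39) = 12960156.\<close>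
  also have "\<dots> \<le> 13000000 * \<eta>"
  proof -
    have "0 \<le> \<eta>" using close(1) zero_le_power2 order_trans by blast
    then show ?thesis by simp
  qed
  finally show ?thesis .
qed

end

section \<open>Matrices and words\<close>

text \<open>One injection g serves all dimensions, so that compression to leading coordinates
  becomes multiplication on both sides by a unit.\<close>

definition toF :: "(nat \<Rightarrow> 'i) \<Rightarrow> complex mat \<Rightarrow> 'i fmat" where
  "toF g A = mkf (g ` {..<dim_row A}) (\<lambda>x y. A $$ (inv_into UNIV g x, inv_into UNIV g y))"

definition fromF :: "(nat \<Rightarrow> 'i) \<Rightarrow> nat \<Rightarrow> 'i fmat \<Rightarrow> complex mat" where
  "fromF g d x = mat d d (\<lambda>(i, j). ent x (g i) (g j))"

lemma fromF_carrier [simp]: "fromF g d x \<in> carrier_mat d d"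
  by (simp add: fromF_def)

lemma adjoint_carrier: "A \<in> carrier_mat D D \<Longrightarrow> adjoint_mat A \<in> carrier_mat D D"
  by (simp add: adjoint_mat_def)

lemma fmat_eqI_img:
  assumes "supp x \<subseteq> g ` {..<D}" "supp y \<subseteq> g ` {..<D}"
    "\<And>i j. i < D \<Longrightarrow> j < D \<Longrightarrow> ent x (g i) (g j) = ent y (g i) (g j)"
  shows "x = y"
proof (rule fmat_eqI)
  fix a b
  show "ent x a b = ent y a b"
  proof (cases "a \<in> g ` {..<D} \<and> b \<in> g ` {..<D}")
    case True
    then obtain i j where "i < D" "j < D" "a = g i" "b = g j" by auto
    then show ?thesis using assms(3) by simp
  next
    case False
    then have "a \<notin> supp x \<or> b \<notin> supp x" "a \<notin> supp y \<or> b \<notin> supp y" using assms(1,2) by (meson subsetD)+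
    then show ?thesis by (simp add: not_supp)
  qed
qed

context
  fixes g :: "nat \<Rightarrow> 'i"
  assumes g: "inj g"
begin

lemma supp_toF: "A \<in> carrier_mat D D \<Longrightarrow> supp (toF g A) \<subseteq> g ` {..<D}"
  using supp_mkf[of "g ` {..<D}"] by (simp add: toF_def)

lemma ent_toF: "A \<in> carrier_mat D D \<Longrightarrow> i < D \<Longrightarrow> j < D \<Longrightarrow> ent (toF g A) (g i) (g j) = A $$ (i, j)"
  by (simp add: toF_def ent_mkf inv_f_f[OF g])

lemma ent_mult_img:
  assumes "supp x \<subseteq> g ` {..<D}"
  shows "ent (x * y) a b = (\<Sum>k<D. ent x a (g k) * ent y (g k) b)"
proof -
  have "ent (x * y) a b = (\<Sum>k\<in>g ` {..<D}. ent x a k * ent y k b)"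
    using assms by (intro ent_times) (auto intro: le_infI1)
  then show ?thesis using g by (simp add: sum.reindex inj_on_subset[OF g])
qed

lemma toF_mult:
  assumes "A \<in> carrier_mat D D" "B \<in> carrier_mat D D"
  shows "toF g (A * B) = toF g A * toF g B"
proof (rule fmat_eqI_img)
  show "supp (toF g (A * B)) \<subseteq> g ` {..<D}" using assms by (intro supp_toF) simp
  show "supp (toF g A * toF g B) \<subseteq> g ` {..<D}" by (intro supp_mult_subset supp_toF assms)
  fix i j assume ij: "i < D" "j < D"
  have "ent (toF g (A * B)) (g i) (g j) = (A * B) $$ (i, j)"
    by (rule ent_toF[OF mult_carrier_mat[OF assms] ij])
  also have "\<dots> = (\<Sum>k<D. A $$ (i, k) * B $$ (k, j))"
    using assms ij by (simp add: scalar_prod_def atLeast0LessThan)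
  also have "\<dots> = ent (toF g A * toF g B) (g i) (g j)"
    unfolding ent_mult_img[OF supp_toF[OF assms(1)]]
    by (intro sum.cong refl) (simp add: ent_toF[OF assms(1)] ent_toF[OF assms(2)] ij)
  finally show "ent (toF g (A * B)) (g i) (g j) = ent (toF g A * toF g B) (g i) (g j)" .
qed

lemma toF_diff:
  assumes "A \<in> carrier_mat D D" "B \<in> carrier_mat D D"
  shows "toF g (A - B) = toF g A - toF g B"
proof (rule fmat_eqI_img)
  have AB: "A - B \<in> carrier_mat D D" using assms by (simp add: minus_carrier_mat)
  then show "supp (toF g (A - B)) \<subseteq> g ` {..<D}" by (rule supp_toF)
  show "supp (toF g A - toF g B) \<subseteq> g ` {..<D}" by (intro supp_diff_subset supp_toF assms)
  show "ent (toF g (A - B)) (g i) (g j) = ent (toF g A - toF g B) (g i) (g j)" if "i < D" "j < D" for i j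
    using that assms by (simp add: ent_toF[OF AB] ent_toF[OF assms(1)] ent_toF[OF assms(2)])
qed

lemma toF_adj:
  assumes "A \<in> carrier_mat D D"
  shows "toF g (adjoint_mat A) = adj (toF g A)"
proof (rule fmat_eqI_img)
  show "supp (toF g (adjoint_mat A)) \<subseteq> g ` {..<D}" by (rule supp_toF[OF adjoint_carrier[OF assms]])
  show "supp (adj (toF g A)) \<subseteq> g ` {..<D}" using supp_toF[OF assms] by simp
  show "ent (toF g (adjoint_mat A)) (g i) (g j) = ent (adj (toF g A)) (g i) (g j)" if "i < D" "j < D" for i j
    using that assms by (simp add: ent_toF[OF adjoint_carrier[OF assms]] ent_toF[OF assms]) (simp add: adjoint_mat_def)
qed

lemma toF_one: "toF g (1\<^sub>m D) = unit (g ` {..<D})"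
proof (rule fmat_eqI_img)
  show "supp (toF g (1\<^sub>m D)) \<subseteq> g ` {..<D}" by (rule supp_toF) simp
  show "supp (unit (g ` {..<D})) \<subseteq> g ` {..<D}" by (simp add: supp_unit)
  show "ent (toF g (1\<^sub>m D)) (g i) (g j) = ent (unit (g ` {..<D})) (g i) (g j)" if "i < D" "j < D" for i j
    using that by (simp add: ent_toF[of "1\<^sub>m D" D] ent_unit inj_eq[OF g])
qed

lemma toF_unitary:
  assumes "U \<in> unitary_mats D"
  shows "unitary (g ` {..<D}) (toF g U)"
proof -
  have c: "U \<in> carrier_mat D D" using assms by (simp add: unitary_mats_def)
  have "toF g U * adj (toF g U) = toF g (U * adjoint_mat U)"
    "adj (toF g U) * toF g U = toF g (adjoint_mat U * U)"
    by (simp_all add: toF_mult[OF c adjoint_carrier[OF c]] toF_mult[OF adjoint_carrier[OF c] c] toF_adj[OF c])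
  then show ?thesis using assms supp_toF[OF c] by (simp add: unitary_def unitary_mats_def toF_one)
qed

lemma toF_fromF:
  assumes "supp x \<subseteq> g ` {..<d}"
  shows "toF g (fromF g d x) = x"
  by (rule fmat_eqI_img[OF supp_toF[OF fromF_carrier] assms])
    (simp add: ent_toF[OF fromF_carrier], simp add: fromF_def)

lemma toF_inject:
  assumes "A \<in> carrier_mat d d" "B \<in> carrier_mat d d" "toF g A = toF g B"
  shows "A = B"
  using assms by (intro eq_matI) (metis carrier_matD ent_toF)+

lemma fromF_unitary:
  assumes "unitary (g ` {..<d}) x"
  shows "fromF g d x \<in> unitary_mats d"
proof -
  have s: "supp x \<subseteq> g ` {..<d}" using assms by (simp add: unitary_def)
  have a: "adjoint_mat (fromF g d x) \<in> carrier_mat d d" by (rule adjoint_carrier[OF fromF_carrier])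
  have "fromF g d x * adjoint_mat (fromF g d x) = 1\<^sub>m d"
  proof (rule toF_inject[of _ d])
    show "toF g (fromF g d x * adjoint_mat (fromF g d x)) = toF g (1\<^sub>m d)"
      using assms by (simp add: toF_mult[OF fromF_carrier a] toF_adj[OF fromF_carrier] toF_fromF[OF s] toF_one unitary_def)
  qed (simp_all add: mult_carrier_mat[OF fromF_carrier a])
  moreover have "adjoint_mat (fromF g d x) * fromF g d x = 1\<^sub>m d"
  proof (rule toF_inject[of _ d])
    show "toF g (adjoint_mat (fromF g d x) * fromF g d x) = toF g (1\<^sub>m d)"
      using assms by (simp add: toF_mult[OF a fromF_carrier] toF_adj[OF fromF_carrier] toF_fromF[OF s] toF_one unitary_def)
  qed (simp_all add: mult_carrier_mat[OF a fromF_carrier])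
  ultimately show ?thesis by (simp add: unitary_mats_def)
qed

lemma hs_norm_toF:
  assumes A: "A \<in> carrier_mat d d"
  shows "hs_norm A = norm (toF g A) / sqrt (real d)"
proof -
  have "(norm (toF g A))\<^sup>2 = (\<Sum>i<d. \<Sum>j<d. (cmod (A $$ (i, j)))\<^sup>2)"
    unfolding norm_fmat_sq[OF finite_imageI[OF finite_lessThan] supp_toF[OF A]]
    by (simp add: sum.reindex inj_on_subset[OF g] ent_toF[OF A])
  then have "norm (toF g A) = sqrt (\<Sum>i<d. \<Sum>j<d. (cmod (A $$ (i, j)))\<^sup>2)"
    by (metis norm_ge_zero real_sqrt_unique)
  then show ?thesis using A by (simp add: hs_norm_def real_sqrt_divide)
qed

lemma compress_toF:
  assumes A: "A \<in> carrier_mat D D" and "d \<le> D"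
  shows "toF g (compress d A) = unit (g ` {..<d}) * toF g A * unit (g ` {..<d})"
proof (rule fmat_eqI_img)
  have c: "compress d A \<in> carrier_mat d d" by (simp add: compress_def)
  show "supp (toF g (compress d A)) \<subseteq> g ` {..<d}" by (rule supp_toF[OF c])
  let ?u = "unit (g ` {..<d})"
  have u: "ent ?u a b = (if a \<in> g ` {..<d} \<and> a = b then 1 else 0)" for a b by (simp add: ent_unit)
  show "supp (?u * toF g A * ?u) \<subseteq> g ` {..<d}"
  proof (rule supp_subsetI)
    fix a b assume ab: "a \<notin> g ` {..<d} \<or> b \<notin> g ` {..<d}"
    show "ent (?u * toF g A * ?u) a b = 0"
      unfolding ent_times_supp u using ab by (intro sum.neutral ballI) (auto simp: image_iff)
  qed
  fix i j assume ij: "i < d" "j < d"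
  have "ent (?u * toF g A * ?u) (g i) (g j) = (\<Sum>k<D. if k = j then ent (?u * toF g A) (g i) (g k) else 0)"
  proof -
    have "g ` {..<d} \<subseteq> g ` {..<D}" using assms(2) by (intro image_mono) simp
    then have "supp ?u \<subseteq> g ` {..<D}"
      by (rule order_trans[OF supp_unit[OF finite_imageI[OF finite_lessThan]]])
    then have "supp (?u * toF g A) \<subseteq> g ` {..<D}" by (rule supp_mult_subset[OF _ supp_toF[OF A]])
    then have "ent (?u * toF g A * ?u) (g i) (g j) = (\<Sum>k<D. ent (?u * toF g A) (g i) (g k) * ent ?u (g k) (g j))"
      by (rule ent_mult_img)
    also have "\<dots> = (\<Sum>k<D. if k = j then ent (?u * toF g A) (g i) (g k) else 0)"
      by (intro sum.cong refl) (use ij in \<open>auto simp: u inj_eq[OF g]\<close>)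
    finally show ?thesis .
  qed
  also have "\<dots> = ent (?u * toF g A) (g i) (g j)" using ij assms(2) by simp
  also have "\<dots> = (\<Sum>k<d. if k = i then A $$ (i, j) else 0)"
    unfolding ent_mult_img[OF supp_unit[OF finite_imageI[OF finite_lessThan]]]
    by (intro sum.cong refl) (use ij assms(2) in \<open>auto simp: u inj_eq[OF g] ent_toF[OF A]\<close>)
  also have "\<dots> = A $$ (i, j)" using ij by simp
  finally show "ent (toF g (compress d A)) (g i) (g j) = ent (?u * toF g A * ?u) (g i) (g j)"
    using ij by (simp add: ent_toF[OF c]) (simp add: compress_def)
qed

end

section \<open>Evaluation of words\<close>

definition letter_val :: "(nat \<Rightarrow> 'i fmat) \<Rightarrow> nat \<times> bool \<Rightarrow> 'i fmat" where
  "letter_val G l = (if snd l then G (fst l) else adj (G (fst l)))"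

definition word_val :: "'i set \<Rightarrow> (nat \<Rightarrow> 'i fmat) \<Rightarrow> (nat \<times> bool) list \<Rightarrow> 'i fmat" where
  "word_val J G w = foldr (\<lambda>l x. letter_val G l * x) w (unit J)"

lemma word_val_simps [simp]:
  "word_val J G [] = unit J" "word_val J G (l # w) = letter_val G l * word_val J G w"
  by (simp_all add: word_val_def)

context
  fixes J :: "'i set" and G :: "nat \<Rightarrow> 'i fmat"
  assumes J: "finite J" and G: "\<And>i. unitary J (G i)"
begin

lemma letter_val_unitary: "unitary J (letter_val G l)"
  using G[of "fst l"] unitary_adj[OF G[of "fst l"]] by (simp add: letter_val_def)

lemma word_val_unitary: "unitary J (word_val J G w)"
  by (induction w) (simp_all add: unitary_unit J unitary_mult letter_val_unitary)

lemma word_val_supp: "supp (word_val J G w) \<subseteq> J"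
  using word_val_unitary by (simp add: unitary_def)

lemma word_val_append: "word_val J G (u @ v) = word_val J G u * word_val J G v"
  by (induction u) (simp_all add: unit_mult J word_val_supp mult.assoc)

lemma letter_val_inverse:
  assumes "inv_letter l l'" shows "letter_val G l * letter_val G l' = unit J"
  using assms G[of "fst l"] by (auto simp: inv_letter_def letter_val_def unitary_def)

text \<open>Reduction only cancels adjacent inverse letters, whose values multiply to the unit. With
  \<open>word_val_append\<close> this makes evaluation multiplicative on the free group.\<close>

lemma word_val_reduce: "word_val J G (reduce w) = word_val J G w"
proof (induction w)
  case (Cons l w)
  have "word_val J G (reduce (l # w)) = letter_val G l * word_val J G (reduce w)"
  proof (cases "reduce w")
    case Nil
    then show ?thesis by (simp add: reduce_def)
  next
    case (Cons y ys)
    have "letter_val G l * (letter_val G y * word_val J G ys) = word_val J G ys" if "inv_letter l y"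
      using letter_val_inverse[OF that] unit_mult[OF J word_val_supp] by (metis mult.assoc)
    then show ?thesis using Cons by (simp add: reduce_def)
  qed
  then show ?case using Cons by simp
qed (simp add: reduce_def)

text \<open>The Leibniz rule for commutators, with unitary factors that do not increase norms. An
  inverse letter has at most the defect of its generator, by conjugating the commutator.\<close>

lemma word_val_commutator:
  assumes x: "supp x \<subseteq> J" and \<epsilon>: "\<And>i. norm (G i * x - x * G i) \<le> \<epsilon>"
  shows "norm (word_val J G w * x - x * word_val J G w) \<le> real (length w) * \<epsilon>"
proof (induction w)
  case Nil
  then show ?case by (simp add: unit_mult[OF J x] mult_unit[OF J x])
next
  case (Cons l w)
  define a where "a = letter_val G l"
  define y where "y = word_val J G w"
  have ca: "contr a" and cy: "contr y"
    unfolding a_def y_def by (rule unitary_contr[OF J], rule letter_val_unitary word_val_unitary)+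
  have "norm (a * x - x * a) \<le> \<epsilon>"
  proof (cases "snd l")
    case True
    then show ?thesis using \<epsilon> by (simp add: a_def letter_val_def)
  next
    case False
    define u where "u = G (fst l)"
    have au: "a = adj u" using False by (simp add: a_def u_def letter_val_def)
    have uu: "unitary J u" by (simp add: u_def G)
    have "adj u * (x * u - u * x) * adj u = adj u * x * (u * adj u) - (adj u * u) * x * adj u"
      by (simp add: left_diff_distrib right_diff_distrib mult.assoc)
    also have "\<dots> = adj u * x - x * adj u"
      using uu x by (simp add: unitary_def unit_mult[OF J] mult_unit[OF J] supp_mult_subset)
    finally have "a * x - x * a = adj u * (x * u - u * x) * adj u" by (simp add: au)
    also have "norm \<dots> \<le> norm (adj u * (x * u - u * x))"
      by (rule contr_right[OF contr_adj[OF unitary_contr[OF J uu]]])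
    also have "\<dots> \<le> norm (x * u - u * x)" by (rule contrD[OF contr_adj[OF unitary_contr[OF J uu]]])
    finally show ?thesis using \<epsilon>[of "fst l"] by (simp add: u_def norm_minus_commute)
  qed
  moreover have "a * y * x - x * (a * y) = a * (y * x - x * y) + (a * x - x * a) * y"
    by (simp add: left_diff_distrib right_diff_distrib mult.assoc)
  then have "norm (a * y * x - x * (a * y)) \<le> norm (a * (y * x - x * y)) + norm ((a * x - x * a) * y)"
    by (simp add: norm_triangle_ineq)
  moreover have "norm (a * (y * x - x * y)) \<le> norm (y * x - x * y)" by (rule contrD[OF ca])
  moreover have "norm ((a * x - x * a) * y) \<le> norm (a * x - x * a)" by (rule contr_right[OF cy])
  ultimately have "norm (a * y * x - x * (a * y)) \<le> real (length w) * \<epsilon> + \<epsilon>"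
    using Cons.IH unfolding y_def by linarith
  then show ?case by (simp add: a_def y_def algebra_simps)
qed

end

lemma norm_unitary_sq: "finite J \<Longrightarrow> unitary J u \<Longrightarrow> (norm u)\<^sup>2 = card J"
  using norm_unitary_left[of J u "unit J"] norm_unit_sq[of J]
  by (simp add: mult_unit supp_unit unitary_def)

text \<open>The norms of U and a are fixed by the dimensions, and the inner product of U with a sees
  only the compression of U. Unitarity thus upgrades closeness of the compression to closeness of U
  to a extended by zero.\<close>

lemma dilation_close:
  assumes J: "finite J" "J0 \<subseteq> J" and U: "unitary J U" and a: "unitary J0 a"
    and r: "norm (a - unit J0 * U * unit J0) \<le> r * sqrt (card J0)"
  shows "(norm (U - a))\<^sup>2 \<le> real (card J) - real (card J0) + 2 * r * real (card J0)"
proof -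
  define p where "p = unit J0"
  have J0: "finite J0" using J finite_subset by blast
  have sa: "supp a \<subseteq> J0" using a by (simp add: unitary_def)
  have pa: "p * a = a" "a * p = a" by (simp_all add: p_def unit_mult[OF J0 sa] mult_unit[OF J0 sa])
  have ap: "adj p = p" by (simp add: p_def adj_unit J0)
  have "inner (p * U * p) a = inner (p * U) (a * p)"
    using inner_mult_right[of "p * U" p a] by (simp only: ap)
  also have "\<dots> = inner U (p * a * p)"
    using inner_mult_left[of p U "a * p"] by (simp only: ap mult.assoc)
  finally have e: "inner U a = inner (p * U * p) a" using pa by simp
  have na: "(norm a)\<^sup>2 = card J0" by (rule norm_unitary_sq[OF J0 a])
  then have na': "norm a = sqrt (card J0)" by (metis norm_ge_zero real_sqrt_unique)
  have "inner (a - p * U * p) a \<le> norm (a - p * U * p) * norm a" by (rule norm_cauchy_schwarz)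
  also have "\<dots> \<le> (r * sqrt (card J0)) * norm a" using r by (intro mult_right_mono) (simp_all add: p_def)
  also have "\<dots> = r * card J0" unfolding na' by simp
  finally have "real (card J0) - inner U a \<le> r * card J0"
    using na e by (simp add: inner_diff_left power2_norm_eq_inner)
  moreover have "(norm (U - a))\<^sup>2 = (norm U)\<^sup>2 + (norm a)\<^sup>2 - 2 * inner U a"
    by (simp add: power2_norm_eq_inner inner_simps inner_commute)
  ultimately show ?thesis using na norm_unitary_sq[OF J(1) U] by simp
qed

section \<open>The asymptotic homomorphism and its rigidity\<close>

context model
begin

definition dm :: nat where "dm = card I0"

text \<open>The first \<open>dm\<close> indices enumerate the model space and later ones use the
  right summand, so the model space occupies the leading coordinates of every larger space.\<close>

definition gi :: "nat \<Rightarrow> idx" where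
  "gi j = (if j < dm then (SOME f. bij_betw f {..<dm} I0) j else Inr j)"

lemma gi: "inj gi" "gi ` {..<dm} = I0"
proof -
  have "\<exists>f. bij_betw f {..<dm} I0"
    using ex_bij_betw_nat_finite[OF finite_I0] by (simp add: dm_def atLeast0LessThan)
  then have f: "bij_betw (SOME f. bij_betw f {..<dm} I0) {..<dm} I0" by (rule someI_ex)
  define f where "f = (SOME f. bij_betw f {..<dm} I0)"
  have bf: "inj_on f {..<dm}" "f ` {..<dm} = I0" using f by (simp_all add: f_def bij_betw_def)
  have gi_f: "gi j = f j" if "j < dm" for j using that by (simp add: gi_def f_def)
  have gi_r: "gi j = Inr j" if "\<not> j < dm" for j using that by (simp add: gi_def)
  have fI: "\<exists>x. f j = Inl x" if "j < dm" for j
  proof -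
    have "f j \<in> I0" using bf(2) that by blast
    then show ?thesis by (auto simp: I0_def)
  qed
  show "gi ` {..<dm} = I0" using bf(2) gi_f by simp
  show "inj gi"
  proof (rule injI)
    fix i j assume ij: "gi i = gi j"
    show "i = j"
    proof (cases "i < dm"; cases "j < dm")
      assume "i < dm" "j < dm"
      then show ?thesis using ij bf(1) gi_f by (simp add: inj_on_def)
    next
      assume "i < dm" "\<not> j < dm"
      then show ?thesis using ij fI[of i] gi_f gi_r by auto
    next
      assume "\<not> i < dm" "j < dm"
      then show ?thesis using ij fI[of j] gi_f gi_r by (metis Inl_Inr_False)
    next
      assume "\<not> i < dm" "\<not> j < dm"
      then show ?thesis using ij gi_r by simp
    qed
  qed
qed

lemma dm_pos: "dm \<ge> 1"
proof -
  have "card R > 0" using card_R n_pos by linarith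
  then show ?thesis by (simp add: dm_def card_I0)
qed

definition genP :: "nat \<Rightarrow> idx fmat" where "genP i = (if i = 0 then aP else if i = 1 then bP else unit I0)"
definition genQ :: "nat \<Rightarrow> idx fmat" where "genQ i = (if i = 0 then aQ else if i = 1 then bQ else unit I0)"

lemma gen_unitary: "unitary I0 (genP i)" "unitary I0 (genQ i)"
  using unitaries by (simp_all add: genP_def genQ_def unitary_unit)

definition wP :: "(nat \<times> bool) list \<Rightarrow> idx fmat" where "wP = word_val I0 genP"
definition wQ :: "(nat \<times> bool) list \<Rightarrow> idx fmat" where "wQ = word_val I0 genQ"

lemma w_unitary: "unitary I0 (wP u)" "unitary I0 (wQ u)"
  unfolding wP_def wQ_def by (rule word_val_unitary[OF finite_I0], rule gen_unitary)+

lemma w_supp: "supp (wP u) \<subseteq> I0" "supp (wQ u) \<subseteq> I0"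
  using w_unitary by (simp_all add: unitary_def)

lemma w_mult: "wP (reduce (u @ v)) = wP u * wP v" "wQ (reduce (u @ v)) = wQ u * wQ v"
  unfolding wP_def wQ_def
  by (simp_all add: word_val_reduce[OF finite_I0 gen_unitary(1)] word_val_reduce[OF finite_I0 gen_unitary(2)]
      word_val_append[OF finite_I0 gen_unitary(1)] word_val_append[OF finite_I0 gen_unitary(2)])

text \<open>Each free factor is represented exactly; multiplicativity fails only where a word of one
  factor has to pass a word of the other.\<close>

definition phi :: "(nat \<times> bool) list \<times> (nat \<times> bool) list \<Rightarrow> complex mat" where
  "phi g = fromF gi dm (wP (fst g) * wQ (snd g))"

lemma phi_unitary: "phi g \<in> unitary_mats dm"
  unfolding phi_def
  by (rule fromF_unitary[OF gi(1)], unfold gi(2)) (intro unitary_mult w_unitary finite_I0)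

lemma toF_phi: "toF gi (phi g) = wP (fst g) * wQ (snd g)"
  unfolding phi_def by (rule toF_fromF[OF gi(1)], unfold gi(2)) (intro supp_mult_subset w_supp)

lemma gen_commutator: "norm (genP i * genQ j - genQ j * genP i) \<le> norm (aP * aQ - aQ * aP)"
proof -
  have s: "supp aP \<subseteq> I0" "supp bP \<subseteq> I0" "supp aQ \<subseteq> I0" "supp bQ \<subseteq> I0"
    using unitaries by (simp_all add: unitary_def)
  show ?thesis
    by (simp add: genP_def genQ_def fourier_commute mixed_commute unit_mult mult_unit supp_unit s)
qed

text \<open>The Leibniz estimate is applied to each word in turn. Only the pair aP, aQ fails to
  commute, and the lengths stay fixed while n grows.\<close>

lemma w_commutator:
  "norm (wP u * wQ v - wQ v * wP u) \<le> real (length u) * (real (length v) * norm (aP * aQ - aQ * aP))"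
  unfolding wP_def
proof (rule word_val_commutator[OF finite_I0 gen_unitary(1) w_supp(2)])
  fix i
  have "norm (wQ v * genP i - genP i * wQ v) \<le> real (length v) * norm (aP * aQ - aQ * aP)"
    unfolding wQ_def
  proof (rule word_val_commutator[OF finite_I0 gen_unitary(2)])
    show "supp (genP i) \<subseteq> I0" using gen_unitary(1) by (simp add: unitary_def)
    show "norm (genQ j * genP i - genP i * genQ j) \<le> norm (aP * aQ - aQ * aP)" for j
      using gen_commutator[of i j] by (simp add: norm_minus_commute)
  qed
  then show "norm (genP i * wQ v - wQ v * genP i) \<le> real (length v) * norm (aP * aQ - aQ * aP)"
    by (simp add: norm_minus_commute)
qed

lemma phi_defect:
  "hs_norm (phi (reduce (u @ u'), reduce (v @ v')) - phi (u, v) * phi (u', v'))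
    \<le> real (length u') * (real (length v) * (2 / sqrt (real (2 * h + 1))))"
proof -
  have c: "phi g \<in> carrier_mat dm dm" for g using phi_unitary by (simp add: unitary_mats_def)
  define A where "A = phi (reduce (u @ u'), reduce (v @ v')) - phi (u, v) * phi (u', v')"
  have cA: "A \<in> carrier_mat dm dm" unfolding A_def using c by (intro minus_carrier_mat mult_carrier_mat)
  have "toF gi A = wP u * (wP u' * wQ v - wQ v * wP u') * wQ v'"
    unfolding A_def toF_diff[OF gi(1) c mult_carrier_mat[OF c c]] toF_mult[OF gi(1) c c] toF_phi
    by (simp add: w_mult left_diff_distrib right_diff_distrib mult.assoc)
  then have "norm (toF gi A) \<le> norm (wP u' * wQ v - wQ v * wP u')"
    using contr_right[OF unitary_contr[OF finite_I0 w_unitary(2)], of "wP u * (wP u' * wQ v - wQ v * wP u')" v']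
      contrD[OF unitary_contr[OF finite_I0 w_unitary(1)], of u "wP u' * wQ v - wQ v * wP u'"] by simp
  also have "\<dots> \<le> real (length u') * (real (length v) * norm (aP * aQ - aQ * aP))" by (rule w_commutator)
  finally have 1: "norm (toF gi A) \<le> real (length u') * (real (length v) * norm (aP * aQ - aQ * aP))" .
  have cR: "real (card R) = real (2 * h + 1)" using card_R unfolding n_def by linarith
  have "(norm (aP * aQ - aQ * aP) * sqrt (real (card R)))\<^sup>2 \<le> (2 * sqrt (real dm))\<^sup>2"
    using commutator_small by (simp add: power_mult_distrib dm_def)
  then have "norm (aP * aQ - aQ * aP) * sqrt (real (card R)) \<le> 2 * sqrt (real dm)"
    by (rule power2_le_imp_le) simp
  then have 2: "norm (aP * aQ - aQ * aP) / sqrt (real dm) \<le> 2 / sqrt (real (2 * h + 1))"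
    using dm_pos unfolding cR by (simp add: field_simps)
  have "hs_norm A = norm (toF gi A) / sqrt (real dm)" by (rule hs_norm_toF[OF gi(1) cA])
  also have "\<dots> \<le> real (length u') * (real (length v) * norm (aP * aQ - aQ * aP)) / sqrt (real dm)"
    using 1 by (intro divide_right_mono) auto
  also have "\<dots> = real (length u') * (real (length v) * (norm (aP * aQ - aQ * aP) / sqrt (real dm)))" by simp
  also have "\<dots> \<le> real (length u') * (real (length v) * (2 / sqrt (real (2 * h + 1))))"
    using 2 by (intro mult_left_mono) auto
  finally show ?thesis by (simp add: A_def)
qed

lemma phi_generators:
  "toF gi (phi ([(0, True)], [])) = aP" "toF gi (phi ([(1, True)], [])) = bP"
  "toF gi (phi ([], [(0, True)])) = aQ" "toF gi (phi ([], [(1, True)])) = bQ"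
proof -
  have s: "supp aP \<subseteq> I0" "supp bP \<subseteq> I0" "supp aQ \<subseteq> I0" "supp bQ \<subseteq> I0"
    using unitaries by (simp_all add: unitary_def)
  show "toF gi (phi ([(0, True)], [])) = aP" "toF gi (phi ([(1, True)], [])) = bP"
    "toF gi (phi ([], [(0, True)])) = aQ" "toF gi (phi ([], [(1, True)])) = bQ"
    by (simp_all add: toF_phi wP_def wQ_def letter_val_def genP_def genQ_def unit_mult mult_unit s)
qed

lemma not_flexibly_close:
  assumes D: "D \<ge> dm" "real D / real dm < 1 + 1 / 10 ^ 8"
    and U: "U1 \<in> unitary_mats D" "U2 \<in> unitary_mats D" "V1 \<in> unitary_mats D" "V2 \<in> unitary_mats D"
    and comm: "U1 * V1 = V1 * U1" "U1 * V2 = V2 * U1" "U2 * V1 = V1 * U2" "U2 * V2 = V2 * U2"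
    and close: "hs_norm (phi ([(0, True)], []) - compress dm U1) < 1 / 10 ^ 8"
      "hs_norm (phi ([(1, True)], []) - compress dm U2) < 1 / 10 ^ 8"
      "hs_norm (phi ([], [(0, True)]) - compress dm V1) < 1 / 10 ^ 8"
      "hs_norm (phi ([], [(1, True)]) - compress dm V2) < 1 / 10 ^ 8"
  shows False
proof -
  define J where "J = gi ` {..<D}"
  have J: "finite J" "I0 \<subseteq> J" using D(1) by (auto simp: J_def gi(2)[symmetric])
  have cJ: "card J = D" unfolding J_def using gi(1) by (simp add: card_image inj_on_subset)
  have dpos: "real dm > 0" using dm_pos by simp
  \<comment> \<open>One unit of 10^-8 for the excess dimension and two for the compression error.
    Then 13000000 * 3 / 10^8 = 0.39 is below 1, the contradiction.\<close>
  define \<eta> where "\<eta> = 3 / 10 ^ 8 * real dm"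
  have Dd: "real D - real dm \<le> 1 / 10 ^ 8 * real dm" using D(2) dpos by (simp add: field_simps)
  have near: "(norm (toF gi U - a))\<^sup>2 \<le> \<eta>"
    if U: "U \<in> unitary_mats D" and a: "unitary I0 a" "toF gi (phi g) = a"
      and cl: "hs_norm (phi g - compress dm U) < 1 / 10 ^ 8" for U a g
  proof -
    have cU: "U \<in> carrier_mat D D" using U by (simp add: unitary_mats_def)
    have c: "phi g \<in> carrier_mat dm dm" "compress dm U \<in> carrier_mat dm dm"
      using phi_unitary by (simp_all add: unitary_mats_def compress_def)
    have "toF gi (phi g - compress dm U) = a - unit I0 * toF gi U * unit I0"
      unfolding toF_diff[OF gi(1) c] compress_toF[OF gi(1) cU D(1)] a(2) gi(2) ..
    moreover have "hs_norm (phi g - compress dm U) = norm (toF gi (phi g - compress dm U)) / sqrt (real dm)"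
      using c by (intro hs_norm_toF gi(1) minus_carrier_mat)
    ultimately have "norm (a - unit I0 * toF gi U * unit I0) / sqrt (real dm) < 1 / 10 ^ 8" using cl by simp
    then have "norm (a - unit I0 * toF gi U * unit I0) \<le> 1 / 10 ^ 8 * sqrt (real (card I0))"
      using dpos by (simp add: dm_def field_simps)
    from dilation_close[OF J toF_unitary[OF gi(1) U, folded J_def] a(1) this]
    have "(norm (toF gi U - a))\<^sup>2 \<le> real D - real dm + 2 * (1 / 10 ^ 8) * real dm"
      by (simp only: cJ dm_def)
    then show ?thesis using Dd by (simp add: \<eta>_def)
  qed
  have "(norm (unit J - unit I0))\<^sup>2 \<le> \<eta>"
  proof -
    have "unit I0 * unit J * unit I0 = unit I0"
      using J supp_unit[OF finite_I0] by (simp add: mult_unit unit_mult order_trans[OF _ J(2)])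
    then have "norm (unit I0 - unit I0 * unit J * unit I0) \<le> 0 * sqrt (card I0)" by simp
    from dilation_close[OF J unitary_unit[OF J(1)] unitary_unit[OF finite_I0] this]
    have "(norm (unit J - unit I0))\<^sup>2 \<le> real D - real dm" by (simp add: cJ dm_def)
    then show ?thesis using Dd dpos by (simp add: \<eta>_def)
  qed
  moreover have cc: "A * B = B * A \<Longrightarrow> toF gi A * toF gi B = toF gi B * toF gi A"
    if "A \<in> unitary_mats D" "B \<in> unitary_mats D" for A B
    using that toF_mult[OF gi(1)] by (metis (no_types, lifting) mem_Collect_eq unitary_mats_def)
  ultimately have "real dm \<le> 13000000 * \<eta>"
    unfolding dm_def
    using J U comm close near[OF U(1) unitaries(1) phi_generators(1)] near[OF U(2) unitaries(2) phi_generators(2)]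
      near[OF U(3) unitaries(3) phi_generators(3)] near[OF U(4) unitaries(4) phi_generators(4)]
    by (intro no_close_commuting_unitaries[of J "toF gi U1" "toF gi U2" "toF gi V1" "toF gi V2"])
      (simp_all add: toF_unitary[OF gi(1), of _ D, folded J_def])
  then show False using dpos by (simp add: \<eta>_def)
qed

end

section \<open>Transfer to the sequence of representations\<close>

theorem theoremB:
  fixes k m :: nat
  assumes "k \<ge> 2" and "m \<ge> 2"
  shows "\<not> flexibly_HS_stable (free_group k \<times>\<times> free_group m)"
proof
  let ?G = "free_group k \<times>\<times> free_group m"
  assume stable: "flexibly_HS_stable ?G"
  have mult: "x \<otimes>\<^bsub>?G\<^esub> y = (reduce (fst x @ fst y), reduce (snd x @ snd y))" for x y
    by (cases x; cases y) (simp add: free_group_def)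
  have "asymptotic_hom ?G model.dm model.phi"
    unfolding asymptotic_hom_def
  proof (intro conjI allI ballI)
    show "1 \<le> model.dm n" for n by (rule model.dm_pos)
    show "model.phi n g \<in> unitary_mats (model.dm n)" for n g by (rule model.phi_unitary)
    fix x y :: "(nat \<times> bool) list \<times> (nat \<times> bool) list"
    \<comment> \<open>The sequence index plays the role of h, so the number of residues is 2 * n + 1
      and each fixed pair of elements has a defect of order 1 / sqrt n.\<close>
    define L where "L = real (length (fst y)) * real (length (snd x)) * 2"
    have "(\<lambda>n. L / sqrt (real (2 * n + 1))) \<longlonglongrightarrow> 0"
      by (rule tendsto_divide_0[OF tendsto_const])
        (intro filterlim_at_top_imp_at_infinity filterlim_compose[OF sqrt_at_top]
          filterlim_compose[OF filterlim_real_sequentially] filterlim_subseq strict_monoI, simp)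
    then show "(\<lambda>n. hs_norm (model.phi n (x \<otimes>\<^bsub>?G\<^esub> y) - model.phi n x * model.phi n y)) \<longlonglongrightarrow> 0"
    proof (rule tendsto_sandwich[OF _ _ tendsto_const, rotated 2])
      show "\<forall>\<^sub>F n in sequentially. 0 \<le> hs_norm (model.phi n (x \<otimes>\<^bsub>?G\<^esub> y) - model.phi n x * model.phi n y)"
        by (simp add: hs_norm_def sum_nonneg)
      have "hs_norm (model.phi n (x \<otimes>\<^bsub>?G\<^esub> y) - model.phi n x * model.phi n y) \<le> L / sqrt (real (2 * n + 1))" for n
        using model.phi_defect[of n "fst x" "fst y" "snd x" "snd y"] by (simp add: mult L_def)
      then show "\<forall>\<^sub>F n in sequentially. hs_norm (model.phi n (x \<otimes>\<^bsub>?G\<^esub> y) - model.phi n x * model.phi n y) \<le> L / sqrt (real (2 * n + 1))"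
        by simp
    qed
  qed
  then have "\<exists>D \<rho>. (\<forall>n. D n \<ge> model.dm n) \<and> (\<lambda>n. real (D n) / real (model.dm n)) \<longlonglongrightarrow> 1 \<and>
      (\<forall>n. unitary_rep ?G (D n) (\<rho> n)) \<and>
      (\<forall>g\<in>carrier ?G. (\<lambda>n. hs_norm (model.phi n g - compress (model.dm n) (\<rho> n g))) \<longlonglongrightarrow> 0)"
    by (rule stable[unfolded flexibly_HS_stable_def, rule_format])
  then obtain D \<rho> where D: "\<forall>n. D n \<ge> model.dm n" "(\<lambda>n. real (D n) / real (model.dm n)) \<longlonglongrightarrow> 1"
    and \<rho>: "\<forall>n. unitary_rep ?G (D n) (\<rho> n)"
    and close: "\<forall>g\<in>carrier ?G. (\<lambda>n. hs_norm (model.phi n g - compress (model.dm n) (\<rho> n g))) \<longlonglongrightarrow> 0"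
    by (elim exE conjE) (rule that)
  \<comment> \<open>Two generators from each factor suffice. Their images commute across the
    factors, and a single late index already gives the contradiction.\<close>
  define x1 x2 y1 y2 :: "(nat \<times> bool) list \<times> (nat \<times> bool) list"
    where xy: "x1 = ([(0, True)], [])" "x2 = ([(1, True)], [])" "y1 = ([], [(0, True)])" "y2 = ([], [(1, True)])"
  have G: "x1 \<in> carrier ?G" "x2 \<in> carrier ?G" "y1 \<in> carrier ?G" "y2 \<in> carrier ?G"
    using assms by (simp_all add: xy free_group_def)
  have comm: "\<rho> n x * \<rho> n y = \<rho> n y * \<rho> n x" if "x \<in> {x1, x2}" "y \<in> {y1, y2}" for n x y
  proof -
    have c: "x \<in> carrier ?G" "y \<in> carrier ?G" using that G by auto
    note hom = conjunct2[OF \<rho>[rule_format, of n, unfolded unitary_rep_def]]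
    have "\<rho> n (x \<otimes>\<^bsub>?G\<^esub> y) = \<rho> n x * \<rho> n y" "\<rho> n (y \<otimes>\<^bsub>?G\<^esub> x) = \<rho> n y * \<rho> n x"
      by (rule bspec[OF bspec[OF hom c(1)] c(2)], rule bspec[OF bspec[OF hom c(2)] c(1)])
    moreover have "x \<otimes>\<^bsub>?G\<^esub> y = y \<otimes>\<^bsub>?G\<^esub> x" unfolding mult using that by (auto simp: xy)
    ultimately show ?thesis by simp
  qed
  have small: "\<forall>\<^sub>F n in sequentially. hs_norm (model.phi n g - compress (model.dm n) (\<rho> n g)) < 1 / 10 ^ 8"
    if "g \<in> carrier ?G" for g
    by (rule order_tendstoD(2)[OF bspec[OF close that]]) simp
  have "\<forall>\<^sub>F n in sequentially. real (D n) / real (model.dm n) < 1 + 1 / 10 ^ 8"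
    by (rule order_tendstoD(2)[OF D(2)]) simp
  then have "\<forall>\<^sub>F n in sequentially. False"
    using small[OF G(1)] small[OF G(2)] small[OF G(3)] small[OF G(4)]
  proof eventually_elim
    case (elim n)
    have u: "\<rho> n g \<in> unitary_mats (D n)" if "g \<in> carrier ?G" for g
      by (rule bspec[OF conjunct1[OF \<rho>[rule_format, of n, unfolded unitary_rep_def]] that])
    show False
      by (rule model.not_flexibly_close[folded xy, OF D(1)[rule_format] elim(1) u[OF G(1)] u[OF G(2)] u[OF G(3)] u[OF G(4)]
            comm comm comm comm elim(2-5)]) simp_all
  qed
  then show False by simp
qed

end
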